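(* Let $K$ be a field of characteristic zero, $L$ a geometric lattice, and let $V$ be an $L$-contractible compatibly $L$-graded complex of $K$-vector spaces. Then the generalized Orlik-Solomon algebra $\tilde{\mathcal{A}}(V)=\tilde{\mathcal{A}}(L,V)$ is also $L$-contractible (as a complex of vector spaces). In particular, if in addition the maps $\partial_1|_{V_a}$, $a\in\mathbb{A}(L)$, are all injective, then the minimal complex $$\mathcal{O}\big(\mathrm{Sym}\,V_0,\ ((\partial V_a)_{\mathrm{Sym}\,V_0})_{a\in\mathbb{A}(L)}\big)\simeq\tilde{\mathcal{A}}(V)$$ is exact, where $(X)_{\mathrm{Sym}\,V_0}$ denotes the ideal of $\mathrm{Sym}\,V_0$ generated by a subspace $X\subset V_0$.
   Context: Geometric lattices. All lattices are finite. A geometric lattice $L$ is an atomic semimodular lattice with minimal element $0$, rank function $\mathrm{rk}$, $n=\mathrm{rk}\,L$; $y\prec x$ means $x$ covers $y$; $\mathbb{A}(L)$ is the set of atoms; $L_{\le x}=\{y:y\le x\}$. Elements $x_1,\dots,x_m\in L$ are dependent if $\sum_i\mathrm{rk}(x_i)>\mathrm{rk}(x_1\vee\dots\vee x_m)$. Compatible grading. A compatible $L$-grading on a chain complex $V_{n+1}=0\to V_n\to\dots\xrightarrow{\partial_i}V_{i-1}\to\dots\to V_0$ is given by submodules $V_x\subset V_{\mathrm{rk}(x)}$, $x\in L$, with $V_i=\bigoplus_{\mathrm{rk}(x)=i}V_x$ and $\partial(V_x)\subset\bigoplus_{y\prec x}V_y$ for $x\ne0$. Then $V_{\le x}=\bigoplus_{y\le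 x}V_y$ is a subcomplex graded by $L_{\le x}$. Exact means $\mathrm{Ker}\,\partial_i=\mathrm{Im}\,\partial_{i+1}$ for $i=1,\dots,n$ (surjectivity of $\partial_1$ is not required). $L$-contractible. An $L$-homotopy for $V$ is a sequence of morphisms $d_0:\mathrm{Im}\,\partial_1\to V_1$, $d_i:V_i\to V_{i+1}$ ($1\le i\le n$) with $d_{i-1}\partial_i+\partial_{i+1}d_i=\mathrm{id}_{V_i}$ for $1\le i\le n$ and $d_{\mathrm{rk}(x)}(V_x)\subset\bigoplus_{y\succ x}V_y$ for $x\ne0$. $V$ is $L$-contractible if for each $x\in L$ the $L_{\le x}$-graded complex $V_{\le x}$ admits an $L_{\le x}$-homotopy. Minimal complex. For a module $U_0$ with submodules $U_a$, $a\in\mathbb{A}(L)$, the minimal complex $\mathcal{O}(U_0,(U_a))$ is the unique compatibly $L$-graded complex $W$ with $W_0=U_0$; $W_a=U_a$ with $\partial|_{W_a}$ the inclusion; and for $\mathrm{rk}(x)=i>1$, $W_x=\mathrm{Ker}(\partial_{i-1}|_{\bigoplus_{y\prec x}W_y})$ with $\partial|_{W_x}$ the inclusion. Generalized Orlik-Solomon algebra. Let $V$ be a compatibly $L$-graded complex of $K$-vector spaces. $S=S(V)$ is the universal supercommutative algebra generated by $V$: the tensor algebra of $V$ modulo the two-sided ideal generated by all $uv-(-1)^{ij}vu$, $u\in V_i$, $v\in V_j$; it is graded by giving $V_i$ degree $i$, and $\partial$ extends to a super-derivation $\tilde\partial$ of $S$. $S$ also has a canonical grading by $L$ in which $V_x\subset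 S_x$ and $S_xS_y\subset S_{x\vee y}$. Let $I\subset S$ be the span of all products $r_1\cdots r_m$ with $r_i\in V_{x_i}$ and $x_1,\dots,x_m\in L$ dependent; it is a two-sided ideal, and $\mathcal{I}=I+\tilde\partial(I)$ is a differential ideal. Then $\tilde{\mathcal{A}}(L,V)=S/\mathcal{I}$, a differential graded algebra, which is compatibly $L$-graded by the grading induced from $S$; its degree-zero part is $\mathrm{Sym}\,V_0$. *)

theory Defs
  imports Complex_Main "HOL-Library.Poly_Mapping" "HOL-Library.Function_Algebras"
begin

section \<open>Geometric lattices\<close>

definition (in order) covers :: "'a \<Rightarrow> 'a \<Rightarrow> bool" (infix \<open>\<lessdot>\<close> 50)
  where "y \<lessdot> x \<longleftrightarrow> y < x \<and> \<not> (\<exists>z. y < z \<and> z < x)"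

definition (in order_bot) atoms :: "'a set"
  where "atoms = {a. bot \<lessdot> a}"

text \<open>A nonempty finite lattice is complete; the class \<^class>\<open>complete_lattice\<close> is used for its
  \<^const>\<open>Sup\<close>, \<^const>\<open>bot\<close> and \<^const>\<open>top\<close>.  Semimodularity is Birkhoff's covering condition.\<close>
class geometric_lattice = finite + complete_lattice +
  assumes atomic: "\<exists>A \<subseteq> atoms. x = Sup A"
    and semimodular: "inf x y \<lessdot> x \<Longrightarrow> y \<lessdot> sup x y"

text \<open>The length of a longest chain from \<^const>\<open>bot\<close> to \<open>x\<close>.\<close>
definition rk :: "'l::{finite,complete_lattice} \<Rightarrow> nat"
  where "rk x = Max {card C - 1 | C. C \<subseteq> {..x} \<and> (\<forall>y\<in>C. \<forall>z\<in>C. y \<le> z \<or> z \<le> y)}"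

definition lattice_dependent :: "'l::{finite,complete_lattice} list \<Rightarrow> bool"
  where "lattice_dependent xs \<longleftrightarrow> sum_list (map rk xs) > rk (Sup (set xs))"

section \<open>Compatibly graded complexes\<close>

definition linear_on ::
    "('k \<Rightarrow> 'a::plus \<Rightarrow> 'a) \<Rightarrow> ('k \<Rightarrow> 'b::plus \<Rightarrow> 'b) \<Rightarrow> 'a set \<Rightarrow> ('a \<Rightarrow> 'b) \<Rightarrow> bool"
  where "linear_on s s' U f \<longleftrightarrow>
    (\<forall>u\<in>U. \<forall>v\<in>U. f (u + v) = f u + f v) \<and> (\<forall>c. \<forall>u\<in>U. f (s c u) = s' c (f u))"

text \<open>The submodules \<open>V\<^sub>i\<close> (\<open>chains\<close>) and \<open>V\<^sub>x\<close> (\<open>part\<close>) all lie in one ambient vector space, in which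
  the \<open>V\<^sub>x\<close> are required to be independent, so that the single map \<open>diff\<close> on their sum
  encodes all the \<open>\<partial>\<^sub>i\<close>.\<close>
record ('v, 'l) lcomplex =
  chains :: "nat \<Rightarrow> 'v set"
  part :: "'l \<Rightarrow> 'v set"
  diff :: "'v \<Rightarrow> 'v"

definition sum_parts :: "('v::comm_monoid_add, 'l::finite) lcomplex \<Rightarrow> 'l set \<Rightarrow> 'v set"
  where "sum_parts V Q = {(\<Sum>x\<in>Q. f x) | f. \<forall>x\<in>Q. f x \<in> part V x}"

abbreviation total :: "('v::comm_monoid_add, 'l::finite) lcomplex \<Rightarrow> 'v set"
  where "total V \<equiv> sum_parts V UNIV"

definition independent_parts :: "('v::comm_monoid_add, 'l::finite) lcomplex \<Rightarrow> 'l set \<Rightarrow> bool"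
  where "independent_parts V Q \<longleftrightarrow>
    (\<forall>f. (\<forall>x\<in>Q. f x \<in> part V x) \<and> (\<Sum>x\<in>Q. f x) = 0 \<longrightarrow> (\<forall>x\<in>Q. f x = 0))"

text \<open>\<open>graded_complex s t V\<close>: \<open>V\<close> is a compatibly \<open>L\<^sub>\<le>\<^sub>t\<close>-graded complex; \<open>t = top\<close> gives \<open>L\<close> itself.
  Only the \<open>part V x\<close> with \<open>x \<le> t\<close> matter.  Since no element of \<open>L\<^sub>\<le>\<^sub>t\<close> has rank above
  \<open>rk t\<close>, the chains in those degrees are \<open>0\<close>.\<close>
definition graded_complex ::
    "('k::field \<Rightarrow> 'v::ab_group_add \<Rightarrow> 'v) \<Rightarrow> 'l::{finite,complete_lattice} \<Rightarrow> ('v, 'l) lcomplex \<Rightarrow> bool"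
  where "graded_complex s t V \<longleftrightarrow>
    (\<forall>x\<le>t. module.subspace s (part V x)) \<and>
    independent_parts V {..t} \<and>
    (\<forall>i. chains V i = sum_parts V {x. x \<le> t \<and> rk x = i}) \<and>
    linear_on s s (sum_parts V {..t}) (diff V) \<and>
    (\<forall>v\<in>chains V 0. diff V v = 0) \<and>
    (\<forall>v\<in>sum_parts V {..t}. diff V (diff V v) = 0) \<and>
    (\<forall>x\<le>t. x \<noteq> bot \<longrightarrow> diff V ` part V x \<subseteq> sum_parts V {y. y \<lessdot> x})"

definition below :: "('v::comm_monoid_add, 'l::{finite,complete_lattice}) lcomplex \<Rightarrow> 'l \<Rightarrow> ('v, 'l) lcomplex"
  where "below V t =
    \<lparr>chains = (\<lambda>i. sum_parts V {y. y \<le> t \<and> rk y = i}), part = part V, diff = diff V\<rparr>"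

definition exact_complex :: "('v::zero, 'l::{finite,complete_lattice}) lcomplex \<Rightarrow> bool"
  where "exact_complex V \<longleftrightarrow>
    (\<forall>i\<in>{1..rk (top :: 'l)}. {v \<in> chains V i. diff V v = 0} = diff V ` chains V (i + 1))"

definition L_homotopy ::
    "('k::field \<Rightarrow> 'v::ab_group_add \<Rightarrow> 'v) \<Rightarrow> 'l::{finite,complete_lattice} \<Rightarrow> ('v, 'l) lcomplex
      \<Rightarrow> (nat \<Rightarrow> 'v \<Rightarrow> 'v) \<Rightarrow> bool"
  where "L_homotopy s t V d \<longleftrightarrow>
    linear_on s s (diff V ` chains V 1) (d 0) \<and>
    d 0 ` (diff V ` chains V 1) \<subseteq> chains V 1 \<and>
    (\<forall>i\<in>{1..rk t}. linear_on s s (chains V i) (d i) \<and> d i ` chains V i \<subseteq> chains V (i + 1)) \<and>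
    (\<forall>i\<in>{1..rk t}. \<forall>v\<in>chains V i. d (i - 1) (diff V v) + diff V (d i v) = v) \<and>
    (\<forall>x\<le>t. x \<noteq> bot \<longrightarrow> d (rk x) ` part V x \<subseteq> sum_parts V {y. x \<lessdot> y \<and> y \<le> t})"

definition L_contractible ::
    "('k::field \<Rightarrow> 'v::ab_group_add \<Rightarrow> 'v) \<Rightarrow> ('v, 'l::{finite,complete_lattice}) lcomplex \<Rightarrow> bool"
  where "L_contractible s V \<longleftrightarrow>
    graded_complex s top V \<and> (\<forall>t. \<exists>d. L_homotopy s t (below V t) d)"

definition lcomplex_iso ::
    "('k \<Rightarrow> 'v::comm_monoid_add \<Rightarrow> 'v) \<Rightarrow> ('k \<Rightarrow> 'w::comm_monoid_add \<Rightarrow> 'w) \<Rightarrow>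
      ('v, 'l::finite) lcomplex \<Rightarrow> ('w, 'l) lcomplex \<Rightarrow> ('v \<Rightarrow> 'w) \<Rightarrow> bool"
  where "lcomplex_iso s s' V W \<phi> \<longleftrightarrow>
    linear_on s s' (total V) \<phi> \<and> bij_betw \<phi> (total V) (total W) \<and>
    (\<forall>i. \<phi> ` chains V i = chains W i) \<and> (\<forall>x. \<phi> ` part V x = part W x) \<and>
    (\<forall>v\<in>total V. \<phi> (diff V v) = diff W (\<phi> v))"

section \<open>The minimal complex\<close>

text \<open>For \<open>rk x > 1\<close> an element of \<open>W\<^sub>x\<close> is a family \<open>(w\<^sub>y)\<close> indexed by the \<open>y \<lessdot> x\<close>,
  whose members are such families again.  Unfolding this, we realise \<open>W\<close> inside the functions from lists of
  lattice elements to \<open>U\<^sub>0\<close>: \<open>at_base u\<close> is \<open>u \<in> U\<^sub>0\<close> as an element of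
  \<open>W\<^sub>0\<close>, and \<open>push x w\<close> is the copy of \<open>w\<close> in the summand \<open>W\<^sub>x\<close>, so that
  \<open>min_diff (push x w) = w\<close>, that is, the differential on \<open>W\<^sub>x\<close> is the inclusion.\<close>
definition at_base :: "'u::zero \<Rightarrow> 'l list \<Rightarrow> 'u"
  where "at_base u = (\<lambda>l. case l of [] \<Rightarrow> u | _ # _ \<Rightarrow> 0)"

definition push :: "'l \<Rightarrow> ('l list \<Rightarrow> 'u::zero) \<Rightarrow> 'l list \<Rightarrow> 'u"
  where "push x w = (\<lambda>l. case l of [] \<Rightarrow> 0 | z # c \<Rightarrow> (if z = x then w c else 0))"

definition min_diff :: "('l::finite list \<Rightarrow> 'u::comm_monoid_add) \<Rightarrow> 'l list \<Rightarrow> 'u"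
  where "min_diff w = (\<lambda>c. \<Sum>x\<in>UNIV. w (x # c))"

inductive min_part ::
    "'u::comm_monoid_add set \<Rightarrow> ('l::{finite,complete_lattice} \<Rightarrow> 'u set) \<Rightarrow> 'l \<Rightarrow> ('l list \<Rightarrow> 'u) \<Rightarrow> bool"
  for U0 :: "'u set" and U :: "'l \<Rightarrow> 'u set"
  where
    base: "u \<in> U0 \<Longrightarrow> min_part U0 U bot (at_base u)"
  | atom: "a \<in> atoms \<Longrightarrow> u \<in> U a \<Longrightarrow> min_part U0 U a (push a (at_base u))"
  | kernel: "rk x > 1 \<Longrightarrow> (\<forall>y\<in>{y. y \<lessdot> x}. min_part U0 U y (f y)) \<Longrightarrow>
      min_diff (\<Sum>y\<in>{y. y \<lessdot> x}. f y) = 0 \<Longrightarrow>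
      min_part U0 U x (push x (\<Sum>y\<in>{y. y \<lessdot> x}. f y))"

definition minimal_complex ::
    "'u::comm_monoid_add set \<Rightarrow> ('l::{finite,complete_lattice} \<Rightarrow> 'u set) \<Rightarrow> ('l list \<Rightarrow> 'u, 'l) lcomplex"
  where "minimal_complex U0 U =
    \<lparr>chains = (\<lambda>i. {(\<Sum>x\<in>{x. rk x = i}. f x) | f. \<forall>x. rk x = i \<longrightarrow> min_part U0 U x (f x)}),
     part = (\<lambda>x. {w. min_part U0 U x w}), diff = min_diff\<rparr>"

section \<open>Quotients, tensor algebras and symmetric algebras\<close>

text \<open>A quotient vector space cannot be a type depending on the parameters, so \<open>W / N\<close> is realised
  as the image of \<open>W\<close> under a linear projection with kernel \<open>N\<close>; the projection plays the
  role of the quotient map, and each \<open>quot_map s N v\<close> is congruent to \<open>v\<close> modulo \<open>N\<close>.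
  The result does not depend on the projection up to canonical isomorphism.\<close>
definition quot_map :: "('k::field \<Rightarrow> 'v::ab_group_add \<Rightarrow> 'v) \<Rightarrow> 'v set \<Rightarrow> 'v \<Rightarrow> 'v"
  where "quot_map s N = (SOME p. Vector_Spaces.linear s s p \<and> (\<forall>v. p (p v) = p v) \<and> (\<forall>v. p v = 0 \<longleftrightarrow> v \<in> N))"

lemma quot_map:
  assumes "vector_space s" and N: "module.subspace s N"
  shows "Vector_Spaces.linear s s (quot_map s N)" (is ?L)
    and "quot_map s N (quot_map s N v) = quot_map s N v" (is ?I)
    and "quot_map s N v = 0 \<longleftrightarrow> v \<in> N" (is ?K)
proof -
  interpret vector_space s by fact
  interpret vector_space_pair s s ..
  have "subspace N" using N by simp
  obtain B where B: "B \<subseteq> N" "independent B" "span B = N"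
    using basis_exists[of N] \<open>subspace N\<close> by (metis span_minimal subset_antisym)
  define E where "E = extend_basis B"
  have E: "B \<subseteq> E" "independent E" "span E = UNIV"
    using extend_basis_superset independent_extend_basis span_extend_basis B(2) by (auto simp: E_def)
  define p where "p = construct E (\<lambda>b. if b \<in> B then 0 else b)"
  have lin: "Vector_Spaces.linear s s p" unfolding p_def by (rule linear_construct[OF E(2)])
  interpret p: Vector_Spaces.linear s s p by (rule lin)
  have pb: "p b = (if b \<in> B then 0 else b)" if "b \<in> E" for b
    unfolding p_def using construct_basis[OF E(2) that] .
  have p0: "p v = 0" if "v \<in> N" for v
    using that[folded B(3)] by (rule p.eq_0_on_span[rotated]) (use E pb in auto)
  have dif: "v - p v \<in> N" for v
  proof -
    have "v \<in> span E" using E(3) by simp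
    then show ?thesis
    proof (induction rule: span_induct_alt)
      case base show ?case using subspace_0[OF \<open>subspace N\<close>] by simp
    next
      case (step c b y)
      have "b - p b \<in> N" using pb[OF step(1)] B(1) subspace_0[OF \<open>subspace N\<close>] by auto
      then have "s c (b - p b) + (y - p y) \<in> N"
        using step(2) \<open>subspace N\<close> by (blast intro: subspace_add subspace_scale)
      then show ?case by (simp add: p.add p.scale algebra_simps)
    qed
  qed
  have ker: "p v = 0 \<longleftrightarrow> v \<in> N" for v using p0 dif[of v] by fastforce
  have idem: "p (p v) = p v" for v using p0[OF dif[of v]] by (simp add: p.diff)
  have "Vector_Spaces.linear s s (quot_map s N) \<and> (\<forall>v. quot_map s N (quot_map s N v) = quot_map s N v)
      \<and> (\<forall>v. quot_map s N v = 0 \<longleftrightarrow> v \<in> N)"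
    unfolding quot_map_def by (rule someI[of _ p]) (use lin ker idem in auto)
  then show ?L ?I ?K by auto
qed

text \<open>Words under concatenation, so that \<open>'v list \<Rightarrow>\<^sub>0 'k\<close> is the free associative algebra on \<open>'v\<close>.\<close>
instantiation list :: (type) monoid_add
begin

definition "0 = []"
definition "xs + ys = xs @ ys"

instance by standard (simp_all add: zero_list_def plus_list_def)

end

definition fscale :: "'k::comm_ring_1 \<Rightarrow> ('w \<Rightarrow>\<^sub>0 'k) \<Rightarrow> 'w \<Rightarrow>\<^sub>0 'k"
  where "fscale c = Poly_Mapping.map ((*) c)"

lemma lookup_fscale: "Poly_Mapping.lookup (fscale c p) w = c * Poly_Mapping.lookup p w"
  by (simp add: fscale_def map.rep_eq when_def)

lemma vector_space_fscale: "vector_space (fscale :: 'k::field \<Rightarrow> ('w \<Rightarrow>\<^sub>0 'k) \<Rightarrow> 'w \<Rightarrow>\<^sub>0 'k)"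
  by standard (auto intro!: poly_mapping_eqI simp: lookup_add lookup_fscale algebra_simps)

definition word :: "'v list \<Rightarrow> 'v list \<Rightarrow>\<^sub>0 'k::comm_ring_1"
  where "word vs = Poly_Mapping.single vs 1"

abbreviation gen :: "'v \<Rightarrow> 'v list \<Rightarrow>\<^sub>0 'k::comm_ring_1"
  where "gen v \<equiv> word [v]"

definition free_alg :: "'v set \<Rightarrow> ('v list \<Rightarrow>\<^sub>0 'k::comm_ring_1) set"
  where "free_alg X = {p. \<forall>w\<in>Poly_Mapping.keys p. set w \<subseteq> X}"

definition linear_rels ::
    "('k::comm_ring_1 \<Rightarrow> 'v::plus \<Rightarrow> 'v) \<Rightarrow> 'v set \<Rightarrow> ('v list \<Rightarrow>\<^sub>0 'k) set"
  where "linear_rels s X =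
    {gen (u + v) - gen u - gen v | u v. u \<in> X \<and> v \<in> X} \<union>
    {gen (s c u) - fscale c (gen u) | c u. u \<in> X}"

text \<open>The tensor algebra \<open>T(X)\<close> of a vector space \<open>X\<close> is the free algebra on the set \<open>X\<close> modulo the
  ideal generated by \<open>linear_rels\<close>.  Hence a quotient of \<open>T(X)\<close> by the two-sided ideal generated by \<open>R\<close> is
  \<open>free_alg X\<close> modulo the following ideal.\<close>
definition tensor_ideal ::
    "('k::field \<Rightarrow> 'v::plus \<Rightarrow> 'v) \<Rightarrow> 'v set \<Rightarrow> ('v list \<Rightarrow>\<^sub>0 'k) set \<Rightarrow> ('v list \<Rightarrow>\<^sub>0 'k) set"
  where "tensor_ideal s X R = module.span fscale
    {a * r * b | a r b. a \<in> free_alg X \<and> b \<in> free_alg X \<and> r \<in> linear_rels s X \<union> R}"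

definition sym_class ::
    "('k::field \<Rightarrow> 'v::plus \<Rightarrow> 'v) \<Rightarrow> 'v set \<Rightarrow> ('v list \<Rightarrow>\<^sub>0 'k) \<Rightarrow> 'v list \<Rightarrow>\<^sub>0 'k"
  where "sym_class s X = quot_map fscale
    (tensor_ideal s X {gen u * gen v - gen v * gen u | u v. u \<in> X \<and> v \<in> X})"

definition Sym :: "('k::field \<Rightarrow> 'v::plus \<Rightarrow> 'v) \<Rightarrow> 'v set \<Rightarrow> ('v list \<Rightarrow>\<^sub>0 'k) set"
  where "Sym s X = sym_class s X ` free_alg X"

text \<open>The ideal of \<open>Sym s X\<close> generated by \<open>Y \<subseteq> X\<close>; the product of \<open>a, b \<in> Sym s X\<close> is \<open>sym_class s X (a * b)\<close>.\<close>
definition Sym_ideal ::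
    "('k::field \<Rightarrow> 'v::plus \<Rightarrow> 'v) \<Rightarrow> 'v set \<Rightarrow> 'v set \<Rightarrow> ('v list \<Rightarrow>\<^sub>0 'k) set"
  where "Sym_ideal s X Y = module.span fscale
    {sym_class s X (a * sym_class s X (gen y)) | a y. a \<in> Sym s X \<and> y \<in> Y}"

section \<open>The generalized Orlik-Solomon algebra\<close>

definition S_class ::
    "('k::field \<Rightarrow> 'v::ab_group_add \<Rightarrow> 'v) \<Rightarrow> ('v, 'l::{finite,complete_lattice}) lcomplex \<Rightarrow>
      ('v list \<Rightarrow>\<^sub>0 'k) \<Rightarrow> 'v list \<Rightarrow>\<^sub>0 'k"
  where "S_class s V = quot_map fscale (tensor_ideal s (total V)
    {gen u * gen v - (- 1) ^ (i * j) * (gen v * gen u) | u v i j. u \<in> chains V i \<and> v \<in> chains V j})"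

definition S_alg ::
    "('k::field \<Rightarrow> 'v::ab_group_add \<Rightarrow> 'v) \<Rightarrow> ('v, 'l::{finite,complete_lattice}) lcomplex \<Rightarrow> ('v list \<Rightarrow>\<^sub>0 'k) set"
  where "S_alg s V = S_class s V ` free_alg (total V)"

definition S_mult ::
    "('k::field \<Rightarrow> 'v::ab_group_add \<Rightarrow> 'v) \<Rightarrow> ('v, 'l::{finite,complete_lattice}) lcomplex \<Rightarrow>
      ('v list \<Rightarrow>\<^sub>0 'k) \<Rightarrow> ('v list \<Rightarrow>\<^sub>0 'k) \<Rightarrow> 'v list \<Rightarrow>\<^sub>0 'k"
  where "S_mult s V a b = S_class s V (a * b)"

text \<open>\<open>S_class s V (word [r\<^sub>1, \<dots>, r\<^sub>m])\<close> is the product \<open>r\<^sub>1 \<cdots> r\<^sub>m\<close> in \<open>S\<close>.\<close>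
definition S_deg ::
    "('k::field \<Rightarrow> 'v::ab_group_add \<Rightarrow> 'v) \<Rightarrow> ('v, 'l::{finite,complete_lattice}) lcomplex \<Rightarrow>
      nat \<Rightarrow> ('v list \<Rightarrow>\<^sub>0 'k) set"
  where "S_deg s V i = module.span fscale
    {S_class s V (word rs) | rs js. list_all2 (\<lambda>r j. r \<in> chains V j) rs js \<and> sum_list js = i}"

definition S_part ::
    "('k::field \<Rightarrow> 'v::ab_group_add \<Rightarrow> 'v) \<Rightarrow> ('v, 'l::{finite,complete_lattice}) lcomplex \<Rightarrow>
      'l \<Rightarrow> ('v list \<Rightarrow>\<^sub>0 'k) set"
  where "S_part s V x = module.span fscale
    {S_class s V (word rs) | rs xs. list_all2 (\<lambda>r y. r \<in> part V y) rs xs \<and> Sup (set xs) = x}"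

text \<open>The extension of \<open>\<partial>\<close> to a super-derivation of \<open>S\<close>; on \<open>S\<close> it is unique because
  \<open>S\<close> is generated by the \<open>V\<^sub>i\<close>.\<close>
definition S_diff ::
    "('k::field \<Rightarrow> 'v::ab_group_add \<Rightarrow> 'v) \<Rightarrow> ('v, 'l::{finite,complete_lattice}) lcomplex \<Rightarrow>
      ('v list \<Rightarrow>\<^sub>0 'k) \<Rightarrow> 'v list \<Rightarrow>\<^sub>0 'k"
  where "S_diff s V = (SOME D.
    linear_on fscale fscale (S_alg s V) D \<and> D ` S_alg s V \<subseteq> S_alg s V \<and>
    (\<forall>v\<in>total V. D (S_class s V (gen v)) = S_class s V (gen (diff V v))) \<and>
    (\<forall>i. \<forall>a\<in>S_deg s V i. \<forall>b\<in>S_alg s V.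
      D (S_mult s V a b) = S_mult s V (D a) b + (- 1) ^ i * S_mult s V a (D b)))"

definition dependent_ideal ::
    "('k::field \<Rightarrow> 'v::ab_group_add \<Rightarrow> 'v) \<Rightarrow> ('v, 'l::{finite,complete_lattice}) lcomplex \<Rightarrow> ('v list \<Rightarrow>\<^sub>0 'k) set"
  where "dependent_ideal s V = module.span fscale
    {S_class s V (word rs) | rs xs. list_all2 (\<lambda>r y. r \<in> part V y) rs xs \<and> lattice_dependent xs}"

definition OS_ideal ::
    "('k::field \<Rightarrow> 'v::ab_group_add \<Rightarrow> 'v) \<Rightarrow> ('v, 'l::{finite,complete_lattice}) lcomplex \<Rightarrow> ('v list \<Rightarrow>\<^sub>0 'k) set"
  where "OS_ideal s V = {a + S_diff s V b | a b. a \<in> dependent_ideal s V \<and> b \<in> dependent_ideal s V}"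

text \<open>The quotient map \<open>S \<rightarrow> S / OS_ideal\<close>.\<close>
definition OS_class ::
    "('k::field \<Rightarrow> 'v::ab_group_add \<Rightarrow> 'v) \<Rightarrow> ('v, 'l::{finite,complete_lattice}) lcomplex \<Rightarrow>
      ('v list \<Rightarrow>\<^sub>0 'k) \<Rightarrow> 'v list \<Rightarrow>\<^sub>0 'k"
  where "OS_class s V = quot_map fscale (OS_ideal s V)"

text \<open>Elements of the quotient are their own representatives in \<open>S\<close> (\<^const>\<open>quot_map\<close> is a
  projection), which gives the induced differential.\<close>
definition OS_algebra ::
    "('k::field \<Rightarrow> 'v::ab_group_add \<Rightarrow> 'v) \<Rightarrow> ('v, 'l::{finite,complete_lattice}) lcomplex \<Rightarrow>
      ('v list \<Rightarrow>\<^sub>0 'k, 'l) lcomplex"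
  where "OS_algebra s V =
    \<lparr>chains = (\<lambda>i. OS_class s V ` S_deg s V i),
     part = (\<lambda>x. OS_class s V ` S_part s V x),
     diff = (\<lambda>a. OS_class s V (S_diff s V a))\<rparr>"

end

theory Submission
  imports Defs
begin

text \<open>Let \<open>d\<close> be the homotopy of \<open>V\<^sub>\<le>\<^sub>t\<close>, extended to \<open>V\<^sub>0\<close> through a projection onto \<open>Im \<partial>\<^sub>1\<close>, and let
  \<open>D\<close>, \<open>D'\<close> be the super-derivations of \<open>S\<close> extending \<open>\<partial>\<close> and \<open>d\<close>.  On words in \<open>V\<^sub>\<le>\<^sub>t\<close> the
  anticommutator \<open>D D' + D' D\<close> is the Euler derivation \<open>E\<close> counting the letters outside a complement of
  \<open>Im \<partial>\<^sub>1\<close> in \<open>V\<^sub>0\<close>.  It is diagonalizable and, in characteristic zero, invertible in positive degrees.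
  By semimodularity \<open>D'\<close> maps dependent words to dependent words, so \<open>D'\<close> and \<open>E\<close> act on the
  quotient, where the inverse of \<open>E\<close> composed with \<open>D'\<close> is the homotopy.  The ideal is \<open>L\<close>-graded because
  the algebra maps deleting all letters outside \<open>L\<^sub>\<le>\<^sub>t\<close> respect it; for \<open>t = 0\<close> they also identify
  the degree zero part with \<open>Sym V\<^sub>0\<close>.

  Contractibility of \<open>A\<^sub>\<le>\<^sub>x\<close> makes \<open>\<partial>\<close> an isomorphism from \<open>A\<^sub>x\<close> onto the cycles in the sum of
  the \<open>A\<^sub>y\<close> with \<open>y\<close> covered by \<open>x\<close> (and injective if \<open>x\<close> is an atom), so a contractible complex
  is minimal.\<close>

section \<open>Rank in geometric lattices\<close>

text \<open>A quotient is the image of a projection picked by \<open>quot_map\<close>, so its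
  elements are representatives about which nothing is known. All maps are therefore built on the
  free algebra whose letters are bare vectors, where values on words can be prescribed freely, and
  congruences are tracked: modulo \<open>J\<close> for S, modulo \<open>K t\<close> for the ideal
  below \<open>t\<close>. Even \<open>gen (s c v)\<close> and \<open>fscale c (gen v)\<close> agree
  only modulo \<open>J\<close>. The obstacle is that the ideal is I + D(I), while only I is visibly
  stable under D'. The anticommutator settles this: D' D b = E b - D D' b, and both E and D'
  preserve I. Moreover E commutes with D because D D vanishes, so inverting E turns D D' + D' D = E
  into the homotopy identity. The eigenvalues of E count letters of a word, hence are positive
  integers off degree zero; dividing by them uses characteristic zero.\<close>

text \<open>Since \<open>inf x (sup y z)\<close> lies between \<open>y\<close> and \<open>x\<close>,
  it is one of the two. In the first case \<open>semimodular\<close> applies, in the second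
  \<open>x\<close> is already below \<open>sup y z\<close>.\<close>

lemma covers_sup:
  fixes x y z :: "'l::geometric_lattice"
  assumes "y \<lessdot> x"
  shows "sup y z = sup x z \<or> sup y z \<lessdot> sup x z"
proof -
  let ?w = "sup y z"
  have yx: "y < x" "\<And>u. y < u \<Longrightarrow> u < x \<Longrightarrow> False" using assms by (auto simp: covers_def)
  have s: "sup x z = sup x ?w" using yx(1) by (simp add: sup.absorb1 sup_assoc[symmetric])
  have "y \<le> inf x ?w" "inf x ?w \<le> x" using yx(1) by auto
  then have "inf x ?w = y \<or> inf x ?w = x" using yx(2) by (metis order_le_imp_less_or_eq)
  then show ?thesis
  proof
    assume "inf x ?w = y"
    then have "?w \<lessdot> sup x ?w" using semimodular[of x ?w] assms by simp
    then show ?thesis by (simp add: s)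
  next
    assume "inf x ?w = x"
    then show ?thesis unfolding s by (metis inf.absorb_iff1 sup.absorb2)
  qed
qed

section \<open>Comparison of chains and the jump of the rank along covers\<close>

text \<open>The lower end is a parameter because the comparison of chain lengths proceeds by raising
  it one cover at a time.\<close>

definition chain_in :: "'l::order \<Rightarrow> 'l \<Rightarrow> 'l set \<Rightarrow> bool"
  where "chain_in a x C \<longleftrightarrow> C \<subseteq> {a..x} \<and> (\<forall>y\<in>C. \<forall>z\<in>C. y \<le> z \<or> z \<le> y)"

lemma exists_upper_cover:
  fixes a x :: "'l::{finite,order}"
  assumes "a < x"
  obtains b where "a \<lessdot> b" "b \<le> x"
proof -
  have "{b. a < b \<and> b \<le> x} \<noteq> {}" using assms by auto
  then obtain b where b: "a < b" "b \<le> x" "\<And>c. a < c \<Longrightarrow> c \<le> x \<Longrightarrow> c \<le> b \<Longrightarrow> b = c"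
    using finite_has_minimal[OF finite, of "{b. a < b \<and> b \<le> x}"] by blast
  have "\<not> (a < z \<and> z < b)" for z
    using b(3)[of z] b(2) by (metis order_less_imp_le order_less_irrefl order_trans)
  then have "a \<lessdot> b" using b(1) unfolding covers_def by blast
  then show thesis using that b(2) by blast
qed

lemma exists_lower_cover:
  fixes a x :: "'l::{finite,order}"
  assumes "a < x"
  obtains y where "a \<le> y" "y \<lessdot> x"
proof -
  have "{b. a \<le> b \<and> b < x} \<noteq> {}" using assms by auto
  then obtain b where b: "a \<le> b" "b < x" "\<And>c. a \<le> c \<Longrightarrow> c < x \<Longrightarrow> b \<le> c \<Longrightarrow> b = c"
    using finite_has_maximal[OF finite, of "{b. a \<le> b \<and> b < x}"] by blast
  have "\<not> (b < z \<and> z < x)" for z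
    using b(3)[of z] b(1) by (metis order_less_imp_le order_less_irrefl order_trans)
  then have "b \<lessdot> x" using b(2) unfolding covers_def by blast
  then show thesis using that b(1) by blast
qed

text \<open>Joining a chain with an atom \<open>b\<close> of the interval identifies at most one pair of its elements:
  \<open>c < c'\<close> with \<open>sup b c = sup b c'\<close> forces \<open>c' = sup b c\<close>, since \<open>sup b c\<close> covers \<open>c\<close>.\<close>
lemma chain_in_join_cover:
  fixes a b x :: "'l::geometric_lattice"
  assumes C: "chain_in a x C" and b: "a \<lessdot> b" "b \<le> x"
  shows "\<exists>C'. chain_in b x C' \<and> card C \<le> card C' + 1"
proof (intro exI conjI)
  let ?C' = "sup b ` C"
  have comp: "\<And>y z. y \<in> C \<Longrightarrow> z \<in> C \<Longrightarrow> y \<le> z \<or> z \<le> y" and ax: "\<And>y. y \<in> C \<Longrightarrow> a \<le> y \<and> y \<le> x"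
    using C by (auto simp: chain_in_def)
  have "?C' \<subseteq> {b..x}" using ax b(2) by auto
  moreover have "sup b y \<le> sup b z \<or> sup b z \<le> sup b y" if "y \<in> C" "z \<in> C" for y z
    using comp[OF that] by (metis sup.mono order_refl)
  ultimately show "chain_in b x ?C'" unfolding chain_in_def by blast
  have key: "c' = sup b c \<and> \<not> b \<le> c" if "c \<in> C" "c' \<in> C" "c < c'" "sup b c = sup b c'" for c c'
  proof -
    have nb: "\<not> b \<le> c"
    proof
      assume "b \<le> c"
      moreover from this have "b \<le> c'" using that(3) by (meson less_imp_le order_trans)
      ultimately have "c = c'" using that(4) by (metis sup_absorb2)
      then show False using that(3) by simp
    qed
    have "sup a c = c" using ax[OF that(1)] by (metis sup_absorb2)
    then have "c = sup b c \<or> c \<lessdot> sup b c" using covers_sup[OF b(1), of c] by simp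
    moreover have "c \<noteq> sup b c" using nb by (metis sup.cobounded1)
    ultimately have "c \<lessdot> sup b c" by simp
    moreover have "c' \<le> sup b c" using that(4) by simp
    ultimately have "c' = sup b c" using that(3) unfolding covers_def by (metis order.order_iff_strict)
    then show ?thesis using nb by simp
  qed
  show "card C \<le> card ?C' + 1"
  proof (cases "\<exists>c\<in>C. \<exists>c'\<in>C. c < c' \<and> sup b c = sup b c'")
    case False
    then have "inj_on (sup b) C" by (intro inj_onI) (metis comp order.order_iff_strict)
    then show ?thesis by (simp add: card_image)
  next
    case True
    then obtain c c' where c: "c \<in> C" "c' \<in> C" "c < c'" "sup b c = sup b c'" by blast
    \<comment> \<open>With two collapsing pairs, \<open>f\<close> would lie between \<open>e\<close>
      and \<open>e' = sup b e\<close>, so \<open>e < f\<close> would collapse as well. Then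
      \<open>key\<close> makes \<open>f\<close> equal to \<open>sup b e\<close>, which lies above
      \<open>b\<close>, and the same fact for \<open>f\<close> forbids that.\<close>
    have pair: False
      if e: "e \<in> C" "e' \<in> C" "e < e'" "sup b e = sup b e'" and f: "f \<in> C" "f' \<in> C" "f < f'" "sup b f = sup b f'"
        and "e < f" for e e' f f'
    proof -
      have k: "e' = sup b e" "\<not> b \<le> f" using key[OF e] key[OF f] by blast+
      then have "\<not> e' \<le> f" by (metis le_sup_iff)
      then have "f \<le> e'" using comp[OF f(1) e(2)] by blast
      then have "sup b f \<le> sup b e" using k(1) by simp
      moreover have "sup b e \<le> sup b f" using \<open>e < f\<close> by (intro sup.mono) auto
      ultimately have "sup b e = sup b f" by (rule antisym[rotated])
      then have "f = sup b e" using key[OF e(1) f(1) \<open>e < f\<close>] by blast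
      then show False using k(2) by (metis sup.cobounded1)
    qed
    have "inj_on (sup b) (C - {c})"
    proof (rule inj_onI)
      have gen: False if d: "d \<in> C - {c}" "d' \<in> C - {c}" "sup b d = sup b d'" "d < d'" for d d'
      proof -
        have dC: "d \<in> C" "d' \<in> C" using d by auto
        have "c < d \<or> d < c" using comp[of c d] c(1) d(1) by auto
        then show False using pair[OF c dC d(4,3)] pair[OF dC d(4,3) c] by blast
      qed
      fix d d' assume d: "d \<in> C - {c}" "d' \<in> C - {c}" "sup b d = sup b d'"
      show "d = d'"
        using gen[OF d] gen[OF d(2,1) d(3)[symmetric]] comp[of d d'] d(1,2)
        by (metis DiffD1 order_le_imp_less_or_eq)
    qed
    then have "card (C - {c}) \<le> card ?C'"
      by (metis card_image card_mono finite image_mono Diff_subset)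
    then show ?thesis using c(1) by simp
  qed
qed

text \<open>Raise \<open>a\<close> to a cover \<open>b\<close> below \<open>y\<close>: the join with
  \<open>b\<close> costs at most one element of the chain, and putting \<open>a\<close> back under
  the chain found in \<open>{b..y}\<close> regains one. This is the part of the Jordan-Dedekind
  condition that \<open>rk_covers\<close> needs.\<close>

lemma chain_in_lower_cover:
  fixes a x y :: "'l::geometric_lattice"
  assumes "y \<lessdot> x" "a \<le> y" "chain_in a x C"
  shows "\<exists>C'. chain_in a y C' \<and> card C \<le> card C' + 1"
  using assms(2,3)
proof (induction "card {a..x}" arbitrary: a C rule: less_induct)
  case less
  have yx: "y < x" using assms(1) by (simp add: covers_def)
  show ?case
  proof (cases "a = y")
    case True
    then have "C \<subseteq> {y, x}" using less.prems assms(1) unfolding chain_in_def covers_def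
      by (auto simp: subset_iff) (metis order.order_iff_strict)
    then have "card C \<le> 2" by (metis card_2_iff card_mono finite yx less_irrefl)
    moreover have "chain_in a y {y}" using True by (simp add: chain_in_def)
    ultimately show ?thesis by (intro exI[of _ "{y}"]) simp
  next
    case False
    then have "a < y" using less.prems by simp
    then obtain b where b: "a \<lessdot> b" "b \<le> y" by (rule exists_upper_cover)
    have ab: "a < b" using b by (simp add: covers_def)
    obtain C1 where C1: "chain_in b x C1" "card C \<le> card C1 + 1"
      using chain_in_join_cover[OF less.prems(2) b(1)] b(2) yx by (meson less_imp_le order_trans)
    have "{b..x} \<subset> {a..x}" using ab \<open>a < y\<close> yx by auto
    then have "card {b..x} < card {a..x}" by (simp add: psubset_card_mono)
    then obtain C2 where C2: "chain_in b y C2" "card C1 \<le> card C2 + 1"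
      using less.hyps[OF _ b(2) C1(1)] by blast
    have "a \<notin> C2" using C2 ab unfolding chain_in_def by (meson atLeastAtMost_iff leD subsetD)
    moreover have "chain_in a y (insert a C2)" using C2(1) ab \<open>a < y\<close>
      unfolding chain_in_def by (auto simp: subset_iff intro: less_imp_le order_trans)
    ultimately show ?thesis using C1 C2 by (intro exI[of _ "insert a C2"]) simp
  qed
qed

lemma rk_alt: "rk x = Max {card C - 1 | C. chain_in bot x C}"
  unfolding rk_def chain_in_def by (simp add: atLeastAtMost_def atLeast_def)

lemma card_chain_le_rk:
  assumes "chain_in bot x C" shows "card C \<le> rk x + 1"
proof -
  have "card C - 1 \<le> rk x" unfolding rk_alt using assms by (intro Max_ge) auto
  then show ?thesis by simp
qed

lemma rk_chain:
  obtains C where "chain_in bot x C" "card C = rk x + 1"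
proof -
  have "{} \<noteq> {card C - 1 | C. chain_in bot x C}" by (auto simp: chain_in_def)
  then have "rk x \<in> {card C - 1 | C. chain_in bot x C}"
    unfolding rk_alt by (intro Max_in) auto
  then obtain C where C: "chain_in bot x C" "rk x = card C - 1" by auto
  show thesis
  \<comment> \<open>The truncated \<open>card C - 1\<close> is 0 for the empty chain too, which is
    then replaced by \<open>{bot}\<close>.\<close>
  proof (cases "C = {}")
    case True
    then show ?thesis using C that[of "{bot}"] by (simp add: chain_in_def)
  next
    case False
    then have "0 < card C" by (simp add: card_gt_0_iff)
    then show ?thesis using C that[of C] by simp
  qed
qed

lemma rk_less:
  fixes x y :: "'l::{finite,complete_lattice}"
  assumes "y < x" shows "rk y < rk x"
proof -
  obtain C where C: "chain_in bot y C" "card C = rk y + 1" by (rule rk_chain)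
  have "x \<notin> C" using C(1) assms by (auto simp: chain_in_def)
  moreover have "chain_in bot x (insert x C)"
    using C(1) assms unfolding chain_in_def by (auto simp: subset_iff intro: less_imp_le order_trans)
  ultimately show ?thesis using card_chain_le_rk[of x "insert x C"] C(2) by simp
qed

lemma rk_mono: "y \<le> x \<Longrightarrow> rk y \<le> rk x"
  by (metis rk_less order.order_iff_strict less_imp_le)

lemma rk_bot [simp]: "rk (bot :: 'l::{finite,complete_lattice}) = 0"
proof -
  obtain C where C: "chain_in bot (bot::'l) C" "card C = rk (bot::'l) + 1" by (rule rk_chain)
  have "C \<subseteq> {bot}" using C(1) by (auto simp: chain_in_def)
  then have "card C \<le> 1" using card_mono[of "{bot}" C] by simp
  then show ?thesis using C(2) by simp
qed

lemma rk_eq_0_iff [simp]: "rk x = 0 \<longleftrightarrow> x = bot"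
  using rk_less[of bot x] by (cases "x = bot") (simp_all add: bot.not_eq_extremum)

lemma rk_covers:
  fixes x y :: "'l::geometric_lattice"
  assumes "y \<lessdot> x" shows "rk x = Suc (rk y)"
proof -
  obtain C where C: "chain_in bot x C" "card C = rk x + 1" by (rule rk_chain)
  obtain C' where "chain_in bot y C'" "card C \<le> card C' + 1"
    using chain_in_lower_cover[OF assms _ C(1)] by auto
  then have "rk x \<le> Suc (rk y)" using card_chain_le_rk[of y C'] C(2) by simp
  moreover have "rk y < rk x" using assms by (intro rk_less) (simp add: covers_def)
  ultimately show ?thesis by simp
qed

lemma covers_iff_rk:
  fixes x y :: "'l::geometric_lattice"
  shows "y \<lessdot> x \<longleftrightarrow> y \<le> x \<and> rk x = Suc (rk y)"
proof
  assume "y \<lessdot> x" then show "y \<le> x \<and> rk x = Suc (rk y)"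
    using rk_covers[of y x] by (simp add: covers_def less_imp_le)
next
  assume a: "y \<le> x \<and> rk x = Suc (rk y)"
  then have "y < x" by (metis n_not_Suc_n order.order_iff_strict)
  moreover have "\<not> (y < z \<and> z < x)" for z using a rk_less[of y z] rk_less[of z x] by linarith
  ultimately show "y \<lessdot> x" by (auto simp: covers_def)
qed

definition level :: "'l::{finite,complete_lattice} \<Rightarrow> nat \<Rightarrow> 'l set"
  where "level t i = {y. y \<le> t \<and> rk y = i}"

lemma level_0: "level t 0 = {bot}"
  by (auto simp: level_def)

lemma level_top: "level top i = {y. rk y = i}"
  by (simp add: level_def)

lemma atoms_iff_rk: "(a::'l::geometric_lattice) \<in> atoms \<longleftrightarrow> rk a = 1"
  by (simp add: atoms_def covers_iff_rk)

lemma rk_sup_covers: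
  fixes x y z :: "'l::geometric_lattice"
  assumes "y \<lessdot> x" shows "rk (sup x z) \<le> Suc (rk (sup y z))"
  using covers_sup[OF assms, of z] rk_covers[of "sup y z" "sup x z"] by auto

text \<open>Each cover on a way from \<open>bot\<close> up to \<open>x\<close> raises the rank of
  the join with \<open>y\<close> by at most one.\<close>

lemma rk_sup_le:
  fixes x y :: "'l::geometric_lattice"
  shows "rk (sup x y) \<le> rk x + rk y"
proof (induction "rk x" arbitrary: x)
  case 0 then show ?case by simp
next
  case (Suc n)
  then have "x \<noteq> bot" by auto
  then have "bot < x" by (simp add: bot.not_eq_extremum)
  then obtain w where w: "w \<lessdot> x" by (rule exists_lower_cover)
  then have "n = rk w" using Suc(2) rk_covers[OF w] by linarith
  then have "rk (sup w y) \<le> rk w + rk y" by (rule Suc(1))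
  then show ?case using rk_sup_covers[OF w, of y] rk_covers[OF w] by linarith
qed

lemma rk_Sup_le: "rk (Sup (set xs) :: 'l::geometric_lattice) \<le> sum_list (map rk xs)"
proof (induction xs)
  case (Cons x xs)
  then show ?case using rk_sup_le[of x "Sup (set xs)"] by simp
qed simp

text \<open>Modulo dependent words the degree of a word (its rank sum) is thus the rank of its
  lattice grade (its join); this makes the quotient compatibly graded.\<close>

lemma not_lattice_dependent_iff:
  fixes xs :: "'l::geometric_lattice list"
  shows "\<not> lattice_dependent xs \<longleftrightarrow> sum_list (map rk xs) = rk (Sup (set xs))"
  using rk_Sup_le[of xs] by (auto simp: lattice_dependent_def)

section \<open>Label lists that differ in one entry\<close>

text \<open>Describes the labels of the summands of a derivation applied to a word, where exactly
  one letter is replaced.\<close>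

inductive list_step :: "('l \<Rightarrow> 'l \<Rightarrow> bool) \<Rightarrow> 'l list \<Rightarrow> 'l list \<Rightarrow> bool" for R
  where
    here: "R x y \<Longrightarrow> list_step R (x # xs) (y # xs)"
  | there: "list_step R xs ys \<Longrightarrow> list_step R (x # xs) (x # ys)"

abbreviation step_down :: "'l::order list \<Rightarrow> 'l list \<Rightarrow> bool"
  where "step_down \<equiv> list_step (\<lambda>x y. y \<lessdot> x)"

abbreviation step_up :: "'l::order \<Rightarrow> 'l list \<Rightarrow> 'l list \<Rightarrow> bool"
  where "step_up t \<equiv> list_step (\<lambda>x y. x \<lessdot> y \<and> y \<le> t)"

lemma list_step_up_rk:
  fixes xs ys :: "'l::geometric_lattice list"
  assumes "list_step (\<lessdot>) xs ys"
  shows "sum_list (map rk ys) = Suc (sum_list (map rk xs))"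
    and "Sup (set xs) = Sup (set ys) \<or> Sup (set xs) \<lessdot> Sup (set ys)"
  using assms
proof (induction rule: list_step.induct)
  case (here x y xs)
  { case 1 then show ?case using rk_covers[OF here] by simp }
  { case 2 then show ?case using covers_sup[OF here, of "Sup (set xs)"] by simp }
next
  case (there xs ys x)
  { case 1 then show ?case using there by simp }
  { case 2 then show ?case using there(3) covers_sup[of "Sup (set xs)" "Sup (set ys)" x]
      by (auto simp: sup_commute) }
qed

lemma list_step_converse: "list_step R xs ys \<Longrightarrow> list_step (\<lambda>x y. R y x) ys xs"
  by (induction rule: list_step.induct) (auto intro: list_step.intros)

text \<open>The rank sum grows by exactly one and the rank of the join by at most one, so the excess
  cannot shrink.\<close>

lemma lattice_dependent_step_up:
  fixes xs ys :: "'l::geometric_lattice list"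
  assumes "list_step (\<lessdot>) xs ys" "lattice_dependent xs"
  shows "lattice_dependent ys"
  using list_step_up_rk[OF assms(1)] assms(2) rk_covers[of "Sup (set xs)" "Sup (set ys)"]
  by (auto simp: lattice_dependent_def)

lemma list_step_down_rk:
  fixes xs ys :: "'l::geometric_lattice list"
  assumes "step_down xs ys"
  shows "sum_list (map rk xs) = Suc (sum_list (map rk ys))"
    and "Sup (set ys) = Sup (set xs) \<or> Sup (set ys) \<lessdot> Sup (set xs)"
  using list_step_up_rk[OF list_step_converse[OF assms]] by auto

text \<open>Rank sum and rank of the join both fall by one, so the excess is kept. If the join
  stays, the excess falls and may reach 0, which is why the span of dependent words alone need not
  be stable under the differential.\<close>

lemma lattice_dependent_step_down:
  fixes xs ys :: "'l::geometric_lattice list"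
  assumes "step_down xs ys" "lattice_dependent xs" "Sup (set ys) \<noteq> Sup (set xs)"
  shows "lattice_dependent ys"
  using list_step_down_rk[OF assms(1)] assms(2,3) rk_covers[of "Sup (set ys)" "Sup (set xs)"]
  by (auto simp: lattice_dependent_def)

lemma list_step_mono: "list_step R xs ys \<Longrightarrow> (\<And>x y. R x y \<Longrightarrow> R' x y) \<Longrightarrow> list_step R' xs ys"
  by (induction rule: list_step.induct) (auto intro: list_step.intros)

lemma list_step_subset:
  "list_step R xs ys \<Longrightarrow> set xs \<subseteq> A \<Longrightarrow> (\<And>x y. x \<in> A \<Longrightarrow> R x y \<Longrightarrow> y \<in> A) \<Longrightarrow> set ys \<subseteq> A"
  by (induction rule: list_step.induct) auto

lemma list_step_eq: "list_step (=) xs ys \<Longrightarrow> ys = xs"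
  by (induction rule: list_step.induct) auto

section \<open>Linear and multiplicative maps of the free algebra\<close>

type_synonym ('v, 'k) fa = "'v list \<Rightarrow>\<^sub>0 'k"

interpretation FA: vector_space "fscale :: 'k::field \<Rightarrow> ('w \<Rightarrow>\<^sub>0 'k) \<Rightarrow> 'w \<Rightarrow>\<^sub>0 'k"
  by (rule vector_space_fscale)

interpretation FA2: vector_space_pair
  "fscale :: 'k::field \<Rightarrow> ('w \<Rightarrow>\<^sub>0 'k) \<Rightarrow> 'w \<Rightarrow>\<^sub>0 'k" "fscale :: 'k::field \<Rightarrow> ('u \<Rightarrow>\<^sub>0 'k) \<Rightarrow> 'u \<Rightarrow>\<^sub>0 'k"
  ..

abbreviation fa_linear :: "(('w \<Rightarrow>\<^sub>0 'k::field) \<Rightarrow> ('u \<Rightarrow>\<^sub>0 'k)) \<Rightarrow> bool"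
  where "fa_linear \<equiv> Vector_Spaces.linear fscale fscale"

lemmas quot_map_fscale = quot_map[OF vector_space_fscale]

lemma fscale_eq_single_mult: "fscale c p = Poly_Mapping.single 0 c * (p :: 'w::monoid_add \<Rightarrow>\<^sub>0 'k::comm_ring_1)"
  unfolding fscale_def by (rule mult_map_scale_conv_mult)

lemma fscale_mult_left: "fscale c p * q = fscale c (p * (q :: 'w::monoid_add \<Rightarrow>\<^sub>0 'k::comm_ring_1))"
  by (simp add: fscale_eq_single_mult mult.assoc)

lemma fscale_sum_words:
  "p = (\<Sum>w\<in>Poly_Mapping.keys p. fscale (Poly_Mapping.lookup p w) (word w :: ('v, 'k::comm_ring_1) fa))"
proof (rule poly_mapping_eqI)
  fix w
  have "(\<Sum>u\<in>Poly_Mapping.keys p. Poly_Mapping.lookup p u * Poly_Mapping.lookup (word u :: ('v, 'k) fa) w)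
      = (\<Sum>u\<in>Poly_Mapping.keys p. if u = w then Poly_Mapping.lookup p u else 0)"
    by (intro sum.cong) (auto simp: word_def lookup_single when_def)
  then show "Poly_Mapping.lookup p w = Poly_Mapping.lookup (\<Sum>u\<in>Poly_Mapping.keys p. fscale (Poly_Mapping.lookup p u) (word u)) w"
    by (simp add: lookup_sum lookup_fscale in_keys_iff)
qed

lemma span_words: "FA.span (range word) = (UNIV :: ('v, 'k::field) fa set)"
proof -
  have "p \<in> FA.span (range word)" for p :: "('v, 'k) fa"
    by (subst fscale_sum_words) (intro FA.span_sum FA.span_scale FA.span_base; simp)
  then show ?thesis by auto
qed

lemma fscale_two: "fscale 2 p = p + (p :: 'w \<Rightarrow>\<^sub>0 'k::field)"
  using FA.scale_left_distrib[of 1 1 p] by simp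

lemma word_mult: "word a * word b = (word (a @ b) :: ('v, 'k::comm_ring_1) fa)"
  by (simp add: word_def mult_single plus_list_def)

lemma word_Nil: "word [] = (1 :: ('v, 'k::comm_ring_1) fa)"
  by (simp add: word_def zero_list_def flip: single_one)

lemma word_Cons: "word (v # vs) = gen v * (word vs :: ('v, 'k::comm_ring_1) fa)"
  by (simp add: word_mult)

lemma fscale_mult_right: "p * fscale c q = fscale c (p * (q :: ('v, 'k::field) fa))"
proof -
  have w: "word w * fscale c q = fscale c (word w * q)" for w
    by (simp add: fscale_eq_single_mult mult.assoc[symmetric])
      (simp add: word_def mult_single mult.commute)
  show ?thesis
    by (subst (1 2) fscale_sum_words[of p])
      (simp add: sum_distrib_right w fscale_mult_left FA.scale_sum_right FA.scale_left_commute mult.commute)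
qed

lemma fscale_neg_one: "(- 1) ^ n * p = fscale ((- 1) ^ n) (p :: 'w::monoid_add \<Rightarrow>\<^sub>0 'k::comm_ring_1)"
proof -
  have "(- 1) ^ n = (Poly_Mapping.single 0 ((- 1) ^ n) :: 'w \<Rightarrow>\<^sub>0 'k)"
    by (induction n) (simp_all add: mult_single single_uminus)
  then show ?thesis by (simp add: fscale_eq_single_mult)
qed

lemma fa_linearI:
  assumes "\<And>p q. T (p + q) = T p + T q" "\<And>c p. T (fscale c p) = fscale c (T p)"
  shows "fa_linear T"
  using assms by (simp add: Vector_Spaces.linear_iff vector_space_fscale)

lemma fa_linear_id [simp]: "fa_linear (\<lambda>p. p)"
  by (rule fa_linearI) auto

lemma fa_linear_mult_left: "fa_linear (\<lambda>p. q * (p :: ('v, 'k::field) fa))"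
  by (rule fa_linearI) (simp_all add: distrib_left fscale_mult_right)

lemma fa_linear_mult_right: "fa_linear (\<lambda>p. p * (q :: ('v, 'k::field) fa))"
  by (rule fa_linearI) (simp_all add: distrib_right fscale_mult_left)

lemma fa_linear_add: "fa_linear T \<Longrightarrow> fa_linear U \<Longrightarrow> fa_linear (\<lambda>p. T p + U p)"
  by (rule FA2.linear_compose_add)

lemma fa_linear_diff: "fa_linear T \<Longrightarrow> fa_linear U \<Longrightarrow> fa_linear (\<lambda>p. T p - U p)"
  by (rule FA2.linear_compose_sub)

lemma fa_linear_compose: "fa_linear T \<Longrightarrow> fa_linear U \<Longrightarrow> fa_linear (\<lambda>p. U (T p))"
  using Vector_Spaces.linear_compose[of fscale fscale T fscale U] by (simp add: o_def)

lemma fa_linear_span_into: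
  assumes "fa_linear T" "FA.subspace N" "\<And>b. b \<in> B \<Longrightarrow> T b \<in> N" "p \<in> FA.span B"
  shows "T p \<in> N"
  using FA2.linear_subspace_vimage[OF assms(1,2)] FA.span_minimal[of B "T -` N"] assms(3,4) by blast

lemma fa_linear_eqI:
  assumes "fa_linear T" "fa_linear U" "\<And>w. T (word w) = U (word w)"
  shows "T p = U (p :: ('v, 'k::field) fa)"
  by (rule FA2.linear_eq_on[OF assms(1,2), of _ "range word"]) (use assms(3) span_words in auto)

definition lin_ext :: "('v list \<Rightarrow> 'u \<Rightarrow>\<^sub>0 'k) \<Rightarrow> ('v, 'k::comm_ring_1) fa \<Rightarrow> 'u \<Rightarrow>\<^sub>0 'k"
  where "lin_ext F p = (\<Sum>w\<in>Poly_Mapping.keys p. fscale (Poly_Mapping.lookup p w) (F w))"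

lemma lin_ext_superset:
  assumes "finite A" "Poly_Mapping.keys p \<subseteq> A"
  shows "lin_ext F p = (\<Sum>w\<in>A. fscale (Poly_Mapping.lookup p w) (F w :: _ \<Rightarrow>\<^sub>0 'k::field))"
  unfolding lin_ext_def using assms
  by (intro sum.mono_neutral_left) (auto simp: in_keys_iff)

lemma fa_linear_lin_ext: "fa_linear (lin_ext F :: ('v, 'k::field) fa \<Rightarrow> 'u \<Rightarrow>\<^sub>0 'k)"
proof (rule fa_linearI)
  fix p q :: "('v, 'k) fa" and c
  let ?A = "Poly_Mapping.keys p \<union> Poly_Mapping.keys q"
  have "Poly_Mapping.keys (p + q) \<subseteq> ?A" by (rule keys_add)
  then show "lin_ext F (p + q) = lin_ext F p + lin_ext F q"
    by (simp add: lin_ext_superset[of ?A] lookup_add FA.scale_left_distrib sum.distrib)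
  have "Poly_Mapping.keys (fscale c p) \<subseteq> Poly_Mapping.keys p"
    by (auto simp: in_keys_iff lookup_fscale)
  then show "lin_ext F (fscale c p) = fscale c (lin_ext F p)"
    by (simp add: lin_ext_superset[of "Poly_Mapping.keys p"] lookup_fscale FA.scale_sum_right)
qed

lemma lin_ext_word [simp]: "lin_ext F (word w) = (F w :: 'u \<Rightarrow>\<^sub>0 'k::field)"
  by (simp add: lin_ext_def word_def)

abbreviation wspan :: "'v list set \<Rightarrow> ('v, 'k::field) fa set"
  where "wspan A \<equiv> FA.span (word ` A)"

lemma free_alg_eq_wspan: "free_alg X = (wspan (lists X) :: ('v, 'k::field) fa set)"
proof
  show "free_alg X \<subseteq> (wspan (lists X) :: ('v, 'k) fa set)"
  proof
    fix p :: "('v, 'k) fa"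
    assume "p \<in> free_alg X"
    then have "\<And>w. w \<in> Poly_Mapping.keys p \<Longrightarrow> w \<in> lists X" by (auto simp: free_alg_def)
    then show "p \<in> wspan (lists X)"
      by (subst fscale_sum_words) (intro FA.span_sum FA.span_scale FA.span_base imageI)
  qed
  have "FA.subspace (free_alg X :: ('v, 'k) fa set)"
  proof (rule FA.subspaceI)
    fix p q :: "('v, 'k) fa" and c
    assume p: "p \<in> free_alg X"
    then show "fscale c p \<in> free_alg X"
      by (auto simp: free_alg_def in_keys_iff lookup_fscale)
    assume "q \<in> free_alg X"
    then show "p + q \<in> free_alg X" using p keys_add[of p q] unfolding free_alg_def by blast
  qed (simp add: free_alg_def)
  then show "wspan (lists X) \<subseteq> (free_alg X :: ('v, 'k) fa set)"
    by (rule FA.span_minimal[rotated]) (auto simp: free_alg_def word_def)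
qed

lemma free_alg_into:
  assumes "fa_linear T" "FA.subspace N" "p \<in> free_alg X" "\<And>w. set w \<subseteq> X \<Longrightarrow> T (word w) \<in> N"
  shows "T p \<in> N"
  by (rule fa_linear_span_into[OF assms(1,2) _ assms(3)[unfolded free_alg_eq_wspan]])
    (use assms(4) in \<open>auto simp: lists_eq_set\<close>)

lemma subspace_free_alg [simp]: "FA.subspace (free_alg X :: ('v, 'k::field) fa set)"
  by (simp add: free_alg_eq_wspan)

lemma word_in_free_alg [simp]: "word w \<in> (free_alg X :: ('v, 'k::comm_ring_1) fa set) \<longleftrightarrow> set w \<subseteq> X"
  by (auto simp: free_alg_def word_def)

lemma wspan_mult:
  assumes "p \<in> wspan A" "q \<in> wspan B" "\<And>a b. a \<in> A \<Longrightarrow> b \<in> B \<Longrightarrow> a @ b \<in> C"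
  shows "p * q \<in> (wspan C :: ('v, 'k::field) fa set)"
proof -
  have "word a * q \<in> wspan C" if "a \<in> A" for a
    by (rule fa_linear_span_into[OF fa_linear_mult_left _ _ assms(2)])
      (use assms(3)[OF that] in \<open>auto simp: word_mult intro!: FA.span_base\<close>)
  then show ?thesis
    by (intro fa_linear_span_into[OF fa_linear_mult_right[of q] _ _ assms(1)]) auto
qed

lemma free_alg_mult: "p \<in> free_alg X \<Longrightarrow> q \<in> free_alg X \<Longrightarrow> p * q \<in> (free_alg X :: ('v, 'k::field) fa set)"
  unfolding free_alg_eq_wspan by (erule wspan_mult) auto

section \<open>Homomorphisms and twisted derivations prescribed on letters\<close>

text \<open>Letters are free generators even though \<open>'v\<close> may carry a vector space
  structure, so \<open>f\<close> is arbitrary here; its linearity enters only when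
  \<open>hom f\<close> is to respect \<open>linear_rels\<close>.\<close>

definition hom :: "('v \<Rightarrow> 'u) \<Rightarrow> ('v, 'k::field) fa \<Rightarrow> ('u, 'k) fa"
  where "hom f = lin_ext (\<lambda>w. word (map f w))"

lemma fa_linear_hom: "fa_linear (hom f)"
  unfolding hom_def by (rule fa_linear_lin_ext)

interpretation hom: Vector_Spaces.linear fscale fscale "hom f :: ('v, 'k::field) fa \<Rightarrow> ('u, 'k) fa" for f
  by (rule fa_linear_hom)

lemma hom_word [simp]: "hom f (word w) = word (map f w)"
  by (simp add: hom_def)

lemma fa_bilinear_eqI:
  fixes T U :: "('v, 'k::field) fa \<Rightarrow> ('w, 'k) fa \<Rightarrow> 'u \<Rightarrow>\<^sub>0 'k"
  assumes "\<And>q. fa_linear (\<lambda>p. T p q)" "\<And>q. fa_linear (\<lambda>p. U p q)"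
    and "\<And>a. fa_linear (T (word a))" "\<And>a. fa_linear (U (word a))"
    and "\<And>a b. T (word a) (word b) = U (word a) (word b)"
  shows "T p q = U p q"
proof -
  have "T (word a) q = U (word a) q" for a
    by (rule fa_linear_eqI[OF assms(3,4,5)])
  then show ?thesis by (rule fa_linear_eqI[of "\<lambda>p. T p q" "\<lambda>p. U p q", OF assms(1,2)])
qed

lemma hom_mult: "hom f (p * q) = hom f p * hom f q"
  by (rule fa_bilinear_eqI[where T = "\<lambda>p q. hom f (p * q)" and U = "\<lambda>p q. hom f p * hom f q"];
      (intro fa_linear_compose[OF fa_linear_mult_right fa_linear_hom] fa_linear_compose[OF fa_linear_mult_left fa_linear_hom]
         fa_linear_compose[OF fa_linear_hom fa_linear_mult_left] fa_linear_compose[OF fa_linear_hom fa_linear_mult_right])?)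
    (simp add: word_mult)

text \<open>With \<open>g = id\<close> this is the derivation extending \<open>f\<close>; with \<open>g\<close> the parity automorphism it is the
  super-derivation extending an odd \<open>f\<close>.\<close>
primrec der_word :: "('v \<Rightarrow> 'v) \<Rightarrow> ('v \<Rightarrow> 'v) \<Rightarrow> 'v list \<Rightarrow> ('v, 'k::field) fa"
  where
    "der_word g f [] = 0"
  | "der_word g f (v # vs) = word (f v # vs) + gen (g v) * der_word g f vs"

definition der :: "('v \<Rightarrow> 'v) \<Rightarrow> ('v \<Rightarrow> 'v) \<Rightarrow> ('v, 'k::field) fa \<Rightarrow> ('v, 'k) fa"
  where "der g f = lin_ext (der_word g f)"

lemma fa_linear_der: "fa_linear (der g f)"
  unfolding der_def by (rule fa_linear_lin_ext)

interpretation der: Vector_Spaces.linear fscale fscale "der g f :: ('v, 'k::field) fa \<Rightarrow> ('v, 'k) fa" for g f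
  by (rule fa_linear_der)

lemma der_word_eq [simp]: "der g f (word w) = der_word g f w"
  by (simp add: der_def)

lemma der_word_append:
  "der_word g f (a @ b) = der_word g f a * word b + word (map g a) * der_word g f b"
  by (induction a) (simp_all add: word_Nil word_mult distrib_left distrib_right mult.assoc[symmetric])

lemma der_mult: "der g f (p * q) = der g f p * q + hom g p * der g f q"
  by (rule fa_bilinear_eqI[where T = "\<lambda>p q. der g f (p * q)" and U = "\<lambda>p q. der g f p * q + hom g p * der g f q"];
      (intro fa_linear_add fa_linear_compose[OF fa_linear_mult_right fa_linear_der] fa_linear_compose[OF fa_linear_mult_left fa_linear_der]
         fa_linear_compose[OF fa_linear_hom fa_linear_mult_right] fa_linear_compose[OF fa_linear_der fa_linear_mult_left]
         fa_linear_compose[OF fa_linear_der fa_linear_mult_right] fa_linear_mult_left)?)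
    (simp add: word_mult der_word_append)

lemma der_word_cong:
  "(\<And>v. v \<in> set w \<Longrightarrow> f v = f' v \<and> g v = g' v) \<Longrightarrow> der_word g f w = der_word g' f' w"
  by (induction w) auto

lemma der_word_in_free_alg:
  assumes "f ` X \<subseteq> X" "g ` X \<subseteq> X" "set w \<subseteq> X"
  shows "der_word g f w \<in> (free_alg X :: ('v, 'k::field) fa set)"
  using assms(3)
proof (induction w)
  case (Cons v w)
  have "gen (g v) \<in> (free_alg X :: ('v, 'k) fa set)" using assms Cons.prems by (auto simp: image_subset_iff)
  then have "gen (g v) * der_word g f w \<in> (free_alg X :: ('v, 'k) fa set)"
    using Cons by (intro free_alg_mult) auto
  moreover have "word (f v # w) \<in> (free_alg X :: ('v, 'k) fa set)" using assms Cons.prems by (auto simp: image_subset_iff)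
  ultimately show ?case by (simp add: FA.subspace_add)
qed (simp add: FA.subspace_0)

lemma der_free_alg:
  assumes "f ` X \<subseteq> X" "g ` X \<subseteq> X" "p \<in> free_alg X"
  shows "der g f p \<in> free_alg X"
  by (rule free_alg_into[OF fa_linear_der subspace_free_alg assms(3)])
    (auto simp: lists_eq_set intro!: der_word_in_free_alg[OF assms(1,2)])

lemma hom_free_alg:
  assumes "f ` X \<subseteq> Y" "p \<in> free_alg X"
  shows "hom f p \<in> free_alg Y"
  by (rule free_alg_into[OF fa_linear_hom subspace_free_alg assms(2)])
    (use assms(1) in \<open>auto simp: image_subset_iff\<close>)

section \<open>Ideals of the tensor algebra\<close>

lemma subspace_tensor_ideal [simp]: "FA.subspace (tensor_ideal s X R)"
  by (simp add: tensor_ideal_def)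

lemma tensor_ideal_wordI:
  assumes "set a \<subseteq> X" "set b \<subseteq> X" "r \<in> linear_rels s X \<union> R"
  shows "word a * r * word b \<in> tensor_ideal s X R"
  unfolding tensor_ideal_def by (rule FA.span_base) (use assms in force)

text \<open>The outer factors of a generator are arbitrary elements of the free algebra; linearity
  in each of them reduces to words.\<close>

lemma tensor_ideal_induct:
  assumes "fa_linear T" "FA.subspace N" "p \<in> tensor_ideal s X R"
    and "\<And>a r b. set a \<subseteq> X \<Longrightarrow> set b \<subseteq> X \<Longrightarrow> r \<in> linear_rels s X \<union> R \<Longrightarrow> T (word a * r * word b) \<in> N"
  shows "T p \<in> N"
proof (rule fa_linear_span_into[OF assms(1,2) _ assms(3)[unfolded tensor_ideal_def]])
  fix q
  assume "q \<in> {a * r * b | a r b. a \<in> free_alg X \<and> b \<in> free_alg X \<and> r \<in> linear_rels s X \<union> R}"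
  then obtain a r b where q: "q = a * r * b" "a \<in> free_alg X" "b \<in> free_alg X" "r \<in> linear_rels s X \<union> R"
    by auto
  have "T (word a' * r * b) \<in> N" if "set a' \<subseteq> X" for a'
    by (rule free_alg_into[OF fa_linear_compose[OF fa_linear_mult_left assms(1)] assms(2) q(3)])
      (use assms(4)[OF that] q(4) in auto)
  then have "T (a * (r * b)) \<in> N"
    by (intro free_alg_into[OF fa_linear_compose[OF fa_linear_mult_right assms(1)] assms(2) q(2)])
      (auto simp: mult.assoc)
  then show "T q \<in> N" by (simp add: q(1) mult.assoc)
qed

lemma tensor_ideal_rel: "r \<in> linear_rels s X \<union> R \<Longrightarrow> r \<in> tensor_ideal s X R"
  using tensor_ideal_wordI[of "[]" X "[]" r] by (simp add: word_Nil)

lemma tensor_ideal_free_alg: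
  fixes R :: "('v::plus list \<Rightarrow>\<^sub>0 'k::field) set"
  assumes "\<And>u v. u \<in> X \<Longrightarrow> v \<in> X \<Longrightarrow> u + v \<in> X" "\<And>c u. u \<in> X \<Longrightarrow> s c u \<in> X" "R \<subseteq> free_alg X"
  shows "tensor_ideal s X R \<subseteq> free_alg X"
proof
  fix p assume p: "p \<in> tensor_ideal s X R"
  have "r \<in> free_alg X" if r: "r \<in> linear_rels s X \<union> R" for r :: "('v, 'k) fa"
    using r assms unfolding linear_rels_def
    by (auto intro!: FA.subspace_diff[OF subspace_free_alg] FA.subspace_scale[OF subspace_free_alg])
  then show "p \<in> free_alg X"
    by (intro tensor_ideal_induct[OF fa_linear_id subspace_free_alg p] free_alg_mult) auto
qed

lemma tensor_ideal_mult_left: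
  assumes "p \<in> tensor_ideal s X R" "q \<in> free_alg X"
  shows "q * p \<in> tensor_ideal s X R"
proof -
  have "word a * p \<in> tensor_ideal s X R" if "set a \<subseteq> X" for a
    by (rule tensor_ideal_induct[OF fa_linear_mult_left _ assms(1)])
      (use that in \<open>auto simp: mult.assoc[symmetric] word_mult intro!: tensor_ideal_wordI\<close>)
  then show ?thesis
    by (intro free_alg_into[OF fa_linear_mult_right _ assms(2)]) auto
qed

lemma tensor_ideal_mult_right:
  assumes "p \<in> tensor_ideal s X R" "q \<in> free_alg X"
  shows "p * q \<in> tensor_ideal s X R"
proof -
  have "p * word a \<in> tensor_ideal s X R" if "set a \<subseteq> X" for a
    by (rule tensor_ideal_induct[OF fa_linear_mult_right _ assms(1)])
      (use that in \<open>auto simp: mult.assoc word_mult, auto simp: mult.assoc[symmetric] intro!: tensor_ideal_wordI\<close>)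
  then show ?thesis
    by (intro free_alg_into[OF fa_linear_mult_left _ assms(2)]) auto
qed

text \<open>Only the effect of \<open>T\<close> on single letters matters, since the relations are
  linear in them; this covers homomorphisms and derivations at once.\<close>

lemma linear_rels_image:
  fixes f :: "'v::plus \<Rightarrow> 'u::plus"
  assumes "fa_linear T" "\<And>v. T (gen v) = gen (f v)"
    and f: "linear_on s s' X f" "f ` X \<subseteq> Y" and r: "r \<in> linear_rels s X"
  shows "T r \<in> (linear_rels s' Y :: ('u, 'k::field) fa set)"
proof -
  interpret T: Vector_Spaces.linear fscale fscale T by fact
  consider u v where "u \<in> X" "v \<in> X" "r = gen (u + v) - gen u - gen v"
    | c u where "u \<in> X" "r = gen (s c u) - fscale c (gen u)"
    using r unfolding linear_rels_def by blast
  then show ?thesis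
  proof cases
    case 1
    then have "T r = gen (f u + f v) - gen (f u) - gen (f v)" "f u \<in> Y" "f v \<in> Y"
      using assms(2) f by (auto simp: T.diff linear_on_def)
    then show ?thesis unfolding linear_rels_def by blast
  next
    case 2
    then have "T r = gen (s' c (f u)) - fscale c (gen (f u))" "f u \<in> Y"
      using assms(2) f by (auto simp: T.diff T.scale linear_on_def)
    then show ?thesis unfolding linear_rels_def by blast
  qed
qed

lemma hom_tensor_ideal:
  assumes f: "linear_on s s' X f" "f ` X \<subseteq> Y"
    and R: "\<And>r. r \<in> R \<Longrightarrow> hom f r \<in> tensor_ideal s' Y R'"
    and p: "p \<in> tensor_ideal s X R"
  shows "hom f p \<in> tensor_ideal s' Y R'"
proof (rule tensor_ideal_induct[OF fa_linear_hom subspace_tensor_ideal p])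
  fix a r b
  assume a: "set a \<subseteq> X" "set b \<subseteq> X" "r \<in> linear_rels s X \<union> R"
  have "hom f r \<in> tensor_ideal s' Y R'"
    using a(3) R linear_rels_image[OF fa_linear_hom _ f] by (auto intro: tensor_ideal_rel)
  moreover have "set (map f a) \<subseteq> Y" "set (map f b) \<subseteq> Y" using a f(2) by auto
  ultimately show "hom f (word a * r * word b) \<in> tensor_ideal s' Y R'"
    by (simp add: hom_mult tensor_ideal_mult_left tensor_ideal_mult_right del: set_map)
qed

text \<open>In the twisted Leibniz rule for \<open>a * r * b\<close> the last summand carries
  \<open>hom g r\<close>, so the relations have to be stable under \<open>hom g\<close> as well as
  under \<open>der g f\<close>.\<close>

lemma der_tensor_ideal:
  assumes f: "linear_on s s X f" "f ` X \<subseteq> X" and g: "linear_on s s X g" "g ` X \<subseteq> X"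
    and R: "\<And>r. r \<in> R \<Longrightarrow> hom g r \<in> tensor_ideal s X R" "\<And>r. r \<in> R \<Longrightarrow> der g f r \<in> tensor_ideal s X R"
    and p: "p \<in> tensor_ideal s X R"
  shows "der g f p \<in> tensor_ideal s X R"
proof (rule tensor_ideal_induct[OF fa_linear_der subspace_tensor_ideal p])
  fix a r b
  assume a: "set a \<subseteq> X" "set b \<subseteq> X" "r \<in> linear_rels s X \<union> R"
  have h: "hom g r \<in> tensor_ideal s X R"
    using a(3) R linear_rels_image[OF fa_linear_hom _ g] by (auto intro: tensor_ideal_rel)
  have d: "der g f r \<in> tensor_ideal s X R"
    using a(3) R linear_rels_image[OF fa_linear_der _ f] by (auto intro: tensor_ideal_rel)
  have r: "r \<in> tensor_ideal s X R" using a(3) by (rule tensor_ideal_rel)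
  have in_X: "word (map g a) \<in> free_alg X" "word b \<in> free_alg X"
    "der_word g f a \<in> free_alg X" "der_word g f b \<in> free_alg X"
    using a g(2) by (auto intro!: der_word_in_free_alg[OF f(2) g(2)])
  have "(der_word g f a * r + word (map g a) * der g f r) * word b \<in> tensor_ideal s X R"
    by (intro tensor_ideal_mult_right FA.subspace_add tensor_ideal_mult_left in_X d r subspace_tensor_ideal)
  moreover have "(word (map g a) * hom g r) * der_word g f b \<in> tensor_ideal s X R"
    by (intro tensor_ideal_mult_right tensor_ideal_mult_left in_X h)
  ultimately show "der g f (word a * r * word b) \<in> tensor_ideal s X R"
    by (simp add: der_mult hom_mult FA.subspace_add)
qed

section \<open>Graded complexes\<close>

lemma (in vector_space) subspace_sum_parts:
  assumes "\<And>x. x \<in> Q \<Longrightarrow> subspace (part W x)"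
  shows "subspace (sum_parts W Q)"
proof (rule subspaceI)
  show "0 \<in> sum_parts W Q" unfolding sum_parts_def
    by (rule CollectI, rule exI[of _ "\<lambda>_. 0"]) (use assms subspace_0 in auto)
  fix u v c assume "u \<in> sum_parts W Q"
  then obtain f where f: "u = (\<Sum>x\<in>Q. f x)" "\<And>x. x \<in> Q \<Longrightarrow> f x \<in> part W x"
    by (auto simp: sum_parts_def)
  show "c *s u \<in> sum_parts W Q" unfolding sum_parts_def
    by (rule CollectI, rule exI[of _ "\<lambda>x. c *s f x"]) (use f assms subspace_scale in \<open>auto simp: scale_sum_right\<close>)
  assume "v \<in> sum_parts W Q"
  then obtain g where g: "v = (\<Sum>x\<in>Q. g x)" "\<And>x. x \<in> Q \<Longrightarrow> g x \<in> part W x"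
    by (auto simp: sum_parts_def)
  show "u + v \<in> sum_parts W Q" unfolding sum_parts_def
    by (rule CollectI, rule exI[of _ "\<lambda>x. f x + g x"]) (use f g assms subspace_add in \<open>auto simp: sum.distrib\<close>)
qed

lemma (in vector_space) part_subset_sum_parts:
  assumes "\<And>x. x \<in> Q \<Longrightarrow> subspace (part W x)" "x \<in> Q"
  shows "part W x \<subseteq> sum_parts W Q"
proof
  fix v assume v: "v \<in> part W x"
  show "v \<in> sum_parts W Q" unfolding sum_parts_def
    by (rule CollectI, rule exI[of _ "\<lambda>y. if y = x then v else 0"]) (use v assms subspace_0 in auto)
qed

lemma (in vector_space) sum_parts_least:
  assumes "subspace N" "\<And>x. x \<in> Q \<Longrightarrow> part W x \<subseteq> N"
  shows "sum_parts W Q \<subseteq> N"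
  unfolding sum_parts_def using assms by (auto intro!: subspace_sum)

lemma (in vector_space) sum_parts_mono:
  assumes "\<And>x. subspace (part W x)" "Q \<subseteq> Q'"
  shows "sum_parts W Q \<subseteq> sum_parts W Q'"
  by (intro sum_parts_least subspace_sum_parts part_subset_sum_parts) (use assms in auto)

lemma (in vector_space) sum_parts_singleton: "sum_parts W {x} = part W x"
  by (auto simp: sum_parts_def)

lemma (in vector_space) linear_on_zero:
  "linear_on scale s' U f \<Longrightarrow> subspace U \<Longrightarrow> f 0 = (0 :: 'd::group_add)"
  using subspace_0[of U] unfolding linear_on_def
  by (metis add.right_neutral add_left_cancel)

lemma (in vector_space) linear_on_diff:
  assumes "linear_on scale s' U f" "subspace U" "u \<in> U" "v \<in> U"
  shows "f (u - v) = f u - (f v :: 'd::ab_group_add)"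
proof -
  have "f ((u - v) + v) = f (u - v) + f v"
    using assms(1) subspace_diff[OF assms(2-4)] assms(4) unfolding linear_on_def by blast
  then show ?thesis by simp
qed

lemma (in vector_space) linear_on_sum:
  assumes "linear_on scale s' U f" "subspace U" "\<And>x. x \<in> A \<Longrightarrow> g x \<in> U"
  shows "f (sum g A) = (\<Sum>x\<in>A. f (g x) :: 'd::ab_group_add)"
  using assms(3)
proof (induction A rule: infinite_finite_induct)
  case (insert x A)
  then have "sum g A \<in> U" "g x \<in> U" by (auto intro!: subspace_sum[OF assms(2)])
  then show ?case using insert assms(1) by (simp add: linear_on_def)
qed (use linear_on_zero[OF assms(1,2)] in auto)

lemma linear_on_subset: "linear_on s s' U f \<Longrightarrow> U' \<subseteq> U \<Longrightarrow> linear_on s s' U' f"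
  unfolding linear_on_def by blast

lemma (in vector_space) linear_on_sum_parts_into:
  assumes f: "linear_on scale scale (sum_parts W Q) f" and N: "subspace N"
    and W: "\<And>x. x \<in> Q \<Longrightarrow> subspace (part W x)" and into: "\<And>x. x \<in> Q \<Longrightarrow> f ` part W x \<subseteq> N"
  shows "f ` sum_parts W Q \<subseteq> N"
proof
  fix u assume "u \<in> f ` sum_parts W Q"
  then obtain h where h: "u = f (\<Sum>x\<in>Q. h x)" "\<And>x. x \<in> Q \<Longrightarrow> h x \<in> part W x"
    by (auto simp: sum_parts_def)
  have "u = (\<Sum>x\<in>Q. f (h x))" unfolding h(1)
    by (rule linear_on_sum[OF f subspace_sum_parts[OF W]]) (use h(2) part_subset_sum_parts[of Q W] W in blast)+
  then show "u \<in> N" using h(2) into by (auto intro!: subspace_sum[OF N])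
qed

lemma sum_parts_below: "sum_parts (below W t) Q = sum_parts W Q"
  by (simp add: below_def sum_parts_def)

lemma below_simps:
  "chains (below W t) = (\<lambda>i. sum_parts W (level t i))" "part (below W t) = part W" "diff (below W t) = diff W"
  by (simp_all add: below_def level_def)

text \<open>Characteristic zero enters through division by 2 in \<open>D_D\<close> and through the
  eigenvalues of the Euler derivation.\<close>

locale lgraded = vector_space s
  for s :: "'k::field_char_0 \<Rightarrow> 'v::ab_group_add \<Rightarrow> 'v" +
  fixes V :: "('v, 'l::geometric_lattice) lcomplex"
  assumes graded: "graded_complex s top V"
begin

lemma subspace_part [simp]: "subspace (part V x)"
  using graded by (simp add: graded_complex_def)

lemma subspace_parts [simp]: "subspace (sum_parts V Q)"
  by (rule subspace_sum_parts) simp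

lemma part_subset: "x \<in> Q \<Longrightarrow> part V x \<subseteq> sum_parts V Q"
  by (rule part_subset_sum_parts) simp_all

lemma parts_mono: "Q \<subseteq> Q' \<Longrightarrow> sum_parts V Q \<subseteq> sum_parts V Q'"
  by (rule sum_parts_mono) simp_all

lemma zero_in_part [simp]: "0 \<in> part V x" "0 \<in> sum_parts V Q"
  by (simp_all add: subspace_0)

lemma part_in_total: "v \<in> part V x \<Longrightarrow> v \<in> total V"
  using part_subset[of x UNIV] by auto

lemma chains_eq: "chains V i = sum_parts V {x. rk x = i}"
  using graded by (simp add: graded_complex_def)

lemma subspace_chains [simp]: "subspace (chains V i)"
  by (simp add: chains_eq)

lemma chains_subset: "chains V i \<subseteq> total V"
  unfolding chains_eq by (rule parts_mono) simp

lemma part_subset_chains: "part V x \<subseteq> chains V (rk x)"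
  unfolding chains_eq by (rule part_subset) simp

lemma diff_linear: "linear_on s s (total V) (diff V)"
  using graded by (simp add: graded_complex_def atMost_def)

lemma diff_diff: "v \<in> total V \<Longrightarrow> diff V (diff V v) = 0"
  using graded by (simp add: graded_complex_def atMost_def)

lemma chains_0: "chains V 0 = part V bot"
  by (simp add: chains_eq sum_parts_singleton)

lemma diff_bot: "v \<in> part V bot \<Longrightarrow> diff V v = 0"
  using graded by (simp add: graded_complex_def chains_0 flip: chains_0)

text \<open>At \<open>bot\<close> the right-hand side is the empty sum, so this includes the
  vanishing of the differential there.\<close>

lemma diff_part: "diff V ` part V x \<subseteq> sum_parts V {y. y \<lessdot> x}"
proof (cases "x = bot")
  case True then show ?thesis using diff_bot by auto
next
  case False then show ?thesis using graded by (simp add: graded_complex_def)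
qed

lemma diff_level: "diff V ` sum_parts V (level t (Suc i)) \<subseteq> sum_parts V (level t i)"
proof (rule linear_on_sum_parts_into[OF linear_on_subset[OF diff_linear parts_mono[OF subset_UNIV]]])
  fix x assume "x \<in> level t (Suc i)"
  then have "{y. y \<lessdot> x} \<subseteq> level t i" by (auto simp: covers_iff_rk level_def)
  then show "diff V ` part V x \<subseteq> sum_parts V (level t i)" using diff_part[of x] parts_mono by (meson order_trans)
qed simp_all

lemma diff_total: "v \<in> total V \<Longrightarrow> diff V v \<in> total V"
proof -
  have "diff V ` part V x \<subseteq> total V" for x
    using diff_part[of x] parts_mono[of "{y. y \<lessdot> x}" UNIV] by (rule order_trans) simp
  then show "v \<in> total V \<Longrightarrow> diff V v \<in> total V"
    using linear_on_sum_parts_into[OF diff_linear, of "total V"] by (auto simp: image_subset_iff)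
qed

lemma independent: "(\<And>x. f x \<in> part V x) \<Longrightarrow> (\<Sum>x\<in>UNIV. f x) = 0 \<Longrightarrow> f x = 0"
  using graded by (simp add: graded_complex_def independent_parts_def atMost_def)

section \<open>Homogeneous components and maps prescribed part by part\<close>

text \<open>On \<open>total V\<close> the choice is forced, by \<open>comp_sum\<close>.\<close>

definition comp :: "'v \<Rightarrow> 'l \<Rightarrow> 'v"
  where "comp v = (SOME f. (\<forall>x. f x \<in> part V x) \<and> v = (\<Sum>x\<in>UNIV. f x))"

lemma comp:
  assumes "v \<in> total V" shows "comp v x \<in> part V x" "v = (\<Sum>x\<in>UNIV. comp v x)"
proof -
  have "\<exists>f. (\<forall>x. f x \<in> part V x) \<and> v = (\<Sum>x\<in>UNIV. f x)"
    using assms by (auto simp: sum_parts_def)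
  from someI_ex[OF this] show "comp v x \<in> part V x" "v = (\<Sum>x\<in>UNIV. comp v x)"
    unfolding comp_def by auto
qed

lemma comp_sum:
  assumes "\<And>x. f x \<in> part V x"
  shows "comp (\<Sum>x\<in>UNIV. f x) = f"
proof
  fix x
  let ?v = "\<Sum>x\<in>UNIV. f x"
  have v: "?v \<in> total V" unfolding sum_parts_def using assms by blast
  have "comp ?v x - f x = 0"
  proof (rule independent)
    show "comp ?v x - f x \<in> part V x" for x by (intro subspace_diff subspace_part comp(1)[OF v] assms)
    show "(\<Sum>x\<in>UNIV. comp ?v x - f x) = 0" unfolding sum_subtractf by (simp flip: comp(2)[OF v])
  qed
  then show "comp ?v x = f x" by simp
qed

lemma comp_parts:
  assumes "\<And>x. x \<in> Q \<Longrightarrow> f x \<in> part V x"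
  shows "comp (\<Sum>x\<in>Q. f x) = (\<lambda>x. if x \<in> Q then f x else 0)"
proof -
  have "(\<Sum>x\<in>Q. f x) = (\<Sum>x\<in>UNIV. if x \<in> Q then f x else 0)" by (simp add: sum.If_cases)
  then show ?thesis using comp_sum[of "\<lambda>x. if x \<in> Q then f x else 0"] assms by simp
qed

lemma comp_part: "v \<in> part V x \<Longrightarrow> comp v = (\<lambda>y. if y = x then v else 0)"
  using comp_parts[of "{x}" "\<lambda>_. v"] by auto

lemma comp_add: "u \<in> total V \<Longrightarrow> v \<in> total V \<Longrightarrow> comp (u + v) x = comp u x + comp v x"
  using comp_sum[of "\<lambda>x. comp u x + comp v x"] comp[of u] comp[of v]
  by (simp add: sum.distrib subspace_add)

lemma comp_scale: "u \<in> total V \<Longrightarrow> comp (s c u) x = s c (comp u x)"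
  using comp_sum[of "\<lambda>x. s c (comp u x)"] comp[of u]
  by (simp add: subspace_scale flip: scale_sum_right)

definition glue :: "('l \<Rightarrow> 'v \<Rightarrow> 'v) \<Rightarrow> 'v \<Rightarrow> 'v"
  where "glue g v = (\<Sum>x\<in>UNIV. g x (comp v x))"

lemma glue_part:
  assumes "\<And>x. linear_on s s (part V x) (g x)" "v \<in> part V x"
  shows "glue g v = g x v"
proof -
  have "g y (comp v y) = (if y = x then g x v else 0)" for y
    using linear_on_zero[OF assms(1)[of y]] by (simp add: comp_part[OF assms(2)])
  then show ?thesis by (simp add: glue_def)
qed

lemma glue_linear:
  assumes "\<And>x. linear_on s s (part V x) (g x)"
  shows "linear_on s s (total V) (glue g)"
  using assms comp(1) unfolding linear_on_def glue_def
  by (simp add: comp_add comp_scale sum.distrib scale_sum_right)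

lemma linear_total_eqI:
  assumes "linear_on s s (total V) f" "linear_on s s (total V) g"
    and "\<And>x v. v \<in> part V x \<Longrightarrow> f v = g v" "v \<in> total V"
  shows "f v = g v"
proof -
  have m: "\<And>x. x \<in> UNIV \<Longrightarrow> comp v x \<in> total V" using comp(1)[OF assms(4)] part_in_total by blast
  have "f v = (\<Sum>x\<in>UNIV. f (comp v x))"
    by (subst comp(2)[OF assms(4)], rule linear_on_sum[OF assms(1) _ m]) auto
  also have "\<dots> = (\<Sum>x\<in>UNIV. g (comp v x))" by (intro sum.cong refl assms(3)[OF comp(1)[OF assms(4)]])
  also have "\<dots> = g v"
    by (subst (2) comp(2)[OF assms(4)], rule linear_on_sum[OF assms(2) _ m, symmetric]) auto
  finally show ?thesis .
qed

text \<open>Serves twice: with the signs \<open>(- 1) ^ rk x\<close> it is the parity automorphism,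
  with the indicator of \<open>x \<le> t\<close> the projection onto the parts below
  \<open>t\<close>.\<close>

definition diag :: "('l \<Rightarrow> 'k) \<Rightarrow> 'v \<Rightarrow> 'v"
  where "diag a = glue (\<lambda>x. s (a x))"

lemma linear_on_scale: "linear_on s s U (s c)"
  by (simp add: linear_on_def scale_right_distrib mult.commute)

lemma diag_part: "v \<in> part V x \<Longrightarrow> diag a v = s (a x) v"
  unfolding diag_def by (rule glue_part) (auto intro: linear_on_scale)

lemma diag_linear: "linear_on s s (total V) (diag a)"
  unfolding diag_def by (rule glue_linear) (rule linear_on_scale)

lemma diag_parts: "v \<in> sum_parts V Q \<Longrightarrow> diag a v \<in> sum_parts V Q"
proof -
  have "diag a ` part V x \<subseteq> sum_parts V Q" if "x \<in> Q" for x
    using that diag_part[of _ x a] part_subset[OF that] by (auto intro!: subspace_scale)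
  then show "v \<in> sum_parts V Q \<Longrightarrow> diag a v \<in> sum_parts V Q"
    using linear_on_sum_parts_into[OF linear_on_subset[OF diag_linear parts_mono[OF subset_UNIV]], of "sum_parts V Q" Q]
    by (auto simp: image_subset_iff)
qed

lemma diag_chains_const:
  assumes "\<And>x. rk x = i \<Longrightarrow> a x = c" "v \<in> chains V i"
  shows "diag a v = s c v"
proof -
  obtain f where f: "v = sum f {x. rk x = i}" "\<And>x. rk x = i \<Longrightarrow> f x \<in> part V x"
    using assms(2) by (auto simp: chains_eq sum_parts_def)
  have "diag a v = (\<Sum>x\<in>{x. rk x = i}. diag a (f x))" unfolding f(1)
    by (rule linear_on_sum[OF diag_linear]) (use f(2) part_in_total in auto)
  also have "\<dots> = (\<Sum>x\<in>{x. rk x = i}. s c (f x))"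
    by (intro sum.cong refl) (metis (mono_tags) mem_Collect_eq diag_part f(2) assms(1))
  finally show ?thesis by (simp add: f(1) scale_sum_right)
qed

abbreviation parity :: "'v \<Rightarrow> 'v"
  where "parity \<equiv> diag (\<lambda>x. (- 1) ^ rk x)"

lemma parity_chains: "v \<in> chains V i \<Longrightarrow> parity v = s ((- 1) ^ i) v"
  by (rule diag_chains_const) auto

lemma parity_parity: "v \<in> total V \<Longrightarrow> parity (parity v) = v"
proof (rule linear_total_eqI[where f = "\<lambda>v. parity (parity v)" and g = "\<lambda>v. v"])
  show "linear_on s s (total V) (\<lambda>v. parity (parity v))"
    using diag_linear diag_parts unfolding linear_on_def by metis
  show "parity (parity v) = v" if "v \<in> part V x" for x v
    using that diag_part[OF that] diag_part[OF subspace_scale[OF subspace_part that]]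
    by (simp flip: power_mult_distrib)
qed (auto simp: linear_on_def)

section \<open>Homogeneous words modulo the supercommutation ideal\<close>

abbreviation tensors :: "('v, 'k) fa set"
  where "tensors \<equiv> free_alg (total V)"

definition super_rels :: "('v, 'k) fa set"
  where "super_rels =
    {gen u * gen v - (- 1) ^ (i * j) * (gen v * gen u) | u v i j. u \<in> chains V i \<and> v \<in> chains V j}"

text \<open>The kernel of the passage from the free algebra to S, restricted to letters from
  \<open>V\<close>. It contains the linearity relations too, since letters are bare vectors.\<close>

definition J :: "('v, 'k) fa set"
  where "J = tensor_ideal s (total V) super_rels"

lemma subspace_J [simp]: "FA.subspace J"
  by (simp add: J_def)

lemmas J_add = FA.subspace_add[OF subspace_J] and J_diff = FA.subspace_diff[OF subspace_J]
  and J_scale = FA.subspace_scale[OF subspace_J] and J_0 = FA.subspace_0[OF subspace_J]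
  and J_neg = FA.subspace_neg[OF subspace_J]

lemma J_mult_left: "p \<in> J \<Longrightarrow> q \<in> tensors \<Longrightarrow> q * p \<in> J"
  unfolding J_def by (rule tensor_ideal_mult_left)

lemma J_mult_right: "p \<in> J \<Longrightarrow> q \<in> tensors \<Longrightarrow> p * q \<in> J"
  unfolding J_def by (rule tensor_ideal_mult_right)

lemma J_super:
  "u \<in> chains V i \<Longrightarrow> v \<in> chains V j \<Longrightarrow> gen u * gen v - (- 1) ^ (i * j) * (gen v * gen u) \<in> J"
  unfolding J_def by (rule tensor_ideal_rel) (auto simp: super_rels_def)

lemma J_gen_add: "u \<in> total V \<Longrightarrow> v \<in> total V \<Longrightarrow> gen (u + v) - gen u - gen v \<in> J"
  unfolding J_def by (rule tensor_ideal_rel) (auto simp: linear_rels_def)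

lemma J_gen_scale: "u \<in> total V \<Longrightarrow> gen (s c u) - fscale c (gen u) \<in> J"
  unfolding J_def by (rule tensor_ideal_rel) (auto simp: linear_rels_def)

lemma J_gen_0: "gen 0 \<in> J"
  using J_gen_scale[of 0 0] by (simp add: FA.scale_zero_left)

lemma J_gen_sum:
  assumes "\<And>x. x \<in> A \<Longrightarrow> f x \<in> total V"
  shows "gen (sum f A) - (\<Sum>x\<in>A. gen (f x)) \<in> J"
  using assms
proof (induction A rule: infinite_finite_induct)
  case (insert x A)
  then have "sum f A \<in> total V" by (auto intro: subspace_sum)
  then have "(gen (f x + sum f A) - gen (f x) - gen (sum f A)) + (gen (sum f A) - (\<Sum>x\<in>A. gen (f x))) \<in> J"
    using insert by (intro J_add J_gen_add) auto
  then show ?case using insert by (simp add: algebra_simps)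
qed (use J_gen_0 in auto)

lemma J_free_alg: "J \<subseteq> tensors"
proof -
  have "gen v \<in> tensors" if "v \<in> chains V i" for v i
    using that chains_subset by auto
  then have "super_rels \<subseteq> tensors" unfolding super_rels_def fscale_neg_one
    by (auto intro!: FA.subspace_diff[OF subspace_free_alg] FA.subspace_scale[OF subspace_free_alg] free_alg_mult)
  then show ?thesis unfolding J_def
    by (intro tensor_ideal_free_alg) (auto intro: subspace_add subspace_scale)
qed

abbreviation homogeneous :: "'v list \<Rightarrow> 'l list \<Rightarrow> bool"
  where "homogeneous \<equiv> list_all2 (\<lambda>r x. r \<in> part V x)"

text \<open>Indexed by sets of whole label lists, because join, degree and dependence are all read
  off from the list.\<close>

definition hspan :: "'l list set \<Rightarrow> ('v, 'k) fa set"
  where "hspan Q = wspan {rs. \<exists>xs\<in>Q. homogeneous rs xs}"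

text \<open>Adding \<open>J\<close> makes membership invariant under congruence, which is needed
  because a vector from a sum of parts is a sum of homogeneous letters only modulo
  \<open>J\<close>.\<close>

definition hspanJ :: "'l list set \<Rightarrow> ('v, 'k) fa set"
  where "hspanJ Q = {p + j | p j. p \<in> hspan Q \<and> j \<in> J}"

lemma subspace_hspan [simp]: "FA.subspace (hspan Q)"
  by (simp add: hspan_def)

lemma subspace_hspanJ [simp]: "FA.subspace (hspanJ Q)"
  unfolding hspanJ_def by (rule FA.subspace_sums) auto

lemma hspan_word: "homogeneous rs xs \<Longrightarrow> xs \<in> Q \<Longrightarrow> word rs \<in> hspan Q"
  unfolding hspan_def by (intro FA.span_base imageI) auto

lemma hspan_mono: "Q \<subseteq> Q' \<Longrightarrow> hspan Q \<subseteq> hspan Q'"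
  unfolding hspan_def by (intro FA.span_mono) auto

lemma hspanJ_mono: "Q \<subseteq> Q' \<Longrightarrow> hspanJ Q \<subseteq> hspanJ Q'"
  unfolding hspanJ_def using hspan_mono by blast

lemma hspan_hspanJ: "hspan Q \<subseteq> hspanJ Q"
  unfolding hspanJ_def using J_0 by force

lemma J_hspanJ: "J \<subseteq> hspanJ Q"
  unfolding hspanJ_def using FA.subspace_0[OF subspace_hspan] by force

lemma hspanJ_cong: "p - q \<in> J \<Longrightarrow> p \<in> hspanJ Q \<longleftrightarrow> q \<in> hspanJ Q"
  using FA.subspace_diff[OF subspace_hspanJ, of p Q "p - q"] FA.subspace_add[OF subspace_hspanJ, of "p - q" Q q] J_hspanJ
  by auto

lemma hspan_into:
  assumes "fa_linear T" "FA.subspace N" "p \<in> hspan Q"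
    and "\<And>rs xs. homogeneous rs xs \<Longrightarrow> xs \<in> Q \<Longrightarrow> T (word rs) \<in> N"
  shows "T p \<in> N"
  by (rule fa_linear_span_into[OF assms(1,2) _ assms(3)[unfolded hspan_def]]) (use assms(4) in auto)

lemma hspanJ_into:
  assumes "fa_linear T" "FA.subspace N" "p \<in> hspanJ Q" "\<And>j. j \<in> J \<Longrightarrow> T j \<in> N"
    and "\<And>rs xs. homogeneous rs xs \<Longrightarrow> xs \<in> Q \<Longrightarrow> T (word rs) \<in> N"
  shows "T p \<in> N"
proof -
  obtain h j where h: "p = h + j" "h \<in> hspan Q" "j \<in> J" using assms(3) by (auto simp: hspanJ_def)
  interpret T: Vector_Spaces.linear fscale fscale T by fact
  show ?thesis unfolding h(1) T.add
    by (intro FA.subspace_add[OF assms(2)] assms(4)[OF h(3)] hspan_into[OF assms(1,2) h(2) assms(5)])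
qed

lemma list_all2_total: "homogeneous rs xs \<Longrightarrow> set rs \<subseteq> total V"
  by (induction rule: list_all2_induct) (auto simp: part_in_total)

lemma hspan_free_alg: "hspan Q \<subseteq> tensors"
  unfolding hspan_def free_alg_eq_wspan
  by (rule FA.span_mono) (use list_all2_total in \<open>auto simp: lists_eq_set\<close>)

lemma hspanJ_free_alg: "hspanJ Q \<subseteq> tensors"
proof
  fix p assume "p \<in> hspanJ Q"
  then obtain h j where "p = h + j" "h \<in> hspan Q" "j \<in> J" by (auto simp: hspanJ_def)
  then show "p \<in> tensors"
    using subsetD[OF hspan_free_alg] subsetD[OF J_free_alg] by (simp add: FA.subspace_add)
qed

lemma gen_mult_hspanJ:
  assumes v: "v \<in> sum_parts V Y" and p: "p \<in> hspanJ A" and B: "\<And>y ys. y \<in> Y \<Longrightarrow> ys \<in> A \<Longrightarrow> y # ys \<in> B"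
  shows "gen v * p \<in> hspanJ B"
proof -
  obtain f where f: "v = (\<Sum>y\<in>Y. f y)" "\<And>y. y \<in> Y \<Longrightarrow> f y \<in> part V y"
    using v by (auto simp: sum_parts_def)
  have vX: "v \<in> total V" using v parts_mono[of Y UNIV] by auto
  have "gen u * p \<in> hspanJ B" if u: "y \<in> Y" "u \<in> part V y" for u y
  proof (rule hspanJ_into[OF fa_linear_mult_left _ p])
    show "gen u * j \<in> hspanJ B" if "j \<in> J" for j
      using J_mult_left[OF that, of "gen u"] part_in_total[OF u(2)] J_hspanJ by auto
    show "gen u * word rs \<in> hspanJ B" if "homogeneous rs xs" "xs \<in> A" for rs xs
      using that u B hspan_hspanJ by (auto simp: word_mult intro!: subsetD[OF hspan_hspanJ] hspan_word[of _ "y # xs"])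
  qed simp
  then have "(\<Sum>y\<in>Y. gen (f y) * p) \<in> hspanJ B" using f(2) by (intro FA.subspace_sum) auto
  moreover have "(gen v - (\<Sum>y\<in>Y. gen (f y))) * p \<in> J"
    unfolding f(1) using f(2) part_in_total subsetD[OF hspanJ_free_alg p] by (intro J_mult_right J_gen_sum) auto
  ultimately show ?thesis
    using hspanJ_cong[of "gen v * p" "\<Sum>y\<in>Y. gen (f y) * p" B] by (simp add: left_diff_distrib sum_distrib_right)
qed

lemma free_alg_hspanJ: "tensors \<subseteq> hspanJ UNIV"
proof
  fix p :: "('v, 'k) fa" assume p: "p \<in> tensors"
  have "word rs \<in> hspanJ UNIV" if "set rs \<subseteq> total V" for rs
    using that
  proof (induction rs)
    case Nil
    show ?case using hspan_word[of "[]" "[]" UNIV] hspan_hspanJ by auto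
  next
    case (Cons v rs)
    then show ?case using gen_mult_hspanJ[of v UNIV "word rs" UNIV UNIV] by (simp add: word_mult)
  qed
  then show "p \<in> hspanJ UNIV"
    by (intro fa_linear_span_into[OF fa_linear_id _ _ p[unfolded free_alg_eq_wspan]]) auto
qed

text \<open>A summand replaces one letter by its image under \<open>f\<close> and applies
  \<open>g\<close>, which keeps labels, to the letters before it; so the labels change in one
  place.\<close>

lemma der_word_step:
  assumes "homogeneous rs xs"
    and "\<And>x v. x \<in> set xs \<Longrightarrow> v \<in> part V x \<Longrightarrow> g v \<in> part V x"
    and "\<And>x v. x \<in> set xs \<Longrightarrow> v \<in> part V x \<Longrightarrow> f v \<in> sum_parts V {y. R x y}"
  shows "der_word g f rs \<in> hspanJ {ys. list_step R xs ys}"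
  using assms
proof (induction rule: list_all2_induct)
  case Nil
  show ?case by (simp add: FA.subspace_0)
next
  case (Cons r rs x xs)
  have "word rs \<in> hspanJ {xs}"
    using hspan_word[OF Cons(2)] hspan_hspanJ by auto
  then have "gen (f r) * word rs \<in> hspanJ {ys. list_step R (x # xs) ys}"
    by (rule gen_mult_hspanJ[where Y = "{y. R x y}", rotated]) (use Cons in \<open>auto intro: list_step.here\<close>)
  moreover have "gen (g r) * der_word g f rs \<in> hspanJ {ys. list_step R (x # xs) ys}"
    by (rule gen_mult_hspanJ[where Y = "{x}"]) (use Cons in \<open>auto intro: list_step.there simp: sum_parts_singleton\<close>)
  ultimately show ?case by (simp add: word_mult FA.subspace_add)
qed

text \<open>The labelling \<open>P\<close> is left open to cover labels in the lattice
  (\<open>hom_diag_word\<close>) and labels by degrees (\<open>chain_words\<close>).\<close>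

lemma hom_diag_word_general:
  assumes "list_all2 P rs xs" "\<And>r x. P r x \<Longrightarrow> r \<in> total V \<and> diag a r = s (c x) r"
  shows "set rs \<subseteq> total V \<and> hom (diag a) (word rs) - fscale (prod_list (map c xs)) (word rs) \<in> J"
  using assms(1)
proof (induction rule: list_all2_induct)
  case Nil
  then show ?case by (simp add: J_0)
next
  case (Cons r rs x xs)
  let ?w = "word (map (diag a) rs) :: ('v, 'k) fa" and ?c = "prod_list (map c xs)"
  have r: "r \<in> total V" "diag a r = s (c x) r" using Cons assms(2) by auto
  have rs: "set rs \<subseteq> total V" using Cons by simp
  then have "set (map (diag a) rs) \<subseteq> total V" using diag_parts[of _ UNIV] by auto
  then have "(gen (s (c x) r) - fscale (c x) (gen r)) * ?w \<in> J"
    using r by (intro J_mult_right J_gen_scale) auto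
  moreover have "fscale (c x) (gen r) * (?w - fscale ?c (word rs)) \<in> J"
    using Cons r by (intro J_mult_left) (auto intro: FA.subspace_scale)
  ultimately have "(gen (s (c x) r) - fscale (c x) (gen r)) * ?w + fscale (c x) (gen r) * (?w - fscale ?c (word rs)) \<in> J"
    by (rule J_add)
  then show ?case using r(1) rs
    by (simp add: r(2) word_Cons[of _ "map (diag a) rs"] word_Cons[of r rs] hom_mult[of _ "gen r"] left_diff_distrib right_diff_distrib fscale_mult_left fscale_mult_right mult.commute)
qed

lemma hom_diag_word:
  assumes "homogeneous rs xs"
  shows "hom (diag a) (word rs) - fscale (prod_list (map a xs)) (word rs) \<in> J"
  using hom_diag_word_general[OF assms, of a a] diag_part part_in_total by blast

lemma hom_diag_J: "p \<in> J \<Longrightarrow> hom (diag a) p \<in> J"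
  unfolding J_def
proof (rule hom_tensor_ideal[OF diag_linear])
  show "diag a ` total V \<subseteq> total V" using diag_parts by auto
  fix r :: "('v, 'k) fa"
  assume "r \<in> super_rels"
  then obtain u v i j where r: "r = gen u * gen v - (- 1) ^ (i * j) * (gen v * gen u)" "u \<in> chains V i" "v \<in> chains V j"
    unfolding super_rels_def by blast
  have "hom (diag a) r = gen (diag a u) * gen (diag a v) - (- 1) ^ (i * j) * (gen (diag a v) * gen (diag a u))"
    by (simp add: r(1) fscale_neg_one hom.diff hom.scale hom_mult)
  moreover have "diag a u \<in> chains V i" "diag a v \<in> chains V j"
    using r diag_parts by (auto simp: chains_eq)
  ultimately show "hom (diag a) r \<in> tensor_ideal s (total V) super_rels"
    by (intro tensor_ideal_rel) (auto simp: super_rels_def)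
qed

section \<open>Odd maps and their super-derivations\<close>

text \<open>Only the parity of the degree is prescribed, so that the differential, which lowers the
  degree, and a homotopy, which raises it, are treated alike.\<close>

definition odd_map :: "('v \<Rightarrow> 'v) \<Rightarrow> bool"
  where "odd_map f \<longleftrightarrow> linear_on s s (total V) f \<and>
    (\<forall>i. \<exists>j. f ` chains V i \<subseteq> chains V j \<and> (even j \<longleftrightarrow> odd i))"

lemma odd_map_total:
  assumes "odd_map f" "v \<in> total V"
  shows "f v \<in> total V"
proof -
  have "f ` part V x \<subseteq> total V" for x
  proof -
    obtain j where "f ` chains V (rk x) \<subseteq> chains V j" using assms(1) unfolding odd_map_def by meson
    then show ?thesis using part_subset_chains[of x] chains_subset[of j] by blast
  qed
  then show ?thesis
    using linear_on_sum_parts_into[of V UNIV f "total V"] assms by (auto simp: odd_map_def)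
qed

lemma odd_map_parity:
  assumes "odd_map f" "v \<in> total V"
  shows "parity (f v) = - f (parity v)"
proof -
  let ?F = "\<lambda>v. parity (f v)" let ?G = "\<lambda>v. s (- 1) (f (parity v))"
  have lf: "linear_on s s (total V) f" using assms by (simp add: odd_map_def)
  have "?F v = ?G v"
  proof (rule linear_total_eqI[of ?F ?G, OF _ _ _ assms(2)])
    show "linear_on s s (total V) ?F"
      using lf diag_linear[of "\<lambda>x. (- 1) ^ rk x"] odd_map_total[OF assms(1)] unfolding linear_on_def by simp
    show "linear_on s s (total V) ?G"
      using lf diag_linear[of "\<lambda>x. (- 1) ^ rk x"] diag_parts[of _ UNIV] unfolding linear_on_def
      by (simp add: scale_right_distrib)
    fix x v assume v: "v \<in> part V x"
    obtain j where j: "f ` chains V (rk x) \<subseteq> chains V j" "even j \<longleftrightarrow> odd (rk x)"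
      using assms(1) unfolding odd_map_def by meson
    then have "f v \<in> chains V j" using v part_subset_chains by blast
    moreover have "(- 1 :: 'k) ^ j = - ((- 1) ^ rk x)" using j(2) by (cases "even j") (auto simp: uminus_power_if)
    ultimately have "?F v = s (- ((- 1) ^ rk x)) (f v)" by (simp add: parity_chains)
    moreover have "f (parity v) = s ((- 1) ^ rk x) (f v)"
      using v lf part_in_total by (simp add: diag_part linear_on_def)
    ultimately show "?F v = ?G v" by simp
  qed
  then show ?thesis by simp
qed

lemma der_odd_J:
  assumes f: "odd_map f" and p: "p \<in> J"
  shows "der parity f p \<in> J"
proof (rule der_tensor_ideal[OF _ _ diag_linear _ _ _ p[unfolded J_def], folded J_def])
  show "linear_on s s (total V) f" "f ` total V \<subseteq> total V" "parity ` total V \<subseteq> total V"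
    using f odd_map_total[OF f] diag_parts by (auto simp: odd_map_def)
  fix r :: "('v, 'k) fa"
  assume a: "r \<in> super_rels"
  then have "r \<in> J" unfolding J_def by (intro tensor_ideal_rel) simp
  then show "hom parity r \<in> J" by (rule hom_diag_J)
  obtain u v i j where r: "r = gen u * gen v - (- 1) ^ (i * j) * (gen v * gen u)" "u \<in> chains V i" "v \<in> chains V j"
    using a unfolding super_rels_def by blast
  have uv: "u \<in> total V" "v \<in> total V" "f u \<in> total V" "f v \<in> total V"
    using r chains_subset odd_map_total[OF f] by auto
  obtain i' where i': "f ` chains V i \<subseteq> chains V i'" "even i' \<longleftrightarrow> odd i"
    using f unfolding odd_map_def by meson
  obtain j' where j': "f ` chains V j \<subseteq> chains V j'" "even j' \<longleftrightarrow> odd j"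
    using f unfolding odd_map_def by meson
  have ij': "f u \<in> chains V i'" "even i' \<longleftrightarrow> odd i" "f v \<in> chains V j'" "even j' \<longleftrightarrow> odd j"
    using i' j' r by auto
  let ?e = "\<lambda>n p. fscale ((- 1) ^ n) (p :: ('v, 'k) fa)"
  \<comment> \<open>\<open>?A\<close> and \<open>?B\<close> are supercommutation relations with one
    letter replaced by its image under \<open>f\<close>; \<open>?C\<close> and \<open>?D\<close>
    pull out the signs that parity puts inside a letter.\<close>
  let ?A = "gen (f u) * gen v - ?e (i' * j) (gen v * gen (f u))"
  let ?B = "gen u * gen (f v) - ?e (i * j') (gen (f v) * gen u)"
  let ?C = "(gen (s ((- 1) ^ i) u) - ?e i (gen u)) * gen (f v)"
  let ?D = "(gen (s ((- 1) ^ j) v) - ?e j (gen v)) * gen (f u)"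
  have AB: "?A \<in> J" "?B \<in> J" using J_super[OF ij'(1) r(3)] J_super[OF r(2) ij'(3)] by (simp_all add: fscale_neg_one)
  have CD: "?C \<in> J" "?D \<in> J" using uv by (auto intro!: J_mult_right J_gen_scale)
  have "?A + ?e i ?B + ?C - ?e (i * j) ?D \<in> J"
    by (rule J_diff[OF J_add[OF J_add[OF AB(1) J_scale[OF AB(2)]] CD(1)] J_scale[OF CD(2)]])
  moreover have "(- 1 :: 'k) ^ (i' * j) = (- 1) ^ (i * j) * (- 1) ^ j" "(- 1 :: 'k) ^ i * (- 1) ^ (i * j') = (- 1) ^ (i * j)"
    using ij' by (auto simp: uminus_power_if)
  then have "?A + ?e i ?B + ?C - ?e (i * j) ?D = der parity f r"
    by (simp add: r(1) fscale_neg_one der.diff der.scale der_mult parity_chains[OF r(2)] parity_chains[OF r(3)]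
        word_Nil fscale_mult_left left_diff_distrib FA.scale_right_diff_distrib FA.scale_right_distrib)
  ultimately show "der parity f r \<in> J" by simp
qed

end

section \<open>Derivations and the Orlik-Solomon ideal\<close>

context lgraded
begin

lemma odd_mapI:
  assumes "linear_on s s (total V) f" "\<And>i. even (c i) \<longleftrightarrow> odd i"
    and "\<And>x. f ` part V x \<subseteq> chains V (c (rk x))"
  shows "odd_map f"
proof -
  have "f ` chains V i \<subseteq> chains V (c i)" for i
    unfolding chains_eq[of i]
    using assms(3) by (intro linear_on_sum_parts_into linear_on_subset[OF assms(1)] parts_mono) auto
  then show ?thesis using assms(1,2) unfolding odd_map_def by blast
qed

lemma odd_map_diff: "odd_map (diff V)"
\<comment> \<open>In degree 0 the differential vanishes, so any odd target degree serves; the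
  truncated \<open>i - 1\<close> would have the wrong parity.\<close>
proof (rule odd_mapI[where c = "\<lambda>i. if i = 0 then 1 else i - 1"])
  fix x
  show "diff V ` part V x \<subseteq> chains V (if rk x = 0 then 1 else rk x - 1)"
  proof (cases "x = bot")
    case True then show ?thesis using diff_bot subspace_0[OF subspace_chains] by auto
  next
    case False
    have "sum_parts V {y. y \<lessdot> x} \<subseteq> chains V (rk x - 1)"
      unfolding chains_eq by (rule parts_mono) (auto simp: rk_covers)
    then show ?thesis using diff_part[of x] False by auto
  qed
qed (auto simp: diff_linear)

lemma J_gen_neg: "u \<in> total V \<Longrightarrow> gen (- u) + gen u \<in> J"
proof -
  assume u: "u \<in> total V"
  have "gen 0 - (gen (- u + u) - gen (- u) - gen u) \<in> J"
    using u by (intro J_diff J_gen_0 J_gen_add) (auto intro: subspace_neg)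
  then show ?thesis by (simp add: add.commute)
qed

lemma der_word_free_alg: "odd_map f \<Longrightarrow> set rs \<subseteq> total V \<Longrightarrow> der_word parity f rs \<in> tensors"
  using odd_map_total diag_parts by (intro der_word_in_free_alg) auto

text \<open>Parity anticommutes with \<open>f\<close> and \<open>g\<close>, so the mixed terms
  cancel and an ordinary derivation remains. It is determined on letters by the anticommutator of
  \<open>f\<close> and \<open>g\<close>.\<close>

lemma der_anticommutator:
  assumes f: "odd_map f" "odd_map g" and "set rs \<subseteq> total V"
  shows "der parity f (der_word parity g rs) + der parity g (der_word parity f rs)
    - der_word (\<lambda>v. v) (\<lambda>v. f (g v) + g (f v)) rs \<in> J"
  using assms(3)
proof (induction rs)
  case Nil
  show ?case by (simp add: J_0 der.zero)
next
  case (Cons r rs)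
  have r: "r \<in> total V" "parity r \<in> total V" and rs: "set rs \<subseteq> total V"
    using Cons.prems diag_parts by auto
  have fr: "f r \<in> total V" "g r \<in> total V" "f (g r) \<in> total V" "g (f r) \<in> total V"
    "f (parity r) \<in> total V" "g (parity r) \<in> total V"
    using r odd_map_total[OF f(1)] odd_map_total[OF f(2)] by auto
  let ?w = "word rs :: ('v, 'k) fa" and ?f = "der_word parity f rs" and ?g = "der_word parity g rs"
  let ?e = "\<lambda>v. f (g v) + g (f v)"
  have free: "?w \<in> tensors" "?f \<in> tensors" "?g \<in> tensors" "gen r \<in> tensors"
    using r rs f der_word_free_alg by auto
  have A: "(gen (?e r) - gen (f (g r)) - gen (g (f r))) * ?w \<in> J"
    using fr free by (intro J_mult_right J_gen_add)
  have B: "(gen (parity (g r)) + gen (g (parity r))) * ?f \<in> J" "(gen (parity (f r)) + gen (f (parity r))) * ?g \<in> J"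
    unfolding odd_map_parity[OF f(1) r(1)] odd_map_parity[OF f(2) r(1)]
    using fr free by (auto intro!: J_mult_right[OF J_gen_neg])
  have C: "gen r * (der parity f ?g + der parity g ?f - der_word (\<lambda>v. v) ?e rs) \<in> J"
    using Cons.IH[OF rs] free by (intro J_mult_left)
  have "(gen (parity (g r)) + gen (g (parity r))) * ?f + (gen (parity (f r)) + gen (f (parity r))) * ?g
      + gen r * (der parity f ?g + der parity g ?f - der_word (\<lambda>v. v) ?e rs)
      - (gen (?e r) - gen (f (g r)) - gen (g (f r))) * ?w \<in> J"
    by (intro J_diff[OF J_add[OF J_add[OF B] C] A])
  then show ?case
    by (simp add: der.add der_mult parity_parity[OF r(1)] word_Cons[of _ rs] algebra_simps)
qed

section \<open>The differential and the ideal on the free algebra\<close>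

abbreviation D :: "('v, 'k) fa \<Rightarrow> ('v, 'k) fa"
  where "D \<equiv> der parity (diff V)"

lemma D_J: "p \<in> J \<Longrightarrow> D p \<in> J"
  by (rule der_odd_J[OF odd_map_diff])

lemma D_free_alg: "p \<in> tensors \<Longrightarrow> D p \<in> tensors"
  using diff_total diag_parts by (intro der_free_alg) auto

text \<open>Twice \<open>D (D p)\<close> is the anticommutator of \<open>D\<close> with itself, a
  derivation that sends every letter to the letter \<open>0\<close>, which lies in
  \<open>J\<close>.\<close>

lemma D_D:
  assumes "p \<in> tensors" shows "D (D p) \<in> J"
proof (rule free_alg_into[OF fa_linear_compose[OF fa_linear_der fa_linear_der] subspace_J assms])
  fix rs assume rs: "set rs \<subseteq> total V"
  have "(der_word (\<lambda>v. v) (\<lambda>v. 0) us :: ('v, 'k) fa) \<in> J" if "set us \<subseteq> total V" for us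
    using that
  proof (induction us)
    case (Cons u us)
    then have "gen 0 * word us \<in> J" by (intro J_mult_right J_gen_0) auto
    moreover have "gen u * der_word (\<lambda>v. v) (\<lambda>v. 0) us \<in> J" using Cons by (intro J_mult_left) auto
    ultimately show ?case by (simp add: word_mult J_add)
  qed (simp add: J_0)
  moreover have "(der_word (\<lambda>v. v) (\<lambda>v. diff V (diff V v) + diff V (diff V v)) rs :: ('v, 'k) fa)
      = der_word (\<lambda>v. v) (\<lambda>v. 0) rs"
    using rs by (intro der_word_cong) (auto simp: diff_diff)
  ultimately have "der_word (\<lambda>v. v) (\<lambda>v. diff V (diff V v) + diff V (diff V v)) rs \<in> J"
    using rs by simp
  from J_add[OF der_anticommutator[OF odd_map_diff odd_map_diff rs] this] have "fscale 2 (D (D (word rs))) \<in> J"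
    by (simp add: fscale_two)
  then have "fscale (1/2) (fscale 2 (D (D (word rs)))) \<in> J" by (rule J_scale)
  then show "D (D (word rs)) \<in> J" by simp
qed

definition dep :: "'l \<Rightarrow> 'l list set"
  where "dep t = {xs. lattice_dependent xs \<and> set xs \<subseteq> {..t}}"

abbreviation dep_ideal :: "'l \<Rightarrow> ('v, 'k) fa set"
  where "dep_ideal t \<equiv> hspanJ (dep t)"

text \<open>\<open>K top\<close> is the preimage of the Orlik-Solomon ideal in the free algebra, and \<open>K t\<close> is its
  analogue for \<open>L\<^sub>\<le>\<^sub>t\<close>.\<close>
definition K :: "'l \<Rightarrow> ('v, 'k) fa set"
  where "K t = {a + b | a b. a \<in> dep_ideal t \<and> b \<in> D ` dep_ideal t}"

lemma subspace_K [simp]: "FA.subspace (K t)"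
  unfolding K_def by (intro FA.subspace_sums der.subspace_image) auto

lemma dep_ideal_K: "dep_ideal t \<subseteq> K t"
  unfolding K_def using FA.subspace_0[OF der.subspace_image[OF subspace_hspanJ]] by force

lemma D_dep_ideal_K: "p \<in> dep_ideal t \<Longrightarrow> D p \<in> K t"
  unfolding K_def using FA.subspace_0[OF subspace_hspanJ] by force

lemma J_K: "J \<subseteq> K t"
  using J_hspanJ dep_ideal_K by blast

lemma K_cases:
  assumes "p \<in> K t"
  obtains a b where "a \<in> dep_ideal t" "b \<in> dep_ideal t" "p = a + D b"
  using assms by (auto simp: K_def)

lemma K_free_alg: "K t \<subseteq> tensors"
  using hspanJ_free_alg D_free_alg unfolding K_def
  by (auto intro!: FA.subspace_add)

lemma D_K: "p \<in> K t \<Longrightarrow> D p \<in> K t"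
proof (erule K_cases)
  fix a b assume "a \<in> dep_ideal t" "b \<in> dep_ideal t" "p = a + D b"
  then have "D a \<in> K t" "D (D b) \<in> J"
    using D_dep_ideal_K D_D hspanJ_free_alg by blast+
  then show "D p \<in> K t" using \<open>p = _\<close> J_K by (auto simp: der.add intro!: FA.subspace_add)
qed

lemma K_mono: "t \<le> u \<Longrightarrow> K t \<subseteq> K u"
  using hspanJ_mono[of "dep t" "dep u"] unfolding K_def by (fastforce simp: dep_def)

text \<open>Lists of \<open>bot\<close>s have rank sum 0, so none is dependent. Hence the ideal
  imposes nothing in degree zero, and the full symmetric algebra survives there.\<close>

lemma K_bot: "K bot \<subseteq> J"
proof -
  have "\<not> lattice_dependent xs" if "set xs \<subseteq> {..bot}" for xs :: "'l list"
  proof -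
    have "x = bot" if "x \<in> set xs" for x using \<open>set xs \<subseteq> {..bot}\<close> that by (auto intro: bot.extremum_uniqueI)
    then have "sum_list (map rk xs) = 0" by (auto simp: sum_list_eq_0_iff)
    then show ?thesis unfolding lattice_dependent_def by (simp only: not_less0 not_False_eq_True)
  qed
  then have "dep bot = {}" by (auto simp: dep_def)
  then have "dep_ideal bot \<subseteq> J" by (auto simp: hspanJ_def hspan_def)
  then show ?thesis using D_J by (auto simp: K_def intro!: J_add)
qed

text \<open>A homogeneous letter with label not below \<open>t\<close> becomes the letter
  \<open>0\<close>, which is nonzero in the free algebra but lies in \<open>J\<close>.\<close>

abbreviation rho :: "'l \<Rightarrow> ('v, 'k) fa \<Rightarrow> ('v, 'k) fa"
  where "rho t \<equiv> hom (diag (\<lambda>x. of_bool (x \<le> t)))"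

lemma rho_word:
  assumes "homogeneous rs xs"
  shows "set xs \<subseteq> {..t} \<Longrightarrow> rho t (word rs) - word rs \<in> J"
    and "\<not> set xs \<subseteq> {..t} \<Longrightarrow> rho t (word rs) \<in> J"
proof -
  have "prod_list (map (\<lambda>x. of_bool (x \<le> t)) xs) = (of_bool (set xs \<subseteq> {..t}) :: 'k)"
    by (induction xs) auto
  then show "set xs \<subseteq> {..t} \<Longrightarrow> rho t (word rs) - word rs \<in> J"
    "\<not> set xs \<subseteq> {..t} \<Longrightarrow> rho t (word rs) \<in> J"
    using hom_diag_word[OF assms, of "\<lambda>x. of_bool (x \<le> t)"] by simp_all
qed

lemma rho_id:
  assumes "p \<in> hspanJ Q" "\<And>xs. xs \<in> Q \<Longrightarrow> set xs \<subseteq> {..t}"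
  shows "rho t p - p \<in> J"
  using assms rho_word(1) by (intro hspanJ_into[OF fa_linear_diff[OF fa_linear_hom fa_linear_id] subspace_J assms(1)])
    (auto intro: J_diff hom_diag_J)

lemma rho_hspanJ:
  assumes "p \<in> hspanJ Q" "\<And>xs. xs \<in> Q \<Longrightarrow> set xs \<subseteq> {..t} \<Longrightarrow> xs \<in> Q'"
  shows "rho t p \<in> hspanJ Q'"
proof (rule hspanJ_into[OF fa_linear_hom subspace_hspanJ assms(1)])
  show "rho t j \<in> hspanJ Q'" if "j \<in> J" for j using hom_diag_J[OF that] J_hspanJ by blast
  fix rs xs assume rs: "homogeneous rs xs" "xs \<in> Q"
  show "rho t (word rs) \<in> hspanJ Q'"
  proof (cases "set xs \<subseteq> {..t}")
    case True
    then have "word rs \<in> hspanJ Q'" using hspan_word[OF rs(1)] assms(2)[OF rs(2)] hspan_hspanJ by blast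
    then show ?thesis using hspanJ_cong[OF rho_word(1)[OF rs(1) True]] by simp
  next
    case False
    then show ?thesis using rho_word(2)[OF rs(1)] J_hspanJ by blast
  qed
qed

lemma D_word:
  assumes "homogeneous rs xs"
  shows "der_word parity (diff V) rs \<in> hspanJ {ys. step_down xs ys}"
  using diff_part by (intro der_word_step[OF assms]) (auto simp: diag_part subspace_scale)

text \<open>Deleting the letters outside \<open>L\<^sub>\<le>\<^sub>t\<close> respects the ideal: if a dependent word has a letter
  outside, then its differential can only have a term without such letters if the join drops, and
  then that term is dependent itself.\<close>
lemma rho_K:
  assumes "p \<in> K u" shows "rho t p \<in> K t"
proof -
  have "rho t (D b) \<in> K t" if b: "b \<in> dep_ideal u" for b
  proof (rule hspanJ_into[OF fa_linear_compose[OF fa_linear_der fa_linear_hom] subspace_K b])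
    show "rho t (D j) \<in> K t" if "j \<in> J" for j using D_J[OF that] hom_diag_J J_K by blast
    fix rs xs assume rs: "homogeneous rs xs" "xs \<in> dep u"
    note Dw = D_word[OF rs(1)]
    have "rho t (der_word parity (diff V) rs) \<in> K t"
    proof (cases "set xs \<subseteq> {..t}")
      case True
      have "set ys \<subseteq> {..t}" if "step_down xs ys" for ys
        by (rule list_step_subset[OF that True]) (auto simp: covers_iff_rk)
      then have "rho t (der_word parity (diff V) rs) - der_word parity (diff V) rs \<in> K t"
        using rho_id[OF Dw] J_K by blast
      moreover have "word rs \<in> dep_ideal t"
        using hspan_word[OF rs(1), of "dep t"] rs(2) True hspan_hspanJ by (auto simp: dep_def)
      then have "der_word parity (diff V) rs \<in> K t" using D_dep_ideal_K by fastforce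
      ultimately show ?thesis using FA.subspace_add[OF subspace_K] by (metis diff_add_cancel)
    next
      case False
      have "rho t (der_word parity (diff V) rs) \<in> dep_ideal t"
      proof (rule rho_hspanJ[OF Dw])
        fix ys assume "ys \<in> {ys. step_down xs ys}" and t: "set ys \<subseteq> {..t}"
        then have step: "step_down xs ys" by simp
        \<comment> \<open>If the join did not drop, it would be below \<open>t\<close> and so would
          every label in \<open>xs\<close>, contrary to this case.\<close>
        have "Sup (set ys) \<noteq> Sup (set xs)"
        proof
          assume eq: "Sup (set ys) = Sup (set xs)"
          have "Sup (set ys) \<le> t" using t by (auto intro: Sup_least)
          then have "x \<le> t" if "x \<in> set xs" for x unfolding eq using Sup_upper[OF that] by simp
          then show False using False by auto
        qed
        then have "lattice_dependent ys"
          using lattice_dependent_step_down[OF step] rs(2) by (simp add: dep_def)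
        then show "ys \<in> dep t" using t by (simp add: dep_def)
      qed
      then show ?thesis using dep_ideal_K by blast
    qed
    then show "rho t (D (word rs)) \<in> K t" by simp
  qed
  moreover have "rho t a \<in> K t" if "a \<in> dep_ideal u" for a
    using rho_hspanJ[OF that, of t "dep t"] dep_ideal_K by (auto simp: dep_def)
  ultimately show ?thesis
    using assms by (elim K_cases) (simp add: hom.add FA.subspace_add)
qed

section \<open>Contractions\<close>

text \<open>The homotopy of \<open>V\<^sub>\<le>\<^sub>t\<close> extended to \<open>V\<close>, such that \<open>\<partial> d\<close> is a projection
  of \<open>V\<^sub>0\<close> onto \<open>\<partial>((V\<^sub>\<le>\<^sub>t)\<^sub>1)\<close>.\<close>
definition contraction :: "'l \<Rightarrow> ('v \<Rightarrow> 'v) \<Rightarrow> bool"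
  where "contraction t d \<longleftrightarrow> odd_map d \<and>
    (\<forall>x\<le>t. \<forall>v\<in>part V x. d v \<in> sum_parts V {y. x \<lessdot> y \<and> y \<le> t}) \<and>
    (\<forall>x\<le>t. x \<noteq> bot \<longrightarrow> (\<forall>v\<in>part V x. diff V (d v) + d (diff V v) = v)) \<and>
    (\<forall>v\<in>part V bot. diff V (d (diff V (d v))) = diff V (d v))"

lemma contraction_part:
  assumes d: "contraction t d" and x: "x \<le> t" and v: "v \<in> part V x"
  shows "diff V (d v) + d (diff V v) \<in> part V x"
proof (cases "x = bot")
  case False
  then show ?thesis using d x v unfolding contraction_def by simp
next
  case True
  have "linear_on s s (total V) d" using d by (simp add: contraction_def odd_map_def)
  then have "d 0 = 0" by (rule linear_on_zero) simp
  then have "d (diff V v) = 0" using v diff_bot by (simp add: True)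
  moreover have "d v \<in> sum_parts V {y. bot \<lessdot> y \<and> y \<le> t}" using d x v True unfolding contraction_def by blast
  moreover have "{y. bot \<lessdot> y \<and> y \<le> t} = level t 1" by (auto simp: covers_iff_rk level_def)
  ultimately show ?thesis using diff_level[of t 0] by (auto simp: True level_0 sum_parts_singleton)
qed

lemma der_hspanJ:
  assumes f: "odd_map f" and p: "p \<in> hspanJ Q"
    and part: "\<And>xs x v. xs \<in> Q \<Longrightarrow> x \<in> set xs \<Longrightarrow> v \<in> part V x \<Longrightarrow> f v \<in> sum_parts V {y. R x y}"
    and step: "\<And>xs ys. xs \<in> Q \<Longrightarrow> list_step R xs ys \<Longrightarrow> ys \<in> Q'"
  shows "der parity f p \<in> hspanJ Q'"
proof (rule hspanJ_into[OF fa_linear_der subspace_hspanJ p])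
  show "der parity f j \<in> hspanJ Q'" if "j \<in> J" for j using der_odd_J[OF f that] J_hspanJ by blast
  fix rs xs assume rs: "homogeneous rs xs" "xs \<in> Q"
  have "der_word parity f rs \<in> hspanJ {ys. list_step R xs ys}"
    using part[OF rs(2)] by (intro der_word_step[OF rs(1)]) (auto simp: diag_part subspace_scale)
  also have "\<dots> \<subseteq> hspanJ Q'" using step[OF rs(2)] by (intro hspanJ_mono) auto
  finally show "der parity f (word rs) \<in> hspanJ Q'" by simp
qed

lemma der_up_hspanJ:
  assumes d: "contraction t d" and p: "p \<in> hspanJ Q" and Q: "\<And>xs. xs \<in> Q \<Longrightarrow> set xs \<subseteq> {..t}"
    and step: "\<And>xs ys. xs \<in> Q \<Longrightarrow> step_up t xs ys \<Longrightarrow> ys \<in> Q'"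
  shows "der parity d p \<in> hspanJ Q'"
  by (rule der_hspanJ[OF _ p _ step]) (use d Q in \<open>auto simp: contraction_def subset_iff\<close>)

lemma der_up_dep_ideal:
  assumes "contraction t d" "p \<in> dep_ideal t"
  shows "der parity d p \<in> dep_ideal t"
proof (rule der_up_hspanJ[OF assms])
  show "ys \<in> dep t" if xs: "xs \<in> dep t" and ys: "step_up t xs ys" for xs ys
    using lattice_dependent_step_up[OF list_step_mono[OF ys]] list_step_subset[OF ys, of "{..t}"] xs
    by (auto simp: dep_def)
qed (simp add: dep_def)

section \<open>The Euler derivation and its eigenvectors\<close>

definition euler :: "('v \<Rightarrow> 'v) \<Rightarrow> ('v, 'k) fa \<Rightarrow> ('v, 'k) fa"
  where "euler d p = D (der parity d p) + der parity d (D p)"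

lemma fa_linear_euler: "fa_linear (euler d)"
  unfolding euler_def by (intro fa_linear_add fa_linear_compose[OF fa_linear_der fa_linear_der])

lemma euler_word:
  assumes "odd_map d" "set rs \<subseteq> total V"
  shows "euler d (word rs) - der_word (\<lambda>v. v) (\<lambda>v. diff V (d v) + d (diff V v)) rs \<in> J"
  using der_anticommutator[OF odd_map_diff assms] by (simp add: euler_def)

lemma euler_J: "odd_map d \<Longrightarrow> p \<in> J \<Longrightarrow> euler d p \<in> J"
  unfolding euler_def by (intro J_add D_J der_odd_J)

text \<open>On letters below \<open>t\<close> the anticommutator of the differential with
  \<open>d\<close> preserves every part, so the labels move along equality.\<close>

lemma euler_hspanJ:
  assumes d: "contraction t d" and p: "p \<in> hspanJ Q" and Q: "\<And>xs. xs \<in> Q \<Longrightarrow> set xs \<subseteq> {..t}"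
  shows "euler d p \<in> hspanJ Q"
proof (rule hspanJ_into[OF fa_linear_euler subspace_hspanJ p])
  have od: "odd_map d" using d by (simp add: contraction_def)
  show "euler d j \<in> hspanJ Q" if "j \<in> J" for j using euler_J[OF od that] J_hspanJ by blast
  fix rs xs assume rs: "homogeneous rs xs" "xs \<in> Q"
  have "der_word (\<lambda>v. v) (\<lambda>v. diff V (d v) + d (diff V v)) rs \<in> hspanJ {ys. list_step (=) xs ys}"
    using contraction_part[OF d] Q[OF rs(2)]
    by (intro der_word_step[OF rs(1)]) (auto simp: sum_parts_singleton subset_iff)
  also have "\<dots> \<subseteq> hspanJ Q" using rs(2) by (intro hspanJ_mono) (auto dest: list_step_eq)
  finally show "euler d (word rs) \<in> hspanJ Q"
    using hspanJ_cong[OF euler_word[OF od list_all2_total[OF rs(1)]]] by simp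
qed

text \<open>The critical term \<open>der parity d (D b)\<close> equals
  \<open>euler d b - D (der parity d b)\<close>, and both \<open>euler d\<close> and
  \<open>der parity d\<close> preserve the dependent words.\<close>

lemma der_up_K:
  assumes d: "contraction t d" and p: "p \<in> K t"
  shows "der parity d p \<in> K t"
proof -
  obtain a b where ab: "a \<in> dep_ideal t" "b \<in> dep_ideal t" "p = a + D b" using p by (rule K_cases)
  have "der parity d p = der parity d a + euler d b - D (der parity d b)"
    by (simp add: ab(3) der.add euler_def)
  moreover have "der parity d a \<in> K t" "euler d b \<in> K t" "D (der parity d b) \<in> K t"
    using der_up_dep_ideal[OF d] euler_hspanJ[OF d ab(2)] ab dep_ideal_K D_dep_ideal_K
    by (auto simp: dep_def subset_iff)
  ultimately show ?thesis by (simp add: FA.subspace_add FA.subspace_diff)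
qed

lemma euler_K:
  assumes "contraction t d" "p \<in> K t"
  shows "euler d p \<in> K t"
  unfolding euler_def using assms by (intro FA.subspace_add subspace_K D_K der_up_K)

text \<open>Letters on which the Euler derivation acts by 1 or 0. The value 0 is allowed only for
  vectors in the kernel of the projection of the degree zero part.\<close>

definition eigenletters :: "('v \<Rightarrow> 'v) \<Rightarrow> 'v list \<Rightarrow> 'l list \<Rightarrow> bool"
  where "eigenletters d = list_all2 (\<lambda>u x. u \<in> part V x \<and>
    (diff V (d u) + d (diff V u) = u \<or> x = bot \<and> diff V (d u) + d (diff V u) = 0))"

text \<open>Letters of \<open>V\<^sub>0\<close> split under the projection \<open>\<partial> d\<close>, so words of eigenvectors span.\<close>
lemma word_span_eigenletters:
  assumes d: "contraction t d" and "homogeneous rs xs" "set xs \<subseteq> {..t}"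
  shows "word rs \<in> FA.span (word ` {us. eigenletters d us xs} \<union> J)"
  using assms(2,3)
proof (induction rule: list_all2_induct)
  case Nil
  show ?case by (rule FA.span_base) (simp add: eigenletters_def)
next
  case (Cons r rs x xs)
  let ?N = "\<lambda>xs. FA.span (word ` {us. eigenletters d us xs} \<union> J)"
  have x: "x \<le> t" and IH: "word rs \<in> ?N xs" using Cons by auto
  have step: "gen u * word rs \<in> ?N (x # xs)"
    if u: "u \<in> part V x" "diff V (d u) + d (diff V u) = u \<or> x = bot \<and> diff V (d u) + d (diff V u) = 0" for u
  proof (rule fa_linear_span_into[OF fa_linear_mult_left _ _ IH])
    fix p assume "p \<in> word ` {us. eigenletters d us xs} \<union> J"
    then show "gen u * p \<in> ?N (x # xs)"
    proof
      assume "p \<in> word ` {us. eigenletters d us xs}"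
      then obtain us where us: "p = word us" "eigenletters d us xs" by auto
      have "eigenletters d (u # us) (x # xs)" using us(2) u unfolding eigenletters_def by simp
      then show ?thesis unfolding us(1) word_mult by (intro FA.span_base) auto
    next
      assume "p \<in> J"
      then have "gen u * p \<in> J" using part_in_total[OF u(1)] by (intro J_mult_left) auto
      then show ?thesis by (intro FA.span_base) auto
    qed
  qed simp
  show ?case
  proof (cases "x = bot")
    case False
    then have "diff V (d r) + d (diff V r) = r" using d x Cons by (simp add: contraction_def)
    then show ?thesis using step[of r] Cons by (simp add: word_mult)
  next
    case True
    \<comment> \<open>\<open>q\<close> is the image of \<open>r\<close> under the projection onto
      the boundaries and has eigenvalue 1; \<open>r - q\<close> lies in its kernel and has
      eigenvalue 0.\<close>
    define q where "q = diff V (d r) + d (diff V r)"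
    have od: "odd_map d" using d by (simp add: contraction_def)
    then have ld: "linear_on s s (total V) d" by (simp add: odd_map_def)
    have d0: "d 0 = 0" "diff V 0 = 0" using linear_on_zero[OF ld] linear_on_zero[OF diff_linear] by auto
    have qp: "q \<in> part V bot" "r \<in> part V bot" using contraction_part[OF d x, of r] Cons True by (auto simp: q_def)
    have qd: "q = diff V (d r)" using diff_bot[OF qp(2)] d0 by (simp add: q_def)
    have "diff V (d q) + d (diff V q) = q"
      using d qp d0 by (simp add: diff_bot contraction_def qd)
    moreover have "diff V (d (r - q)) + d (diff V (r - q)) = 0"
    proof -
      have t: "r \<in> total V" "q \<in> total V" using qp part_in_total by auto
      have "diff V (d (r - q)) = diff V (d r) - diff V (d q)"
        using linear_on_diff[OF ld _ t] linear_on_diff[OF diff_linear] odd_map_total[OF od] t by simp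
      also have "\<dots> = 0" using d qp by (simp add: contraction_def qd)
      finally show ?thesis using d0 diff_bot[OF subspace_diff[OF _ qp(2,1)]] by simp
    qed
    moreover have rq: "r - q \<in> part V bot" using qp by (intro subspace_diff) auto
    moreover have "q \<in> part V x" "r - q \<in> part V x" using qp rq by (simp_all only: True)
    ultimately have "gen q * word rs \<in> ?N (x # xs)" "gen (r - q) * word rs \<in> ?N (x # xs)"
      using True by (intro step; blast)+
    moreover have "(gen (q + (r - q)) - gen q - gen (r - q)) * word rs \<in> J"
      using qp rq part_in_total list_all2_total[OF Cons(2)] by (intro J_mult_right J_gen_add) auto
    then have "(gen (q + (r - q)) - gen q - gen (r - q)) * word rs \<in> ?N (x # xs)" by (intro FA.span_base) auto
    ultimately have "(gen (q + (r - q)) - gen q - gen (r - q)) * word rs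
        + (gen q * word rs + gen (r - q) * word rs) \<in> ?N (x # xs)"
      by (intro FA.span_add)
    then show ?thesis by (simp add: left_diff_distrib word_mult)
  qed
qed

text \<open>The eigenvalue counts the letters fixed by the anticommutator; a letter with label other
  than \<open>bot\<close> is one of them, hence \<open>n > 0\<close>.\<close>

lemma euler_eigenletters:
  assumes d: "contraction t d" and us: "eigenletters d us xs" and xs: "\<exists>x\<in>set xs. x \<noteq> bot"
  shows "\<exists>n::nat. n > 0 \<and> euler d (word us) - fscale (of_nat n) (word us) \<in> J"
proof -
  let ?e = "\<lambda>v. diff V (d v) + d (diff V v)"
  have p: "homogeneous us xs"
    using us unfolding eigenletters_def by (rule list_all2_mono) simp
  have "\<exists>n::nat. ((\<exists>x\<in>set xs. x \<noteq> bot) \<longrightarrow> n > 0) \<and> der_word (\<lambda>v. v) ?e us - fscale (of_nat n) (word us) \<in> J"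
    using us unfolding eigenletters_def
  proof (induction rule: list_all2_induct)
    case Nil
    show ?case by (intro exI[of _ 0]) (simp add: J_0)
  next
    case (Cons u us x xs)
    then obtain n where n: "(\<exists>x\<in>set xs. x \<noteq> bot) \<longrightarrow> n > 0" "der_word (\<lambda>v. v) ?e us - fscale (of_nat n) (word us) \<in> J"
      by blast
    have "homogeneous us xs" using Cons(2) by (rule list_all2_mono) simp
    then have free: "word us \<in> tensors" using list_all2_total by simp
    have "gen u * (der_word (\<lambda>v. v) ?e us - fscale (of_nat n) (word us)) \<in> J"
      using n(2) Cons(1) part_in_total by (intro J_mult_left) auto
    then have *: "gen u * der_word (\<lambda>v. v) ?e us - fscale (of_nat n) (word (u # us)) \<in> J"
      by (simp add: right_diff_distrib fscale_mult_right word_mult)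
    consider "?e u = u" | "x = bot" "?e u = 0" using Cons(1) by auto
    then show ?case
    proof cases
      case 1
      then have "der_word (\<lambda>v. v) ?e (u # us) - fscale (of_nat (Suc n) :: 'k) (word (u # us))
        = gen u * der_word (\<lambda>v. v) ?e us - fscale (of_nat n) (word (u # us))"
        by (simp add: FA.scale_left_distrib)
      then have "der_word (\<lambda>v. v) ?e (u # us) - fscale (of_nat (Suc n)) (word (u # us)) \<in> J"
        using * by (simp only:)
      then show ?thesis by blast
    next
      case 2
      have "gen 0 * word us + (gen u * der_word (\<lambda>v. v) ?e us - fscale (of_nat n) (word (u # us))) \<in> J"
        using * by (intro J_add J_mult_right free J_gen_0)
      then show ?thesis using 2 n(1) by (intro exI[of _ n]) (simp add: word_mult add_diff_eq)
    qed
  qed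
  then obtain n :: nat where n: "n > 0" "der_word (\<lambda>v. v) ?e us - fscale (of_nat n) (word us) \<in> J" using xs by blast
  have "(euler d (word us) - der_word (\<lambda>v. v) ?e us) + (der_word (\<lambda>v. v) ?e us - fscale (of_nat n) (word us)) \<in> J"
    using d euler_word[OF _ list_all2_total[OF p]] n(2) by (intro J_add) (auto simp: contraction_def)
  then show ?thesis using n(1) by auto
qed

lemma word_span_eigenvectors:
  assumes d: "contraction t d" and rs: "homogeneous rs xs"
    and xs: "set xs \<subseteq> {..t}" "\<exists>x\<in>set xs. x \<noteq> bot"
  shows "word rs \<in> FA.span {p \<in> hspanJ {xs}. \<exists>n::nat. n > 0 \<and> euler d p - fscale (of_nat n) p \<in> J}"
    (is "_ \<in> FA.span ?E")
proof -
  have "word us \<in> ?E" if "eigenletters d us xs" for us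
  proof -
    have "homogeneous us xs"
      using that unfolding eigenletters_def by (rule list_all2_mono) simp
    then have "word us \<in> hspanJ {xs}" using hspan_word[of us xs "{xs}"] hspan_hspanJ by auto
    then show ?thesis using euler_eigenletters[OF d that xs(2)] by simp
  qed
  \<comment> \<open>Any eigenvalue fits an element of \<open>J\<close>, as both sides of the
    congruence lie in \<open>J\<close>; 1 is taken.\<close>
  moreover have "p \<in> ?E" if "p \<in> J" for p
  proof -
    have "euler d p - fscale (of_nat 1) p \<in> J" using that d euler_J[of d p] by (auto simp: contraction_def intro: J_diff)
    then show ?thesis using that J_hspanJ by (auto intro!: exI[of _ 1])
  qed
  ultimately have "word ` {us. eigenletters d us xs} \<union> J \<subseteq> ?E" by blast
  then show ?thesis using word_span_eigenletters[OF d rs xs(1)] FA.span_mono by blast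
qed

text \<open>The homotopy consists of separate maps per degree, lives only below \<open>t\<close>,
  and in degree 0 only on boundaries. So \<open>dh 0\<close> is composed with a projection onto the
  boundaries, 0 is put outside \<open>t\<close>, and the pieces are glued part by part.\<close>

lemma exists_contraction:
  assumes dh: "L_homotopy s t (below V t) dh"
  shows "\<exists>d. contraction t d"
proof -
  define ch where "ch i = sum_parts V (level t i)" for i
  define B where "B = diff V ` ch 1"
  have ch_total: "ch i \<subseteq> total V" "subspace (ch i)" for i
    unfolding ch_def by (simp_all add: parts_mono)
  have below: "chains (below V t) = ch" "part (below V t) = part V" "diff (below V t) = diff V"
    by (simp_all add: below_simps ch_def[abs_def])
  have dh0: "linear_on s s B (dh 0)" "dh 0 ` B \<subseteq> ch 1"
    and dhi: "\<And>i. i \<in> {1..rk t} \<Longrightarrow> linear_on s s (ch i) (dh i)"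
      "\<And>i v. i \<in> {1..rk t} \<Longrightarrow> v \<in> ch i \<Longrightarrow> dh (i - 1) (diff V v) + diff V (dh i v) = v"
    and dhi1: "\<And>i. i \<in> {1..rk t} \<Longrightarrow> dh i ` ch i \<subseteq> ch (i + 1)"
    and dhx: "\<And>x. x \<le> t \<Longrightarrow> x \<noteq> bot \<Longrightarrow> dh (rk x) ` part V x \<subseteq> sum_parts V {y. x \<lessdot> y \<and> y \<le> t}"
    using dh[unfolded L_homotopy_def below sum_parts_below, folded B_def] by simp_all
  have B: "subspace B" unfolding B_def
  proof (rule subspaceI)
    show "0 \<in> diff V ` ch 1"
      using linear_on_zero[OF diff_linear] subspace_0[OF ch_total(2), of 1] by force
    fix a b c assume "a \<in> diff V ` ch 1"
    then obtain u where u: "a = diff V u" "u \<in> ch 1" by auto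
    then have "s c a = diff V (s c u)" using diff_linear ch_total(1)[of 1] by (auto simp: linear_on_def)
    then show "s c a \<in> diff V ` ch 1" using subspace_scale[OF ch_total(2) u(2)] by blast
    assume "b \<in> diff V ` ch 1"
    then obtain v where v: "b = diff V v" "v \<in> ch 1" by auto
    moreover from this u have "u \<in> total V" "v \<in> total V" using ch_total(1)[of 1] by auto
    ultimately have "a + b = diff V (u + v)" using diff_linear u by (simp add: linear_on_def)
    then show "a + b \<in> diff V ` ch 1" using subspace_add[OF ch_total(2) u(2) v(2)] by blast
  qed
  \<comment> \<open>\<open>quot_map s B\<close> is a projection with kernel \<open>B\<close>, so the
    complementary \<open>q\<close> is a projection onto \<open>B\<close>.\<close>
  define q where "q v = v - quot_map s B v" for v
  interpret qm: Vector_Spaces.linear s s "quot_map s B"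
    by (rule quot_map(1)[OF vector_space_axioms B])
  have qB: "q v \<in> B" for v
    using quot_map(2,3)[OF vector_space_axioms B] by (simp add: q_def qm.diff flip: quot_map(3)[OF vector_space_axioms B])
  have qid: "q v = v" if "v \<in> B" for v
    using that quot_map(3)[OF vector_space_axioms B] by (simp add: q_def)
  define g where "g x = (if x = bot then dh 0 \<circ> q else if x \<le> t then dh (rk x) else (\<lambda>_. 0))" for x
  have part_ch: "part V x \<subseteq> ch (rk x)" if "x \<le> t" for x
    unfolding ch_def using that by (intro part_subset) (auto simp: level_def)
  have rkt: "rk x \<in> {1..rk t}" if "x \<le> t" "x \<noteq> bot" for x
    using that rk_mono[of x t] rk_eq_0_iff[of x] by (metis atLeastAtMost_iff less_one linorder_le_less_linear)
  have glin: "linear_on s s (part V x) (g x)" for x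
  proof -
    have "q (u + v) = q u + q v" "q (s c u) = s c (q u)" for u v c
      by (simp_all add: q_def qm.add qm.scale scale_right_diff_distrib)
    then have "linear_on s s (part V x) (dh 0 \<circ> q)"
      using dh0(1) qB unfolding linear_on_def by simp
    moreover have "linear_on s s (part V x) (dh (rk x))" if "x \<le> t" "x \<noteq> bot"
      using linear_on_subset[OF dhi(1)[OF rkt[OF that]] part_ch[OF that(1)]] .
    moreover have "linear_on s s (part V x) (\<lambda>_. 0)" by (simp add: linear_on_def)
    ultimately show ?thesis unfolding g_def by (cases "x = bot"; cases "x \<le> t") simp_all
  qed
  define d where "d = glue g"
  have dlin: "linear_on s s (total V) d" unfolding d_def by (rule glue_linear[OF glin])
  have dp: "d v = g x v" if "v \<in> part V x" for v x
    unfolding d_def by (rule glue_part[OF glin that])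
  have up: "d v \<in> sum_parts V {y. x \<lessdot> y \<and> y \<le> t}" if "x \<le> t \<or> x = bot" "v \<in> part V x" for x v
  proof (cases "x = bot")
    case True
    have "dh 0 (q v) \<in> ch 1" using dh0(2) qB by blast
    also have "ch 1 = sum_parts V {y. bot \<lessdot> y \<and> y \<le> t}"
      unfolding ch_def by (rule arg_cong[where f = "sum_parts V"]) (auto simp: covers_iff_rk level_def)
    finally show ?thesis using dp[OF that(2)] True by (simp add: g_def)
  next
    case False
    then show ?thesis using dhx[of x] that dp[OF that(2)] by (auto simp: g_def)
  qed
  have "odd_map d"
  proof (rule odd_mapI[where c = Suc, OF dlin])
    fix x
    have "sum_parts V {y. x \<lessdot> y \<and> y \<le> t} \<subseteq> chains V (Suc (rk x))"
      unfolding chains_eq by (rule parts_mono) (auto simp: rk_covers)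
    moreover have "d v = 0" if "\<not> x \<le> t" "x \<noteq> bot" "v \<in> part V x" for v
      using dp[OF that(3)] that by (simp add: g_def)
    ultimately show "d ` part V x \<subseteq> chains V (Suc (rk x))"
      using up[of x] subspace_0[OF subspace_chains] by (metis (no_types, lifting) image_subsetI subsetD)
  qed auto
  moreover have "diff V (d (diff V (d v))) = diff V (d v)" if v: "v \<in> part V bot" for v
  proof -
    have dv: "d v \<in> ch 1" using dh0(2) qB dp[OF v] by (auto simp: g_def)
    \<comment> \<open>Apply the differential to the homotopy identity in degree 1. For
      \<open>t = bot\<close> that identity is out of range, but then there are no boundaries except
      0.\<close>
    have dh_section: "diff V (dh 0 b) = b" if "b \<in> B" for b
    proof (cases "t = bot")
      case True
      have "level t 1 = {}" using True bot.extremum_uniqueI unfolding level_def by force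
      then have "ch 1 = {0}" by (simp only: ch_def) (simp add: sum_parts_def)
      then have "B = {0}" using linear_on_zero[OF diff_linear] by (simp add: B_def)
      then show ?thesis using that dh0(2) \<open>ch 1 = {0}\<close> linear_on_zero[OF diff_linear] by auto
    next
      case False
      then have 1: "1 \<in> {1..rk t}" using rkt[of t] by simp
      obtain u where u: "u \<in> ch 1" "b = diff V u" using \<open>b \<in> B\<close> by (auto simp: B_def)
      have 2: "dh 1 u \<in> total V" using dhi1[OF 1] u(1) ch_total(1) by blast
      have "dh 0 b \<in> total V" using dh0(2) ch_total(1) \<open>b \<in> B\<close> by blast
      have "diff V u = diff V (dh 0 b + diff V (dh 1 u))" using dhi(2)[OF 1 u(1)] u(2) by simp
      also have "\<dots> = diff V (dh 0 b) + diff V (diff V (dh 1 u))"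
        using diff_linear diff_total[OF 2] \<open>dh 0 b \<in> total V\<close> by (simp add: linear_on_def)
      finally show ?thesis using u(2) diff_diff[OF 2] by simp
    qed
    have b: "diff V (d v) \<in> B" using dv by (simp add: B_def)
    have "diff V (d v) \<in> part V bot"
      using dv diff_level[of t 0] by (auto simp: ch_def level_0 sum_parts_singleton)
    then have "d (diff V (d v)) = dh 0 (diff V (d v))" using dp qid[OF b] by (simp add: g_def)
    then show ?thesis using dh_section[OF b] by simp
  qed
  moreover have "diff V (d v) + d (diff V v) = v" if x: "x \<le> t" "x \<noteq> bot" and v: "v \<in> part V x" for x v
  proof -
    have dv: "diff V v \<in> sum_parts V {y. y \<lessdot> x}" using diff_part v by auto
    have dch: "diff V v \<in> ch (rk x - 1)"
      unfolding ch_def by (rule subsetD[OF parts_mono dv]) (use x in \<open>auto simp: covers_iff_rk level_def\<close>)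
    have "d (diff V v) = dh (rk x - 1) (diff V v)"
    \<comment> \<open>In degree 1 the boundary lies in \<open>B\<close>, which \<open>q\<close>
      fixes, so \<open>d\<close> agrees with \<open>dh 0\<close> on it.\<close>
    proof (cases "rk x = 1")
      case True
      then have "v \<in> ch 1" using v part_ch[OF x(1)] by auto
      then have b: "diff V v \<in> B" by (simp add: B_def)
      have "diff V v \<in> part V bot"
        unfolding sum_parts_singleton[symmetric]
        by (rule subsetD[OF parts_mono dv]) (use True in \<open>auto simp: covers_iff_rk\<close>)
      then show ?thesis using dp qid[OF b] True by (simp add: g_def)
    next
      case False
      then have i: "rk x - 1 \<in> {1..rk t}" using rkt[OF x] by auto
      obtain f where f: "diff V v = (\<Sum>y\<in>{y. y \<lessdot> x}. f y)" "\<And>y. y \<lessdot> x \<Longrightarrow> f y \<in> part V y"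
        using dv by (auto simp: sum_parts_def)
      have y: "y \<le> t" "y \<noteq> bot" "rk y = rk x - 1" if "y \<lessdot> x" for y
        using that x False by (auto simp: covers_iff_rk)
      have "d (diff V v) = (\<Sum>y\<in>{y. y \<lessdot> x}. d (f y))" unfolding f(1)
        by (rule linear_on_sum[OF dlin]) (use f(2) part_in_total in auto)
      also have "\<dots> = (\<Sum>y\<in>{y. y \<lessdot> x}. dh (rk x - 1) (f y))"
        using dp[OF f(2)] y by (intro sum.cong) (auto simp: g_def)
      also have "\<dots> = dh (rk x - 1) (\<Sum>y\<in>{y. y \<lessdot> x}. f y)"
        by (rule linear_on_sum[OF dhi(1)[OF i] ch_total(2), symmetric]) (use f(2) y part_ch in fastforce)
      finally show ?thesis by (simp add: f(1))
    qed
    then show ?thesis using dhi(2)[OF rkt[OF x], of v] part_ch[OF x(1)] v dp[OF v] x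
      by (auto simp: g_def add.commute)
  qed
  ultimately have "contraction t d" using up unfolding contraction_def by simp
  then show ?thesis by blast
qed

end

section \<open>The generalized Orlik-Solomon algebra as a quotient of the free algebra\<close>

context lgraded
begin

lemma S_class_eq_quot_map: "S_class s V = quot_map fscale J"
  by (simp add: S_class_def J_def super_rels_def)

lemma fa_linear_S_class: "fa_linear (S_class s V)"
  unfolding S_class_eq_quot_map by (rule quot_map_fscale(1)[OF subspace_J])

sublocale S: Vector_Spaces.linear fscale fscale "S_class s V"
  by (rule fa_linear_S_class)

lemma S_class_0_iff: "S_class s V p = 0 \<longleftrightarrow> p \<in> J"
  unfolding S_class_eq_quot_map by (rule quot_map_fscale(3)[OF subspace_J])

lemma S_class_idem: "S_class s V (S_class s V p) = S_class s V p"
  unfolding S_class_eq_quot_map by (rule quot_map_fscale(2)[OF subspace_J])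

lemma S_class_eq_iff: "S_class s V p = S_class s V q \<longleftrightarrow> p - q \<in> J"
  using S_class_0_iff[of "p - q"] by (simp add: S.diff)

lemma S_class_cong: "p - S_class s V p \<in> J"
  unfolding S_class_eq_iff[symmetric] by (simp add: S_class_idem)

lemma S_class_free_alg: "p \<in> tensors \<Longrightarrow> S_class s V p \<in> tensors"
  using FA.subspace_diff[OF subspace_free_alg, of p "total V" "p - S_class s V p"] S_class_cong J_free_alg by auto

lemma S_alg: "a \<in> S_alg s V \<longleftrightarrow> a \<in> tensors \<and> S_class s V a = a"
  unfolding S_alg_def using S_class_free_alg S_class_idem by force

lemma S_class_mult:
  assumes "p \<in> tensors" "q \<in> tensors"
  shows "S_class s V (S_class s V p * q) = S_class s V (p * q)"
    and "S_class s V (p * S_class s V q) = S_class s V (p * q)"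
  unfolding S_class_eq_iff
  using FA.subspace_neg[OF subspace_J J_mult_right[OF S_class_cong assms(2), of p]]
    FA.subspace_neg[OF subspace_J J_mult_left[OF S_class_cong assms(1), of q]]
  by (simp_all add: algebra_simps)

lemma chain_words:
  assumes "list_all2 (\<lambda>r j. r \<in> chains V j) rs js"
  shows "set rs \<subseteq> total V" "hom parity (word rs) - fscale ((- 1) ^ sum_list js) (word rs) \<in> J"
proof -
  have p: "prod_list (map (\<lambda>j. (- 1) ^ j) js) = ((- 1) ^ sum_list js :: 'k)"
    by (induction js) (simp_all add: power_add)
  have "r \<in> total V \<and> parity r = s ((- 1) ^ j) r" if "r \<in> chains V j" for r j
    using that parity_chains chains_subset by auto
  from hom_diag_word_general[OF assms, of "\<lambda>x. (- 1) ^ rk x" "\<lambda>j. (- 1) ^ j", OF this]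
  show "set rs \<subseteq> total V" "hom parity (word rs) - fscale ((- 1) ^ sum_list js) (word rs) \<in> J"
    unfolding p by simp_all
qed

text \<open>Translates the sign in the super-Leibniz rule for S, given by the degree, into
  \<open>hom parity\<close>, the twist in \<open>der_mult\<close>.\<close>

lemma S_deg:
  assumes "a \<in> S_deg s V i"
  shows "a \<in> tensors" "hom parity a - fscale ((- 1) ^ i) a \<in> J"
proof -
  have w: "S_class s V (word rs) \<in> tensors"
      "hom parity (S_class s V (word rs)) - fscale ((- 1) ^ i) (S_class s V (word rs)) \<in> J"
    if "list_all2 (\<lambda>r j. r \<in> chains V j) rs js" "sum_list js = i" for rs js
  proof -
    show "S_class s V (word rs) \<in> tensors"
      using chain_words(1)[OF that(1)] by (intro S_class_free_alg) simp
    have d: "word rs - S_class s V (word rs) \<in> J" by (rule S_class_cong)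
    have "hom parity (word rs) - fscale ((- 1) ^ i) (word rs)
       - (hom parity (word rs - S_class s V (word rs)) - fscale ((- 1) ^ i) (word rs - S_class s V (word rs))) \<in> J"
      using J_diff[OF chain_words(2)[OF that(1), unfolded that(2)] J_diff[OF hom_diag_J[OF d] J_scale[OF d]]] .
    then show "hom parity (S_class s V (word rs)) - fscale ((- 1) ^ i) (S_class s V (word rs)) \<in> J"
      by (simp only: hom.diff FA.scale_right_diff_distrib) (simp add: algebra_simps)
  qed
  show "a \<in> tensors"
    by (rule fa_linear_span_into[OF fa_linear_id _ _ assms[unfolded S_deg_def]]) (auto intro: w)
  have "fa_linear (\<lambda>a. hom parity a - fscale ((- 1) ^ i) a :: ('v, 'k) fa)"
    by (intro fa_linear_diff fa_linear_hom fa_linearI) (simp_all add: FA.scale_right_distrib mult.commute)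
  from fa_linear_span_into[OF this subspace_J _ assms[unfolded S_deg_def]]
  show "hom parity a - fscale ((- 1) ^ i) a \<in> J" using w(2) by auto
qed

lemma S_class_D: "p - q \<in> J \<Longrightarrow> S_class s V (D p) = S_class s V (D q)"
  unfolding S_class_eq_iff by (simp add: D_J flip: der.diff)

section \<open>Existence and uniqueness of the extended differential\<close>

text \<open>Exactly the predicate under the choice operator in \<open>S_diff\<close>, named so that
  existence and uniqueness can be stated.\<close>

definition S_derivation :: "(('v, 'k) fa \<Rightarrow> ('v, 'k) fa) \<Rightarrow> bool"
  where "S_derivation E \<longleftrightarrow>
    linear_on fscale fscale (S_alg s V) E \<and> E ` S_alg s V \<subseteq> S_alg s V \<and>
    (\<forall>v\<in>total V. E (S_class s V (gen v)) = S_class s V (gen (diff V v))) \<and>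
    (\<forall>i. \<forall>a\<in>S_deg s V i. \<forall>b\<in>S_alg s V.
      E (S_mult s V a b) = S_mult s V (E a) b + (- 1) ^ i * S_mult s V a (E b))"

lemma S_derivation_D: "S_derivation (\<lambda>a. S_class s V (D a))"
  unfolding S_derivation_def
proof (intro conjI ballI allI)
  show "linear_on fscale fscale (S_alg s V) (\<lambda>a. S_class s V (D a))"
    by (simp add: linear_on_def der.add der.scale S.add S.scale)
  show "(\<lambda>a. S_class s V (D a)) ` S_alg s V \<subseteq> S_alg s V"
    using D_free_alg S_class_free_alg by (auto simp: S_alg S_class_idem)
  show "S_class s V (D (S_class s V (gen v))) = S_class s V (gen (diff V v))" if "v \<in> total V" for v
    using S_class_D[OF S_class_cong, of "gen v"] by simp
  fix i a b
  assume a: "a \<in> S_deg s V i" and b: "b \<in> S_alg s V"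
  have free: "a \<in> tensors" "b \<in> tensors" using a b S_deg(1) by (auto simp: S_alg)
  have "S_class s V (D (S_mult s V a b)) = S_class s V (D a * b + hom parity a * D b)"
    using S_class_D[OF S_class_cong, of "a * b"] by (simp add: S_mult_def der_mult)
  moreover have "S_class s V (hom parity a * D b) = S_class s V (fscale ((- 1) ^ i) a * D b)"
    unfolding S_class_eq_iff using J_mult_right[OF S_deg(2)[OF a] D_free_alg[OF free(2)]]
    by (simp add: left_diff_distrib)
  ultimately show "S_class s V (D (S_mult s V a b)) =
      S_mult s V (S_class s V (D a)) b + (- 1) ^ i * S_mult s V a (S_class s V (D b))"
    using free D_free_alg by (simp add: S_mult_def S_class_mult S.add S.scale fscale_neg_one fscale_mult_left)
qed

lemma S_derivation_S_diff: "S_derivation (S_diff s V)"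
  using someI[of S_derivation, OF S_derivation_D] unfolding S_diff_def S_derivation_def .

text \<open>The Leibniz rule forces the value on every homogeneous word, and modulo \<open>J\<close>
  these words span; so the choice in \<open>S_diff\<close> is harmless.\<close>

lemma S_derivation_unique:
  assumes E: "S_derivation E" and p: "p \<in> tensors"
  shows "E (S_class s V p) = S_class s V (D p)"
proof -
  note E' = E[unfolded S_derivation_def]
  have w: "E (S_class s V (word rs)) = S_class s V (D (word rs))"
    if "homogeneous rs xs" for rs xs
    using that
  proof (induction rule: list_all2_induct)
    case Nil
    have 1: "S_class s V 1 \<in> S_deg s V 0" unfolding S_deg_def
      by (rule FA.span_base) (auto simp: word_Nil[symmetric] intro!: exI[of _ "[]"])
    have f1: "1 \<in> tensors" by (simp flip: word_Nil)
    then have 2: "S_class s V 1 \<in> S_alg s V" by (simp add: S_alg_def)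
    then have 3: "E (S_class s V 1) \<in> S_alg s V" using E' by blast
    \<comment> \<open>The Leibniz rule for the product of the unit with itself reads E 1 = E 1 + E
      1, hence E 1 = 0.\<close>
    have "E (S_mult s V (S_class s V 1) (S_class s V 1)) =
      S_mult s V (E (S_class s V 1)) (S_class s V 1) + (- 1) ^ 0 * S_mult s V (S_class s V 1) (E (S_class s V 1))"
      using E' 1 2 by blast
    then have "E (S_class s V 1) = E (S_class s V 1) + E (S_class s V 1)"
      using 2 3 f1 S_class_mult[OF _ f1] S_class_mult(1)[OF f1] by (simp add: S_mult_def S_alg S_class_idem)
    then show ?case by (simp add: word_Nil[symmetric] der.zero S.zero)
  next
    case (Cons r rs x xs)
    have r: "r \<in> chains V (rk x)" "r \<in> total V" using Cons(1) part_subset_chains part_in_total by auto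
    have free: "gen r \<in> tensors"
       "gen (diff V r) \<in> tensors"
       "word rs \<in> tensors"
       using r(2) diff_total list_all2_total[OF Cons(2)] by auto
    have "S_class s V (gen r) \<in> S_deg s V (rk x)" unfolding S_deg_def
      using r(1) by (intro FA.span_base CollectI exI[of _ "[r]"] exI[of _ "[rk x]"]) auto
    moreover have "S_class s V (word rs) \<in> S_alg s V" using free by (simp add: S_alg_def)
    ultimately have "E (S_mult s V (S_class s V (gen r)) (S_class s V (word rs))) =
        S_mult s V (S_class s V (gen (diff V r))) (S_class s V (word rs))
        + (- 1) ^ rk x * S_mult s V (S_class s V (gen r)) (S_class s V (D (word rs)))"
      using E' r(2) Cons(3) by metis
    then have "E (S_class s V (gen r * word rs)) = S_class s V (gen (diff V r) * word rs)
        + S_class s V (fscale ((- 1) ^ rk x) (gen r) * D (word rs))"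
      using free D_free_alg[OF free(3)]
      by (simp add: S_mult_def S_class_mult S_class_free_alg fscale_neg_one S.scale fscale_mult_left)
    also have "S_class s V (fscale ((- 1) ^ rk x) (gen r) * D (word rs)) = S_class s V (gen (parity r) * D (word rs))"
      unfolding S_class_eq_iff parity_chains[OF r(1)]
      using J_neg[OF J_mult_right[OF J_gen_scale[OF r(2), of "(- 1) ^ rk x"] D_free_alg[OF free(3)]]]
      by (simp add: left_diff_distrib)
    finally show ?case by (simp add: word_mult S.add)
  qed
  let ?N = "{p \<in> tensors. E (S_class s V p) = S_class s V (D p)}"
  have lin: "linear_on fscale fscale (S_alg s V) E" using E' by blast
  have N: "FA.subspace ?N"
  proof (rule FA.subspaceI)
    have "E 0 = 0" by (rule FA.linear_on_zero[OF lin]) (auto simp: S_alg_def intro: S.subspace_image)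
    then show "0 \<in> ?N" by (simp add: S.zero der.zero FA.subspace_0)
    show "p + q \<in> ?N" if "p \<in> ?N" "q \<in> ?N" for p q
      using that lin by (auto simp: S.add der.add FA.subspace_add linear_on_def S_alg_def)
    show "fscale c p \<in> ?N" if "p \<in> ?N" for c p
      using that lin by (auto simp: S.scale der.scale FA.subspace_scale linear_on_def S_alg_def)
  qed
  obtain h j where h: "p = h + j" "h \<in> hspan UNIV" "j \<in> J"
    using p free_alg_hspanJ by (auto simp: hspanJ_def)
  have "h \<in> ?N"
    by (rule hspan_into[OF fa_linear_id N h(2)]) (use w list_all2_total in auto)
  moreover have "S_class s V p = S_class s V h" "S_class s V (D p) = S_class s V (D h)"
    using S_class_D[of p h] h by (auto simp: S_class_eq_iff)
  ultimately show ?thesis by simp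
qed

lemma S_diff_class: "p \<in> tensors \<Longrightarrow> S_diff s V (S_class s V p) = S_class s V (D p)"
  by (rule S_derivation_unique[OF S_derivation_S_diff])

lemma span_S_class_words: "FA.span {S_class s V (word rs) | rs xs. P rs xs} = S_class s V ` wspan {rs. \<exists>xs. P rs xs}"
proof -
  have "{S_class s V (word rs) | rs xs. P rs xs} = S_class s V ` word ` {rs. \<exists>xs. P rs xs}" by auto
  then show ?thesis by (simp add: S.span_image)
qed

lemma S_class_hspanJ: "S_class s V ` hspanJ Q = S_class s V ` hspan Q"
proof
  show "S_class s V ` hspanJ Q \<subseteq> S_class s V ` hspan Q"
    by (auto simp: hspanJ_def S.add S_class_0_iff[THEN iffD2])
qed (intro image_mono hspan_hspanJ)

lemma dep_top: "dep top = {xs. lattice_dependent xs}"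
  unfolding dep_def by auto

lemma dependent_ideal_eq: "dependent_ideal s V = S_class s V ` dep_ideal top"
  unfolding dependent_ideal_def span_S_class_words S_class_hspanJ hspan_def dep_top
  by (simp add: conj_commute Bex_def)

lemma OS_ideal_eq: "OS_ideal s V = S_class s V ` K top"
proof -
  have "S_diff s V (S_class s V b) = S_class s V (D b)" if "b \<in> dep_ideal top" for b
    using that hspanJ_free_alg by (intro S_diff_class) blast
  then show ?thesis
    unfolding OS_ideal_def dependent_ideal_eq K_def by (auto simp: S.add image_iff) (metis S.add)+
qed

section \<open>The quotient algebra as a linear image of the free algebra\<close>

text \<open>Both quotient steps in one linear map. By \<open>P_0_iff\<close> its kernel is
  \<open>K top\<close>, which makes the chosen representatives irrelevant.\<close>

definition P :: "('v, 'k) fa \<Rightarrow> ('v, 'k) fa"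
  where "P p = OS_class s V (S_class s V p)"

lemma subspace_OS_ideal: "FA.subspace (OS_ideal s V)"
  unfolding OS_ideal_eq by (intro S.subspace_image) simp

lemma fa_linear_OS_class: "fa_linear (OS_class s V)"
  unfolding OS_class_def by (rule quot_map_fscale(1)[OF subspace_OS_ideal])

lemma fa_linear_P: "fa_linear P"
  unfolding P_def by (rule fa_linear_compose[OF fa_linear_S_class fa_linear_OS_class])

sublocale P: Vector_Spaces.linear fscale fscale P
  by (rule fa_linear_P)

lemma P_0_iff: "P p = 0 \<longleftrightarrow> p \<in> K top"
proof -
  have "P p = 0 \<longleftrightarrow> S_class s V p \<in> S_class s V ` K top"
    unfolding P_def OS_class_def OS_ideal_eq[symmetric]
    by (rule quot_map_fscale(3)[OF subspace_OS_ideal])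
  also have "\<dots> \<longleftrightarrow> p \<in> K top"
  proof
    assume "S_class s V p \<in> S_class s V ` K top"
    then obtain k where "k \<in> K top" "p - k \<in> J" by (auto simp: S_class_eq_iff)
    then show "p \<in> K top" using FA.subspace_add[OF subspace_K, of k top "p - k"] J_K by auto
  qed simp
  finally show ?thesis .
qed

lemma P_eq_iff: "P p = P q \<longleftrightarrow> p - q \<in> K top"
  using P_0_iff[of "p - q"] by (simp add: P.diff)

lemma OS_class_diff: "\<exists>k\<in>K top. OS_class s V a = a - S_class s V k"
proof -
  interpret O: Vector_Spaces.linear fscale fscale "OS_class s V" by (rule fa_linear_OS_class)
  have "OS_class s V (a - OS_class s V a) = 0"
    using quot_map_fscale(2)[OF subspace_OS_ideal, of a] by (simp add: O.diff flip: OS_class_def)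
  then have "a - OS_class s V a \<in> S_class s V ` K top"
    using quot_map_fscale(3)[OF subspace_OS_ideal] by (simp add: OS_class_def OS_ideal_eq)
  then obtain k where "k \<in> K top" "a - OS_class s V a = S_class s V k" by auto
  then show ?thesis by (intro bexI[of _ k]) (simp_all add: algebra_simps)
qed

lemma P_cong: "p - P p \<in> K top"
proof -
  obtain k where k: "k \<in> K top" "P p = S_class s V p - S_class s V k"
    using OS_class_diff[of "S_class s V p"] by (auto simp: P_def)
  have "(p - S_class s V p) - (k - S_class s V k) + k \<in> K top"
    by (rule FA.subspace_add[OF subspace_K FA.subspace_diff[OF subspace_K] k(1)])
      (rule subsetD[OF J_K S_class_cong])+
  then show ?thesis by (simp add: k(2) algebra_simps)
qed

lemma P_J: "p \<in> J \<Longrightarrow> P p = 0"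
  using P_0_iff J_K by blast

abbreviation OS :: "(('v, 'k) fa, 'l) lcomplex"
  where "OS \<equiv> OS_algebra s V"

text \<open>The differential of the quotient acts on a chosen representative. This differs from the
  class of \<open>p\<close> in S by the class of an element of \<open>K top\<close>, and
  \<open>D\<close> preserves \<open>K top\<close>.\<close>

lemma OS_diff: "p \<in> tensors \<Longrightarrow> diff OS (P p) = P (D p)"
proof -
  assume p: "p \<in> tensors"
  obtain k where k: "k \<in> K top" "P p = S_class s V p - S_class s V k"
    using OS_class_diff[of "S_class s V p"] by (auto simp: P_def)
  then have "P p = S_class s V (p - k)" by (simp add: S.diff)
  moreover have "p - k \<in> tensors" using p k K_free_alg by (intro FA.subspace_diff) auto
  ultimately have "diff OS (P p) = P (D (p - k))"
    by (simp add: OS_algebra_def S_diff_class P_def)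
  moreover have "P (D k) = 0" using D_K[OF k(1)] by (simp add: P_0_iff)
  ultimately show ?thesis by (simp add: der.diff P.diff)
qed

lemma P_hspanJ: "P ` hspanJ Q = P ` hspan Q"
proof
  show "P ` hspanJ Q \<subseteq> P ` hspan Q"
    by (auto simp: hspanJ_def P.add P_J)
qed (intro image_mono hspan_hspanJ)

lemma OS_part: "part OS x = P ` hspan {xs. Sup (set xs) = x}"
  unfolding OS_algebra_def S_part_def span_S_class_words
  by (simp add: image_image P_def hspan_def conj_commute Bex_def)

lemma chain_word_hspanJ:
  assumes "list_all2 (\<lambda>r j. r \<in> chains V j) rs js"
  shows "word rs \<in> hspanJ {xs. sum_list (map rk xs) = sum_list js}"
  using assms
proof (induction rule: list_all2_induct)
  case Nil
  show ?case by (rule subsetD[OF hspan_hspanJ hspan_word[of "[]" "[]"]]) auto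
next
  case (Cons r rs j js)
  show ?case unfolding word_Cons[of r rs]
    by (rule gen_mult_hspanJ[where Y = "{x. rk x = j}"]) (use Cons in \<open>auto simp: chains_eq\<close>)
qed

lemma OS_chains: "chains OS i = P ` hspan {xs. sum_list (map rk xs) = i}"
proof
  show "chains OS i \<subseteq> P ` hspan {xs. sum_list (map rk xs) = i}"
  proof -
    have "wspan {rs. \<exists>js. list_all2 (\<lambda>r j. r \<in> chains V j) rs js \<and> sum_list js = i}
        \<subseteq> hspanJ {xs. sum_list (map rk xs) = i}"
      using chain_word_hspanJ by (intro FA.span_minimal) auto
    then show ?thesis
      unfolding P_hspanJ[symmetric] OS_algebra_def S_deg_def span_S_class_words
      by (auto simp: image_image P_def)
  qed
  have "hspan {xs. sum_list (map rk xs) = i} \<subseteq> wspan {rs. \<exists>js. list_all2 (\<lambda>r j. r \<in> chains V j) rs js \<and> sum_list js = i}"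
    unfolding hspan_def
  proof (intro FA.span_mono image_mono subsetI)
    fix rs assume "rs \<in> {rs. \<exists>xs\<in>{xs. sum_list (map rk xs) = i}. homogeneous rs xs}"
    then obtain xs where xs: "homogeneous rs xs" "sum_list (map rk xs) = i" by auto
    have "list_all2 (\<lambda>r j. r \<in> chains V j) rs (map rk xs)"
      unfolding list.rel_map by (rule list_all2_mono[OF xs(1)]) (use part_subset_chains in auto)
    then show "rs \<in> {rs. \<exists>js. list_all2 (\<lambda>r j. r \<in> chains V j) rs js \<and> sum_list js = i}" using xs(2) by blast
  qed
  then show "P ` hspan {xs. sum_list (map rk xs) = i} \<subseteq> chains OS i"
    unfolding OS_algebra_def S_deg_def span_S_class_words by (auto simp: image_image P_def)
qed

lemma subspace_P_hspan [simp]: "FA.subspace (P ` hspan Q)"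
  by (rule P.subspace_image) simp

lemma P_hspan_mono: "Q \<subseteq> Q' \<Longrightarrow> P ` hspan Q \<subseteq> P ` hspan Q'"
  using hspan_mono by blast

text \<open>Dependent words vanish under \<open>P\<close>, so only independent ones have to be
  tested.\<close>

lemma P_hspan_subset:
  assumes "FA.subspace N"
    "\<And>rs xs. homogeneous rs xs \<Longrightarrow> xs \<in> Q \<Longrightarrow> \<not> lattice_dependent xs \<Longrightarrow> P (word rs) \<in> N"
  shows "P ` hspan Q \<subseteq> N"
proof
  fix a assume "a \<in> P ` hspan Q"
  then obtain p where p: "a = P p" "p \<in> hspan Q" by auto
  have "P (word rs) \<in> N" if "homogeneous rs xs" "xs \<in> Q" for rs xs
  proof (cases "lattice_dependent xs")
    case True
    then have "word rs \<in> dep_ideal top"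
      using hspan_word[OF that(1), of "dep top"] hspan_hspanJ dep_top by blast
    then have "P (word rs) = 0" using P_0_iff dep_ideal_K by blast
    then show ?thesis using FA.subspace_0[OF assms(1)] by simp
  qed (use assms(2) that in blast)
  then show "a \<in> N" unfolding p(1) by (rule hspan_into[OF fa_linear_P assms(1) p(2)])
qed

lemma P_hspan_independent: "P ` hspan Q = P ` hspan {xs \<in> Q. \<not> lattice_dependent xs}"
proof
  show "P ` hspan Q \<subseteq> P ` hspan {xs \<in> Q. \<not> lattice_dependent xs}"
    by (rule P_hspan_subset) (auto intro!: imageI hspan_word)
qed (rule P_hspan_mono, auto)

section \<open>The quotient is compatibly graded\<close>

lemma subspace_OS_part [simp]: "FA.subspace (part OS x)"
  by (simp add: OS_part)

lemma OS_sum_parts: "sum_parts OS Q = P ` hspan {xs. Sup (set xs) \<in> Q}"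
proof
  show "sum_parts OS Q \<subseteq> P ` hspan {xs. Sup (set xs) \<in> Q}"
  proof (rule FA.sum_parts_least)
    show "part OS x \<subseteq> P ` hspan {xs. Sup (set xs) \<in> Q}" if "x \<in> Q" for x
      unfolding OS_part by (rule P_hspan_mono) (use that in auto)
  qed simp
  show "P ` hspan {xs. Sup (set xs) \<in> Q} \<subseteq> sum_parts OS Q"
  proof (rule P_hspan_subset)
    fix rs xs assume rs: "homogeneous rs xs" "xs \<in> {xs. Sup (set xs) \<in> Q}"
    then have "P (word rs) \<in> part OS (Sup (set xs))" unfolding OS_part by (intro imageI hspan_word) auto
    then show "P (word rs) \<in> sum_parts OS Q"
      using FA.part_subset_sum_parts[of Q OS "Sup (set xs)"] rs(2) by auto
  qed (rule FA.subspace_sum_parts, simp)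
qed

lemma OS_sum_parts_independent:
  "sum_parts OS Q = P ` hspan {xs. Sup (set xs) \<in> Q \<and> \<not> lattice_dependent xs}"
  unfolding OS_sum_parts by (subst P_hspan_independent) simp

text \<open>Since \<open>rho t\<close> respects the ideal, it can be applied to the relation and
  leaves the sum of the \<open>f x\<close> with \<open>x \<le> t\<close> equal to 0. Induction on
  the rank of \<open>t\<close> then isolates \<open>f t\<close>.\<close>

lemma OS_independent_parts:
  assumes f: "\<And>x. f x \<in> part OS x" and 0: "(\<Sum>x\<in>UNIV. f x) = 0"
  shows "f t = 0"
proof -
  have "\<forall>x. \<exists>p. f x = P p \<and> p \<in> hspan {xs. Sup (set xs) = x}" using f unfolding OS_part by blast
  then obtain h where h: "\<And>x. f x = P (h x)" "\<And>x. h x \<in> hspan {xs. Sup (set xs) = x}" by metis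
  have rho: "P (rho t (h x)) = (if x \<le> t then f x else 0)" for x t
  proof (cases "x \<le> t")
    case True
    have "rho t (h x) - h x \<in> J"
      by (rule rho_id[OF subsetD[OF hspan_hspanJ h(2)]]) (use True in \<open>auto simp: Sup_le_iff\<close>)
    then show ?thesis using True P_J[of "rho t (h x) - h x"] by (simp add: P.diff h(1))
  next
    case False
    have "rho t (h x) \<in> hspanJ {}"
      by (rule rho_hspanJ[OF subsetD[OF hspan_hspanJ h(2)]]) (use False in \<open>auto simp: Sup_le_iff subset_iff\<close>)
    then have "P (rho t (h x)) \<in> P ` hspan {}" unfolding P_hspanJ[symmetric] by simp
    then show ?thesis using False by (simp add: hspan_def P.zero)
  qed
  have "P (\<Sum>x\<in>UNIV. h x) = 0" using 0 by (simp add: P.sum h(1))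
  then have "rho t (\<Sum>x\<in>UNIV. h x) \<in> K top" for t using rho_K[of _ top t] K_mono[of t top] by (auto simp: P_0_iff)
  then have "P (rho t (\<Sum>x\<in>UNIV. h x)) = 0" for t by (simp add: P_0_iff)
  then have s: "(\<Sum>x\<in>UNIV. if x \<le> t then f x else 0) = 0" for t
    by (simp add: FA2.linear_sum[OF fa_linear_hom] P.sum rho)
  show ?thesis
  proof (induction "rk t" arbitrary: t rule: less_induct)
    case less
    have "(if x \<le> t then f x else 0) = (if x = t then f t else 0)" for x
      using less[of x] rk_less[of x t] by (auto simp: order.order_iff_strict)
    then show ?case using s[of t] by simp
  qed
qed

lemma hspanJ_empty: "hspanJ {} = J"
  by (auto simp: hspanJ_def hspan_def)

lemma graded_complex_OS: "graded_complex fscale top OS"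
  unfolding graded_complex_def
proof (intro conjI allI ballI impI)
  show "FA.subspace (part OS x)" for x by simp
  show "independent_parts OS {..top}"
    unfolding independent_parts_def by (auto simp: atMost_def intro!: OS_independent_parts)
  show "chains OS i = sum_parts OS {x. x \<le> top \<and> rk x = i}" for i
  proof -
    \<comment> \<open>On independent words degree \<open>i\<close> and join of rank \<open>i\<close>
      are the same condition.\<close>
    have rk_Sup: "rk (Sup (set xs)) = sum_list (map rk xs)" if "\<not> lattice_dependent xs" for xs :: "'l list"
      using that not_lattice_dependent_iff[of xs] by simp
    have "{xs \<in> {xs :: 'l list. sum_list (map rk xs) = i}. \<not> lattice_dependent xs}
        = {xs. Sup (set xs) \<in> {x. x \<le> top \<and> rk x = i} \<and> \<not> lattice_dependent xs}"
      using rk_Sup by auto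
    then show ?thesis
      unfolding OS_chains OS_sum_parts_independent by (subst P_hspan_independent) (simp only:)
  qed
  have tot: "sum_parts OS {..top} = P ` hspan UNIV" unfolding OS_sum_parts by simp
  have dP: "diff OS (P p) = P (D p)" if "p \<in> hspan UNIV" for p
    using OS_diff hspan_free_alg that by blast
  show "linear_on fscale fscale (sum_parts OS {..top}) (diff OS)"
    unfolding tot linear_on_def
    by (auto simp: dP FA.subspace_add FA.subspace_scale P.add der.add P.scale der.scale simp flip: P.add P.scale)
  show "diff OS v = 0" if "v \<in> chains OS 0" for v
  proof -
    obtain p where p: "v = P p" "p \<in> hspan {xs. sum_list (map rk xs) = 0}" using \<open>v \<in> _\<close> unfolding OS_chains by auto
    have "D p \<in> J"
    proof (rule hspan_into[OF fa_linear_der subspace_J p(2)])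
      fix rs xs assume rs: "homogeneous rs xs" "xs \<in> {xs. sum_list (map rk xs) = 0}"
      then have "sum_list (map rk xs) = 0" by simp
      then have "\<not> step_down xs ys" for ys
        using list_step_down_rk(1)[of xs ys] by (metis nat.distinct(1))
      then have "{ys. step_down xs ys} = {}" by simp
      then show "D (word rs) \<in> J" using D_word[OF rs(1)] by (simp add: hspanJ_empty)
    qed
    then show ?thesis using dP hspan_mono[OF subset_UNIV] p by (metis P_J subsetD)
  qed
  show "diff OS (diff OS v) = 0" if v: "v \<in> sum_parts OS {..top}" for v
  proof -
    obtain p where p: "v = P p" "p \<in> tensors" using v hspan_free_alg unfolding tot by auto
    then show ?thesis using D_free_alg D_D[OF p(2)] by (simp add: OS_diff P_J)
  qed
  fix x :: 'l
  show "diff OS ` part OS x \<subseteq> sum_parts OS {y. y \<lessdot> x}"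
  proof
    fix v assume "v \<in> diff OS ` part OS x"
    then obtain p where p: "v = diff OS (P p)" "P p \<in> part OS x" by (auto simp: OS_part)
    then obtain q where q: "P p = P q" "q \<in> hspan {xs \<in> {xs. Sup (set xs) = x}. \<not> lattice_dependent xs}"
      unfolding OS_part P_hspan_independent[of "{xs. Sup (set xs) = x}"] by auto
    have v: "v = P (D q)" using OS_diff hspan_free_alg q p(1) by auto
    have "P (D q) \<in> sum_parts OS {y. y \<lessdot> x}"
    proof (rule hspan_into[OF fa_linear_compose[OF fa_linear_der fa_linear_P] FA.subspace_sum_parts q(2)])
      fix rs xs assume rs: "homogeneous rs xs"
        and xs: "xs \<in> {xs \<in> {xs. Sup (set xs) = x}. \<not> lattice_dependent xs}"
      have "P (D (word rs)) \<in> P ` hspan {ys. step_down xs ys}"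
        unfolding P_hspanJ[symmetric] using D_word[OF rs] by auto
      also have "\<dots> = P ` hspan {ys \<in> {ys. step_down xs ys}. \<not> lattice_dependent ys}"
        by (rule P_hspan_independent)
      also have "\<dots> \<subseteq> sum_parts OS {y. y \<lessdot> x}" unfolding OS_sum_parts
      proof (intro P_hspan_mono subsetI CollectI)
        fix ys assume "ys \<in> {ys \<in> {ys. step_down xs ys}. \<not> lattice_dependent ys}"
        then have ys: "step_down xs ys" "\<not> lattice_dependent ys" by auto
        \<comment> \<open>Both lists are independent and their rank sums differ by one, so their
          joins have different ranks.\<close>
        have "rk (Sup (set ys)) \<noteq> rk (Sup (set xs))"
          using list_step_down_rk(1)[OF ys(1)] ys(2) xs by (auto simp: not_lattice_dependent_iff)
        then show "Sup (set ys) \<lessdot> x" using list_step_down_rk(2)[OF ys(1)] xs by auto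
      qed
      finally show "P (D (word rs)) \<in> sum_parts OS {y. y \<lessdot> x}" .
    qed simp
    then show "v \<in> sum_parts OS {y. y \<lessdot> x}" by (simp add: v)
  qed
qed

lemma lgraded_OS: "lgraded fscale OS"
  by (intro lgraded.intro lgraded_axioms.intro vector_space_fscale graded_complex_OS)

end

section \<open>The homotopy on the quotient\<close>

text \<open>Subtracting \<open>m\<close> times the identity from \<open>T\<close> kills the
  component for \<open>m\<close> and multiplies each other one by a difference of eigenvalues,
  nonzero in characteristic zero.\<close>

lemma eigenvectors_independent:
  fixes v :: "nat \<Rightarrow> 'w \<Rightarrow>\<^sub>0 'k::field_char_0"
  assumes T: "fa_linear T" and "finite A" "\<And>n. n \<in> A \<Longrightarrow> T (v n) = fscale (of_nat n) (v n)" "(\<Sum>n\<in>A. v n) = 0"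
  shows "\<forall>n\<in>A. v n = 0"
  using assms(2-)
proof (induction A arbitrary: v)
  case (insert m A)
  interpret T: Vector_Spaces.linear fscale fscale T by fact
  let ?w = "\<lambda>n. T (v n) - fscale (of_nat m) (v n)"
  have w: "?w n = fscale (of_nat n - of_nat m) (v n)" if "n \<in> A" for n
    using insert.prems(1)[of n] that by (simp add: FA.scale_left_diff_distrib)
  have "?w m = 0" using insert.prems(1)[of m] by simp
  then have "(\<Sum>n\<in>A. ?w n) = (\<Sum>n\<in>insert m A. ?w n)" using insert.hyps by simp
  also have "\<dots> = T (\<Sum>n\<in>insert m A. v n) - fscale (of_nat m) (\<Sum>n\<in>insert m A. v n)"
    by (simp only: sum_subtractf T.sum FA.scale_sum_right)
  finally have "(\<Sum>n\<in>A. ?w n) = 0" using insert.prems(2) by (simp add: T.zero)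
  moreover have "T (?w n) = fscale (of_nat n) (?w n)" if "n \<in> A" for n
    using insert.prems(1)[of n] that by (simp add: T.diff T.scale mult.commute FA.scale_right_diff_distrib)
  ultimately have "\<forall>n\<in>A. ?w n = 0" using insert.IH[of ?w] by blast
  moreover have "n \<noteq> m" if "n \<in> A" for n using that insert.hyps by auto
  ultimately have v: "\<forall>n\<in>A. v n = 0" using w by auto
  then have "v m = 0" using insert.prems(2) insert.hyps by simp
  then show ?case using v by simp
qed simp

text \<open>Sorted by eigenvalue, the components of \<open>T u\<close> are independent and must
  vanish, and no eigenvalue is 0. The spaces may be infinite-dimensional, so this yields only
  injectivity; surjectivity is shown separately in \<open>eps_part\<close> by dividing eigenvectors
  by their eigenvalues.\<close>

lemma span_eigenvectors_kernel:
  fixes u :: "'w \<Rightarrow>\<^sub>0 'k::field_char_0"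
  assumes T: "fa_linear T" and u: "u \<in> FA.span {v. \<exists>n::nat. n > 0 \<and> T v = fscale (of_nat n) v}" and "T u = 0"
  shows "u = 0"
proof -
  interpret T: Vector_Spaces.linear fscale fscale T by fact
  have "\<exists>A v. finite A \<and> 0 \<notin> A \<and> (\<forall>n. T (v n) = fscale (of_nat n) (v n)) \<and> (\<forall>n. n \<notin> A \<longrightarrow> v n = 0) \<and> u = (\<Sum>n\<in>A. v n)"
    using u
  proof (induction rule: FA.span_induct_alt)
    case base
    show ?case by (rule exI[of _ "{}"], rule exI[of _ "\<lambda>_. 0"]) (simp add: T.zero)
  next
    case (step c w u)
    obtain n where n: "n > 0" "T w = fscale (of_nat n) w" using step(1) by auto
    obtain A v where A: "finite A" "0 \<notin> A" "\<And>n. T (v n) = fscale (of_nat n) (v n)" "\<And>n. n \<notin> A \<Longrightarrow> v n = 0" "u = (\<Sum>n\<in>A. v n)"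
      using step(2) by blast
    let ?v = "\<lambda>m. v m + (if m = n then fscale c w else 0)"
    have "(\<Sum>m\<in>insert n A. ?v m) = (\<Sum>m\<in>insert n A. v m) + fscale c w"
      using A(1) by (simp add: sum.distrib sum.delta del: sum.insert)
    also have "(\<Sum>m\<in>insert n A. v m) = u" using A by (cases "n \<in> A") (auto simp: insert_absorb)
    finally have "fscale c w + u = (\<Sum>m\<in>insert n A. ?v m)" by (simp add: add.commute)
    moreover have "T (?v m) = fscale (of_nat m) (?v m)" for m
      using A(3)[of m] n(2) by (auto simp: T.add T.scale T.zero FA.scale_right_distrib mult.commute)
    ultimately show ?case using A n(1)
      by (intro exI[of _ "insert n A"] exI[of _ ?v]) auto
  qed
  then obtain A v where A: "finite A" "0 \<notin> A" "\<And>n. T (v n) = fscale (of_nat n) (v n)" "u = (\<Sum>n\<in>A. v n)" by blast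
  have "(\<Sum>n\<in>A. T (v n)) = 0" using assms(3) by (simp add: A(4) T.sum)
  then have "\<forall>n\<in>A. T (v n) = 0"
    by (intro eigenvectors_independent[OF T A(1)]) (simp_all add: A(3) T.scale)
  moreover have "n \<noteq> 0" if "n \<in> A" for n using that A(2) by metis
  ultimately have "\<forall>n\<in>A. v n = 0" using A(3) by simp
  then show ?thesis by (simp add: A(4))
qed

context lgraded
begin

section \<open>Operators on the quotient induced by a contraction\<close>

context
  fixes t :: 'l and d :: "'v \<Rightarrow> 'v"
  assumes d: "contraction t d"
begin

abbreviation low :: "('v, 'k) fa set"
  where "low \<equiv> hspanJ {xs. set xs \<subseteq> {..t}}"

text \<open>A representative in \<open>OS\<close> of a class from \<open>L\<^sub>\<le>\<^sub>t\<close> may contain letters outside \<open>L\<^sub>\<le>\<^sub>t\<close>,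
  where \<open>d\<close> is not a homotopy; \<open>rho t\<close> deletes them.\<close>
definition delta :: "('v, 'k) fa \<Rightarrow> ('v, 'k) fa"
  where "delta a = P (der parity d (rho t a))"

definition eps :: "('v, 'k) fa \<Rightarrow> ('v, 'k) fa"
  where "eps a = P (euler d (rho t a))"

lemma odd_d: "odd_map d"
  using d by (simp add: contraction_def)

lemma fa_linear_delta: "fa_linear delta"
  unfolding delta_def by (intro fa_linear_compose[OF _ fa_linear_P] fa_linear_compose[OF _ fa_linear_der] fa_linear_hom)

lemma fa_linear_eps: "fa_linear eps"
  unfolding eps_def by (intro fa_linear_compose[OF _ fa_linear_P] fa_linear_compose[OF _ fa_linear_euler] fa_linear_hom)

interpretation G: lgraded fscale OS by (rule lgraded_OS)
interpretation delta: Vector_Spaces.linear fscale fscale delta by (rule fa_linear_delta)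
interpretation eps: Vector_Spaces.linear fscale fscale eps by (rule fa_linear_eps)

text \<open>\<open>P p\<close> and \<open>p\<close> agree only modulo \<open>K top\<close>, which is
  not known to be stable under \<open>der parity d\<close>; \<open>rho t\<close> moves their
  difference into \<open>K t\<close>, which is.\<close>

lemma rho_P_low:
  assumes "p \<in> low" shows "rho t (P p) - p \<in> K t"
proof -
  have "rho t (p - P p) \<in> K t" using rho_K[OF P_cong] .
  moreover have "rho t p - p \<in> K t" using rho_id[OF assms] J_K by auto
  ultimately have "(rho t p - p) - rho t (p - P p) \<in> K t" by (rule FA.subspace_diff[OF subspace_K, rotated])
  then show ?thesis by (simp add: hom.diff)
qed

lemma delta_P: "p \<in> low \<Longrightarrow> delta (P p) = P (der parity d p)"
proof -
  assume "p \<in> low"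
  show ?thesis using der_up_K[OF d rho_P_low[OF \<open>p \<in> low\<close>]] K_mono[of t top]
    by (auto simp: delta_def P_eq_iff der.diff)
qed

lemma eps_P: "p \<in> low \<Longrightarrow> eps (P p) = P (euler d p)"
proof -
  assume "p \<in> low"
  interpret f: Vector_Spaces.linear fscale fscale "euler d" by (rule fa_linear_euler)
  show ?thesis using euler_K[OF d rho_P_low[OF \<open>p \<in> low\<close>]] K_mono[of t top]
    by (auto simp: eps_def P_eq_iff f.diff)
qed

lemma low_free_alg: "low \<subseteq> tensors"
  by (rule hspanJ_free_alg)

lemma D_low: "p \<in> low \<Longrightarrow> D p \<in> low"
proof (erule der_hspanJ[OF odd_map_diff])
  show "diff V v \<in> sum_parts V {y. y \<lessdot> x}" if "v \<in> part V x" for x v using diff_part that by blast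
  show "ys \<in> {xs. set xs \<subseteq> {..t}}" if xs: "xs \<in> {xs. set xs \<subseteq> {..t}}" and ys: "step_down xs ys" for xs ys
    by (rule CollectI, rule list_step_subset[OF ys]) (use xs in \<open>auto simp: covers_iff_rk\<close>)
qed

lemma der_up_low: "p \<in> low \<Longrightarrow> der parity d p \<in> low"
proof (erule der_up_hspanJ[OF d])
  show "ys \<in> {xs. set xs \<subseteq> {..t}}" if xs: "xs \<in> {xs. set xs \<subseteq> {..t}}" and ys: "step_up t xs ys" for xs ys
    using list_step_subset[OF ys, of "{..t}"] xs by auto
qed simp

lemma sum_parts_low:
  assumes "Q \<subseteq> {..t}" "v \<in> sum_parts OS Q"
  obtains p where "p \<in> low" "v = P p"
proof -
  obtain p where p: "v = P p" "p \<in> hspan {xs. Sup (set xs) \<in> Q}" using assms(2) unfolding OS_sum_parts by auto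
  have "hspan {xs. Sup (set xs) \<in> Q} \<subseteq> hspan {xs. set xs \<subseteq> {..t}}"
  proof (rule hspan_mono, safe)
    fix xs x assume "Sup (set xs) \<in> Q" "x \<in> set xs"
    then show "x \<le> t" using assms(1) Sup_upper[of x "set xs"] order_trans[of x "Sup (set xs)" t] by blast
  qed
  then show thesis using that p hspan_hspanJ by blast
qed

lemma delta_diff:
  assumes "v \<in> sum_parts OS {..t}"
  shows "delta (diff OS v) + diff OS (delta v) = eps v"
proof -
  obtain p where p: "p \<in> low" "v = P p" using assms by (rule sum_parts_low[OF order_refl])
  have "p \<in> tensors" "der parity d p \<in> tensors"
    using p(1) der_up_low low_free_alg by auto
  then show ?thesis using D_low[OF p(1)] p(1)
    by (simp add: p(2) OS_diff delta_P eps_P euler_def P.add add.commute)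
qed

text \<open>Because \<open>D D\<close> vanishes modulo \<open>J\<close>, both sides reduce to the
  class of \<open>D (der parity d (D p))\<close>.\<close>

lemma eps_diff:
  assumes "v \<in> sum_parts OS {..t}"
  shows "eps (diff OS v) = diff OS (eps v)"
proof -
  obtain p where p: "p \<in> low" "v = P p" using assms by (rule sum_parts_low[OF order_refl])
  have free: "p \<in> tensors" "der parity d p \<in> tensors" "euler d p \<in> tensors"
    using p(1) der_up_low D_low low_free_alg unfolding euler_def by (auto intro!: FA.subspace_add)
  have "der parity d (D (D p)) - D (D (der parity d p)) \<in> J"
    by (rule J_diff[OF der_odd_J[OF odd_d D_D[OF free(1)]] D_D[OF free(2)]])
  then have "P (euler d (D p)) = P (D (euler d p))"
    using J_K unfolding P_eq_iff by (auto simp: euler_def der.add)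
  then show ?thesis using D_low[OF p(1)] p(1) free by (simp add: p(2) OS_diff eps_P)
qed

text \<open>Mirror image of the argument for the differential: the rank sum grows by one, so in an
  independent result the join has to rise to a cover; it stays below \<open>t\<close> because all
  letters do.\<close>

lemma delta_part:
  assumes "x \<le> t" shows "delta ` part OS x \<subseteq> sum_parts OS {y. x \<lessdot> y \<and> y \<le> t}"
proof
  fix v assume "v \<in> delta ` part OS x"
  then obtain p where p: "v = delta (P p)" "p \<in> hspan {xs \<in> {xs. Sup (set xs) = x}. \<not> lattice_dependent xs}"
    unfolding OS_part P_hspan_independent[of "{xs. Sup (set xs) = x}"] by auto
  have "delta (P p) \<in> sum_parts OS {y. x \<lessdot> y \<and> y \<le> t}"
  proof (rule hspan_into[OF fa_linear_compose[OF fa_linear_P fa_linear_delta] FA.subspace_sum_parts p(2)])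
    fix rs xs assume rs: "homogeneous rs xs"
      and xs: "xs \<in> {xs \<in> {xs. Sup (set xs) = x}. \<not> lattice_dependent xs}"
    then have t: "set xs \<subseteq> {..t}" using assms Sup_upper[of _ "set xs"] by (auto intro: order_trans)
    then have low: "word rs \<in> low" using hspan_word[OF rs, of "{xs. set xs \<subseteq> {..t}}"] hspan_hspanJ by blast
    have "word rs \<in> hspanJ {xs}" using hspan_word[OF rs, of "{xs}"] hspan_hspanJ by blast
    then have "der parity d (word rs) \<in> hspanJ {ys. step_up t xs ys}"
      by (rule der_up_hspanJ[OF d]) (use t in auto)
    then have "delta (P (word rs)) \<in> P ` hspan {ys. step_up t xs ys}"
      unfolding P_hspanJ[symmetric] using delta_P[OF low] by simp
    also have "\<dots> = P ` hspan {ys \<in> {ys. step_up t xs ys}. \<not> lattice_dependent ys}"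
      by (rule P_hspan_independent)
    also have "\<dots> \<subseteq> sum_parts OS {y. x \<lessdot> y \<and> y \<le> t}" unfolding OS_sum_parts
    proof (intro P_hspan_mono subsetI CollectI)
      fix ys assume "ys \<in> {ys \<in> {ys. step_up t xs ys}. \<not> lattice_dependent ys}"
      then have ys: "step_up t xs ys" "list_step (\<lessdot>) xs ys" "\<not> lattice_dependent ys"
        by (auto intro: list_step_mono)
      have "set ys \<subseteq> {..t}" by (rule list_step_subset[OF ys(1) t]) auto
      moreover have "rk (Sup (set ys)) \<noteq> rk (Sup (set xs))"
        using list_step_up_rk(1)[OF ys(2)] ys(3) xs not_lattice_dependent_iff[of xs] not_lattice_dependent_iff[of ys] by auto
      ultimately show "x \<lessdot> Sup (set ys) \<and> Sup (set ys) \<le> t"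
        using list_step_up_rk(2)[OF ys(2)] xs by (auto intro: Sup_least)
    qed
    finally show "delta (P (word rs)) \<in> sum_parts OS {y. x \<lessdot> y \<and> y \<le> t}" .
  qed simp
  then show "v \<in> sum_parts OS {y. x \<lessdot> y \<and> y \<le> t}" by (simp add: p(1))
qed

lemma OS_part_eigenvectors:
  assumes x: "x \<le> t" "x \<noteq> bot"
  shows "part OS x = FA.span {v \<in> part OS x. \<exists>n::nat. n > 0 \<and> eps v = fscale (of_nat n) v}" (is "_ = FA.span ?E")
proof
  show "FA.span ?E \<subseteq> part OS x" by (rule FA.span_minimal) auto
  have "P ` hspan {xs. Sup (set xs) = x} \<subseteq> FA.span ?E"
  proof (rule P_hspan_subset)
    fix rs xs assume rs: "homogeneous rs xs" and xs: "xs \<in> {xs. Sup (set xs) = x}"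
    have t: "set xs \<subseteq> {..t}" using xs x(1) Sup_upper[of _ "set xs"] by (auto intro: order_trans)
    have ne: "\<exists>y\<in>set xs. y \<noteq> bot"
    proof (rule ccontr)
      assume "\<not> (\<exists>y\<in>set xs. y \<noteq> bot)"
      then have "Sup (set xs) \<le> bot" by (intro Sup_least) auto
      then show False using xs x(2) bot.extremum_uniqueI by auto
    qed
    show "P (word rs) \<in> FA.span ?E"
    proof (rule fa_linear_span_into[OF fa_linear_P _ _ word_span_eigenvectors[OF d rs t ne]])
      fix p assume "p \<in> {p \<in> hspanJ {xs}. \<exists>n::nat. n > 0 \<and> euler d p - fscale (of_nat n) p \<in> J}"
      then obtain n :: nat where p: "p \<in> hspanJ {xs}" "n > 0" "euler d p - fscale (of_nat n) p \<in> J" by auto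
      have "p \<in> low" using p(1) hspanJ_mono[of "{xs}" "{xs. set xs \<subseteq> {..t}}"] t by auto
      then have "eps (P p) = fscale (of_nat n) (P p)"
        using P_J[OF p(3)] by (simp add: eps_P P.diff P.scale)
      moreover have "P p \<in> part OS x"
        unfolding OS_part P_hspanJ[symmetric] using p(1) hspanJ_mono[of "{xs}" "{xs. Sup (set xs) = x}"] xs by auto
      ultimately show "P p \<in> FA.span ?E" using p(2) by (intro FA.span_base) auto
    qed simp
  qed simp
  then show "part OS x \<subseteq> FA.span ?E" by (simp only: OS_part[symmetric])
qed

abbreviation positive :: "('v, 'k) fa set"
  where "positive \<equiv> sum_parts OS {x. x \<le> t \<and> x \<noteq> bot}"

lemma eps_inj:
  assumes "v \<in> positive" "eps v = 0" shows "v = 0"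
proof (rule span_eigenvectors_kernel[OF fa_linear_eps _ assms(2)])
  have "part OS x \<subseteq> FA.span {v. \<exists>n::nat. n > 0 \<and> eps v = fscale (of_nat n) v}"
    if "x \<in> {x. x \<le> t \<and> x \<noteq> bot}" for x
  proof -
    have "part OS x = FA.span {v \<in> part OS x. \<exists>n::nat. n > 0 \<and> eps v = fscale (of_nat n) v}"
      using that by (intro OS_part_eigenvectors) auto
    also have "\<dots> \<subseteq> FA.span {v. \<exists>n::nat. n > 0 \<and> eps v = fscale (of_nat n) v}"
      by (rule FA.span_mono) auto
    finally show ?thesis .
  qed
  then show "v \<in> FA.span {v. \<exists>n::nat. n > 0 \<and> eps v = fscale (of_nat n) v}"
    using FA.sum_parts_least[of "FA.span {v. \<exists>n::nat. n > 0 \<and> eps v = fscale (of_nat n) v}" "{x. x \<le> t \<and> x \<noteq> bot}" OS] assms(1)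
    by auto
qed

lemma eps_part:
  assumes "x \<le> t" "x \<noteq> bot" shows "eps ` part OS x = part OS x"
proof
  let ?E = "{v \<in> part OS x. \<exists>n::nat. n > 0 \<and> eps v = fscale (of_nat n) v}"
  have "eps v \<in> part OS x" if "v \<in> FA.span ?E" for v
    by (rule fa_linear_span_into[OF fa_linear_eps subspace_OS_part _ that]) (auto intro: FA.subspace_scale[OF subspace_OS_part])
  then show "eps ` part OS x \<subseteq> part OS x" using OS_part_eigenvectors[OF assms] by auto
  have "v \<in> eps ` part OS x" if v: "v \<in> ?E" for v
  proof -
    obtain n :: nat where n: "n > 0" "eps v = fscale (of_nat n) v" using v by blast
    then have "v = eps (fscale (1 / of_nat n) v)" by (simp add: eps.scale)
    then show ?thesis using FA.subspace_scale[OF subspace_OS_part, of v x "1 / of_nat n"] v by blast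
  qed
  then have "FA.span ?E \<subseteq> eps ` part OS x" by (intro FA.span_minimal eps.subspace_image) auto
  then show "part OS x \<subseteq> eps ` part OS x" using OS_part_eigenvectors[OF assms] by simp
qed

lemma eps_sum_parts:
  assumes "Q \<subseteq> {x. x \<le> t \<and> x \<noteq> bot}"
  shows "eps ` sum_parts OS Q = sum_parts OS Q"
proof
  have lin: "linear_on fscale fscale U eps" for U by (simp add: linear_on_def eps.add eps.scale)
  show "eps ` sum_parts OS Q \<subseteq> sum_parts OS Q"
  proof (rule FA.linear_on_sum_parts_into[OF lin])
    show "eps ` part OS x \<subseteq> sum_parts OS Q" if "x \<in> Q" for x
      using eps_part[of x] that assms FA.part_subset_sum_parts[of Q OS x] by auto
  qed simp_all
  show "sum_parts OS Q \<subseteq> eps ` sum_parts OS Q"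
  proof (rule FA.sum_parts_least)
    show "part OS x \<subseteq> eps ` sum_parts OS Q" if "x \<in> Q" for x
    proof -
      have "part OS x = eps ` part OS x" using eps_part[of x] that assms by auto
      also have "\<dots> \<subseteq> eps ` sum_parts OS Q" using that by (intro image_mono FA.part_subset_sum_parts) simp_all
      finally show ?thesis .
    qed
  qed (rule eps.subspace_image, simp)
qed

lemma inj_on_eps: "inj_on eps positive"
  by (subst eps.inj_on_iff_eq_0) (use eps_inj in auto)

text \<open>One formula serves every degree, including 0: \<open>delta\<close> raises the degree, so
  its values on the parts below \<open>t\<close> lie where \<open>eps\<close> is invertible.\<close>

definition homotopy :: "('v, 'k) fa \<Rightarrow> ('v, 'k) fa"
  where "homotopy a = the_inv_into positive eps (delta a)"

lemma eps_inverse: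
  assumes "Q \<subseteq> {x. x \<le> t \<and> x \<noteq> bot}" "w \<in> sum_parts OS Q"
  shows "eps (the_inv_into positive eps w) = w" "the_inv_into positive eps w \<in> sum_parts OS Q"
proof -
  obtain u where u: "u \<in> sum_parts OS Q" "eps u = w" using eps_sum_parts[OF assms(1)] assms(2) by (metis imageE)
  then have "u \<in> positive" using G.parts_mono[OF assms(1)] by auto
  then have "the_inv_into positive eps w = u" using the_inv_into_f_f[OF inj_on_eps] u(2) by auto
  then show "eps (the_inv_into positive eps w) = w" "the_inv_into positive eps w \<in> sum_parts OS Q"
    using u by auto
qed

lemma delta_chain:
  "delta ` sum_parts OS (level t i) \<subseteq> sum_parts OS (level t (Suc i))"
proof (rule FA.linear_on_sum_parts_into)
  show "linear_on fscale fscale (sum_parts OS (level t i)) delta"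
    by (simp add: linear_on_def delta.add delta.scale)
  show "delta ` part OS x \<subseteq> sum_parts OS (level t (Suc i))" if "x \<in> level t i" for x
  proof -
    have "delta ` part OS x \<subseteq> sum_parts OS {y. x \<lessdot> y \<and> y \<le> t}"
      using that by (intro delta_part) (simp add: level_def)
    also have "\<dots> \<subseteq> sum_parts OS (level t (Suc i))"
      using that by (intro G.parts_mono) (auto simp: rk_covers level_def)
    finally show ?thesis .
  qed
qed simp_all

text \<open>Every identity for \<open>homotopy\<close> is checked after applying \<open>eps\<close>,
  which is injective in positive degrees, is linear and commutes with the differential; there it
  becomes the corresponding identity for \<open>delta\<close>.\<close>

lemma L_homotopy_OS: "L_homotopy fscale t (below OS t) (\<lambda>_. homotopy)"
proof -
  let ?ch = "\<lambda>i. sum_parts OS (level t i)"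

  have pos: "level t (Suc i) \<subseteq> {x. x \<le> t \<and> x \<noteq> bot}" for i by (auto simp: level_def)
  have eps_homotopy: "eps (homotopy v) = delta v" and homotopy_chain: "homotopy v \<in> ?ch (Suc i)" if "v \<in> ?ch i" for v i
    unfolding homotopy_def using eps_inverse[OF pos, of "delta v" i] delta_chain that by blast+
  have ch_pos: "?ch (Suc i) \<subseteq> positive" for i using G.parts_mono[OF pos] .
  have ch_low: "?ch i \<subseteq> sum_parts OS {..t}" for i by (rule G.parts_mono) (auto simp: level_def)
  have eps_cancel: "u = v" if "eps u = eps v" "u \<in> ?ch (Suc i)" "v \<in> ?ch (Suc i)" for u v i
    using inj_onD[OF inj_on_eps that(1)] that(2,3) ch_pos by blast
  have lin: "linear_on fscale fscale (?ch i) homotopy" for i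
    unfolding linear_on_def
  proof (intro conjI ballI allI)
    fix u v c assume u: "u \<in> ?ch i"
    then have su: "fscale c u \<in> ?ch i" "fscale c (homotopy u) \<in> ?ch (Suc i)"
      using homotopy_chain by (auto intro!: FA.subspace_scale)
    show "homotopy (fscale c u) = fscale c (homotopy u)"
      by (rule eps_cancel[OF _ homotopy_chain[OF su(1)] su(2)])
        (simp add: eps_homotopy[OF su(1)] eps.scale eps_homotopy[OF u] delta.scale)
    assume v: "v \<in> ?ch i"
    have suv: "u + v \<in> ?ch i" "homotopy u + homotopy v \<in> ?ch (Suc i)"
      using u v homotopy_chain by (auto intro!: FA.subspace_add)
    show "homotopy (u + v) = homotopy u + homotopy v"
      by (rule eps_cancel[OF _ homotopy_chain[OF suv(1)] suv(2)])
        (simp add: eps_homotopy[OF suv(1)] eps.add eps_homotopy[OF u] eps_homotopy[OF v] delta.add)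
  qed

  have B: "diff OS ` ?ch (Suc i) \<subseteq> ?ch i" for i by (rule G.diff_level)
  have homotopy_eq: "homotopy (diff OS v) + diff OS (homotopy v) = v" if v: "v \<in> ?ch (Suc i)" for v i
  proof (rule eps_cancel)
    have dv: "diff OS v \<in> ?ch i" using B v by blast
    have hv: "homotopy v \<in> ?ch (Suc (Suc i))" by (rule homotopy_chain[OF v])
    have dhv: "diff OS (homotopy v) \<in> ?ch (Suc i)" using B hv by blast
    have "eps (diff OS (homotopy v)) = diff OS (delta v)" using eps_diff[OF subsetD[OF ch_low hv]] eps_homotopy[OF v] by simp
    then show "eps (homotopy (diff OS v) + diff OS (homotopy v)) = eps v"
      using delta_diff[of v] v ch_low by (auto simp: eps.add eps_homotopy[OF dv])
    show "homotopy (diff OS v) + diff OS (homotopy v) \<in> ?ch (Suc i)"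
      by (rule FA.subspace_add[OF _ homotopy_chain[OF dv] dhv]) simp
  qed (rule v)
  show ?thesis unfolding L_homotopy_def below_simps sum_parts_below
  proof (intro conjI ballI allI impI)
    show "linear_on fscale fscale (diff OS ` ?ch 1) homotopy"
      using linear_on_subset[OF lin[of 0]] B[of 0] by simp
    show "homotopy ` diff OS ` ?ch 1 \<subseteq> ?ch 1" using homotopy_chain[of _ 0] B[of 0] by auto
    show "linear_on fscale fscale (?ch i) homotopy" "homotopy ` ?ch i \<subseteq> ?ch (i + 1)" for i
      using lin homotopy_chain by auto
    show "homotopy (diff OS v) + diff OS (homotopy v) = v" if "i \<in> {1..rk t}" "v \<in> ?ch i" for i v
      using homotopy_eq[of v "i - 1"] that by simp
    fix x assume x: "x \<le> t" "x \<noteq> bot"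
    have sub: "{y. x \<lessdot> y \<and> y \<le> t} \<subseteq> {x. x \<le> t \<and> x \<noteq> bot}" by (auto simp: covers_iff_rk)
    show "homotopy ` part OS x \<subseteq> sum_parts OS {y. x \<lessdot> y \<and> y \<le> t}"
      unfolding homotopy_def using eps_inverse(2)[OF sub] delta_part[OF x(1)] by blast
  qed
qed

end

lemma L_contractible_OS:
  assumes "L_contractible s V"
  shows "L_contractible fscale OS"
  unfolding L_contractible_def
proof (intro conjI allI)
  fix t
  obtain d where "contraction t d" using assms exists_contraction unfolding L_contractible_def by blast
  then show "\<exists>d. L_homotopy fscale t (below OS t) d" using L_homotopy_OS by blast
qed (rule graded_complex_OS)

end

section \<open>Contractible complexes are minimal\<close>

lemma sum_fun_apply: "(\<Sum>x\<in>A. f x) l = (\<Sum>x\<in>A. f x l)" for f :: "'a \<Rightarrow> 'b \<Rightarrow> 'c::comm_monoid_add"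
  by (induction A rule: infinite_finite_induct) auto

lemma (in lgraded) contractible_exact:
  assumes "L_homotopy s t (below V t) d" and i: "i \<in> {1..rk t}"
    and v: "v \<in> sum_parts V (level t i)" "diff V v = 0"
  shows "\<exists>w\<in>sum_parts V (level t (Suc i)). diff V w = v"
proof -
  let ?ch = "\<lambda>i. sum_parts V (level t i)"
  note h = assms(1)[unfolded L_homotopy_def below_simps]
  \<comment> \<open>\<open>d 0\<close> is linear only on the boundaries, so degree 1 is treated
    apart.\<close>
  have "d (i - 1) 0 = 0"
  proof (cases "i = 1")
    case True
    have 0: "0 \<in> diff V ` ?ch 1"
      by (rule image_eqI[of _ _ 0]) (simp_all add: linear_on_zero[OF diff_linear])
    have "linear_on s s (diff V ` ?ch 1) (d 0)" using h by blast
    then have "d 0 (0 + 0) = d 0 0 + d 0 0" using 0 unfolding linear_on_def by blast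
    then show ?thesis using True by simp
  next
    case False
    then have "i - 1 \<in> {1..rk t}" using i by auto
    then have "linear_on s s (?ch (i - 1)) (d (i - 1))" using h by blast
    then show ?thesis by (rule linear_on_zero) simp
  qed
  moreover have "d (i - 1) (diff V v) + diff V (d i v) = v" using h i v(1) by blast
  ultimately have "diff V (d i v) = v" using v(2) by simp
  moreover have "d i v \<in> ?ch (Suc i)" using h i v(1) by fastforce
  ultimately show ?thesis by blast
qed

text \<open>The identification \<open>\<psi>\<close> is a parameter because the degree zero part of
  the quotient and \<open>Sym\<close> consist of representatives chosen by different
  projections.\<close>

locale contractible_lgraded = lgraded s V
  for s :: "'k::field_char_0 \<Rightarrow> 'v::ab_group_add \<Rightarrow> 'v" and V :: "('v, 'l::geometric_lattice) lcomplex" +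
  fixes su :: "'k \<Rightarrow> 'u::ab_group_add \<Rightarrow> 'u" and U0 :: "'u set" and U :: "'l \<Rightarrow> 'u set" and \<psi> :: "'v \<Rightarrow> 'u"
  assumes contractible: "L_contractible s V"
    and su: "vector_space su"
    and psi_linear: "linear_on s su (part V bot) \<psi>"
    and psi_inj: "inj_on \<psi> (part V bot)"
    and psi_U0: "\<psi> ` part V bot = U0"
    and psi_U: "a \<in> atoms \<Longrightarrow> \<psi> ` diff V ` part V a = U a"
begin

lemma exact_below:
  assumes "i \<in> {1..rk t}" "v \<in> sum_parts V (level t i)" "diff V v = 0"
  shows "\<exists>w\<in>sum_parts V (level t (Suc i)). diff V w = v"
  using contractible contractible_exact[OF _ assms] unfolding L_contractible_def by blast

lemma diff_zero: "diff V 0 = 0"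
  using linear_on_zero[OF diff_linear] by simp

text \<open>In the complex below \<open>x\<close> the degree \<open>rk x\<close> is the highest, so
  exactness there is injectivity.\<close>

lemma diff_inj_part:
  assumes "x \<noteq> bot" "v \<in> part V x" "diff V v = 0" shows "v = 0"
proof -
  have "0 < rk x" by (rule gr0I) (simp add: assms(1))
  then have "rk x \<in> {1..rk x}" by simp
  moreover have "v \<in> sum_parts V (level x (rk x))" by (rule subsetD[OF part_subset assms(2)]) (simp add: level_def)
  ultimately obtain w where w: "w \<in> sum_parts V (level x (Suc (rk x)))" "diff V w = v"
    using exact_below assms(3) by blast
  have "level x (Suc (rk x)) = {}" using rk_mono[of _ x] unfolding level_def by fastforce
  then have "sum_parts V (level x (Suc (rk x))) = {0}" by (simp only:) (simp add: sum_parts_def)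
  then show ?thesis using w diff_zero by auto
qed

text \<open>Exactness one degree under the top of the complex below \<open>x\<close>, whose top
  chains are \<open>part V x\<close> alone. The bound on \<open>rk x\<close> keeps that degree at
  least 1.\<close>

lemma exact_part:
  assumes "rk x > 1" "w \<in> sum_parts V {y. y \<lessdot> x}" "diff V w = 0"
  shows "\<exists>v\<in>part V x. diff V v = w"
proof -
  have "{y. y \<lessdot> x} = level x (rk x - 1)" using assms(1) by (auto simp: covers_iff_rk level_def)
  moreover have "level x (Suc (rk x - 1)) = {x}"
    using assms(1) unfolding level_def by (auto simp: order.order_iff_strict dest: rk_less)
  moreover have "rk x - 1 \<in> {1..rk x}" using assms(1) by auto
  ultimately show ?thesis using exact_below[of "rk x - 1" x w] assms by (simp add: sum_parts_singleton)
qed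

text \<open>An element of \<open>minimal_complex\<close> is a family of families; \<open>theta v\<close> unfolds \<open>v\<close> accordingly into its
  iterated boundary components.\<close>
primrec theta_at :: "'l list \<Rightarrow> 'v \<Rightarrow> 'u"
  where
    "theta_at [] v = \<psi> (comp v bot)"
  | "theta_at (x # c) v = (if x = bot then 0 else theta_at c (diff V (comp v x)))"

definition theta :: "'v \<Rightarrow> 'l list \<Rightarrow> 'u"
  where "theta v = (\<lambda>c. theta_at c v)"

lemma theta_at_linear: "linear_on s su (total V) (theta_at c)"
proof (induction c)
  case Nil
  show ?case using psi_linear comp(1) unfolding linear_on_def by (simp add: comp_add comp_scale)
next
  case (Cons x c)
  interpret su: vector_space su by (rule su)
  have t: "comp u x \<in> total V" if "u \<in> total V" for u using comp(1)[OF that] part_in_total by blast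
  show ?case
    using Cons diff_linear t diff_total unfolding linear_on_def by (simp add: comp_add comp_scale)
qed

lemma theta_zero: "theta 0 = 0"
  using linear_on_zero[OF theta_at_linear] by (simp add: theta_def zero_fun_def)

lemma theta_add: "u \<in> total V \<Longrightarrow> v \<in> total V \<Longrightarrow> theta (u + v) = theta u + theta v"
  using theta_at_linear unfolding theta_def linear_on_def by (simp add: plus_fun_def)

lemma theta_scale: "u \<in> total V \<Longrightarrow> theta (s c u) = (\<lambda>l. su c (theta u l))"
  using theta_at_linear unfolding theta_def linear_on_def by simp

lemma theta_sum: "(\<And>x. x \<in> A \<Longrightarrow> f x \<in> total V) \<Longrightarrow> theta (sum f A) = (\<Sum>x\<in>A. theta (f x))"
  unfolding theta_def by (rule ext) (simp add: sum_fun_apply linear_on_sum[OF theta_at_linear])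

lemma psi_zero: "\<psi> 0 = 0"
  by (rule linear_on_zero[OF psi_linear]) simp

lemma theta_at_zero: "theta_at c 0 = 0"
  by (rule linear_on_zero[OF theta_at_linear]) simp

lemma theta_bot: "v \<in> part V bot \<Longrightarrow> theta v = at_base (\<psi> v)"
proof (rule ext)
  fix l assume "v \<in> part V bot"
  then show "theta v l = at_base (\<psi> v) l"
    by (cases l) (simp_all add: theta_def at_base_def comp_part diff_zero theta_at_zero)
qed

lemma theta_part:
  assumes "v \<in> part V x" "x \<noteq> bot" shows "theta v = push x (theta (diff V v))"
proof (rule ext)
  fix l
  show "theta v l = push x (theta (diff V v)) l"
    using assms by (cases l) (auto simp: theta_def push_def comp_part diff_zero theta_at_zero psi_zero)
qed

text \<open>Summing over the first entry of the list collects the boundaries of all components; the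
  entry \<open>bot\<close> adds 0 on both sides, as the differential vanishes in degree
  zero.\<close>

lemma min_diff_theta:
  assumes v: "v \<in> total V" shows "min_diff (theta v) = theta (diff V v)"
proof (rule ext)
  fix c
  have t: "comp v x \<in> total V" for x using comp(1)[OF v] part_in_total by blast
  have "diff V v = (\<Sum>x\<in>UNIV. diff V (comp v x))"
    by (subst comp(2)[OF v], rule linear_on_sum[OF diff_linear]) (use t in auto)
  then have "theta (diff V v) c = (\<Sum>x\<in>UNIV. theta_at c (diff V (comp v x)))"
    unfolding theta_def using linear_on_sum[OF theta_at_linear, of UNIV "\<lambda>x. diff V (comp v x)" c] diff_total[OF t] by simp
  also have "\<dots> = (\<Sum>x\<in>UNIV. theta v (x # c))"
    using diff_bot[OF comp(1)[OF v]] by (intro sum.cong) (auto simp: theta_def theta_at_zero)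
  finally show "min_diff (theta v) c = theta (diff V v) c" by (simp add: min_diff_def)
qed

text \<open>Different components are recorded on disjoint sets of lists: the empty list for
  \<open>bot\<close>, the lists starting with \<open>y\<close> for any other
  \<open>y\<close>.\<close>

lemma theta_comp_zero:
  assumes "w \<in> total V" "theta w = 0" shows "theta (comp w y) = 0"
proof (cases "y = bot")
  case True
  have "\<psi> (comp w bot) = theta w []" by (simp add: theta_def)
  then have "\<psi> (comp w bot) = 0" using assms(2) by simp
  then show ?thesis using theta_bot[OF comp(1)[OF assms(1)]] True by (auto simp: at_base_def fun_eq_iff split: list.split)
next
  case False
  have "theta (diff V (comp w y)) c = theta w (y # c)" for c using False by (simp add: theta_def)
  then have "theta (diff V (comp w y)) = 0" using assms(2) by (simp add: fun_eq_iff)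
  then show ?thesis using theta_part[OF comp(1)[OF assms(1)] False] by (auto simp: push_def fun_eq_iff split: list.split)
qed

text \<open>If \<open>theta v\<close> vanishes, so does \<open>theta\<close> of the boundary and, by
  induction on the rank, every component of the boundary; then \<open>diff_inj_part\<close>
  applies.\<close>

lemma theta_inj_part: "v \<in> part V x \<Longrightarrow> theta v = 0 \<Longrightarrow> v = 0"
proof (induction "rk x" arbitrary: v x rule: less_induct)
  case less
  show ?case
  proof (cases "x = bot")
    case True
    then have "at_base (\<psi> v) = (0 :: 'l list \<Rightarrow> 'u)" using theta_bot[of v] less.prems by simp
    from fun_cong[OF this, of "[]"] have "\<psi> v = \<psi> 0" by (simp add: at_base_def psi_zero)
    then show ?thesis using inj_onD[OF psi_inj] less.prems True by simp
  next
    case False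
    have "theta (diff V v) c = theta v (x # c)" for c
      using theta_part[OF less.prems(1) False] by (simp add: push_def)
    then have d0: "theta (diff V v) = 0" using less.prems(2) by (simp add: fun_eq_iff)
    have dv: "diff V v \<in> sum_parts V {y. y \<lessdot> x}" "diff V v \<in> total V"
      using diff_part less.prems part_in_total diff_total by blast+
    have "comp (diff V v) y = 0" for y
    proof (cases "y \<lessdot> x")
      case True
      then show ?thesis using less.hyps[of y] rk_covers[OF True] comp(1)[OF dv(2)] theta_comp_zero[OF dv(2) d0] by simp
    next
      case False
      obtain f where "diff V v = (\<Sum>y\<in>{y. y \<lessdot> x}. f y)" "\<And>y. y \<lessdot> x \<Longrightarrow> f y \<in> part V y"
        using dv(1) by (auto simp: sum_parts_def)
      then show ?thesis using comp_parts[of "{y. y \<lessdot> x}" f] False by simp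
    qed
    then have "diff V v = 0" using comp(2)[OF dv(2)] by simp
    then show ?thesis using diff_inj_part[OF False less.prems(1)] by simp
  qed
qed

lemma theta_eq_0: "v \<in> total V \<Longrightarrow> theta v = 0 \<Longrightarrow> v = 0"
  using theta_inj_part[OF comp(1) theta_comp_zero] comp(2)[of v] by simp

lemma theta_inj: "inj_on theta (total V)"
proof (rule inj_onI)
  fix u v assume uv: "u \<in> total V" "v \<in> total V" "theta u = theta v"
  have m: "u - v \<in> total V" using uv by (intro subspace_diff) auto
  have "theta u = theta ((u - v) + v)" by simp
  also have "\<dots> = theta (u - v) + theta v" by (rule theta_add[OF m uv(2)])
  finally have "theta (u - v) = 0" using uv(3) by (auto simp: fun_eq_iff)
  then show "u = v" using theta_eq_0[OF m] by simp
qed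

text \<open>By \<open>exact_part\<close> a cycle among the parts covered by \<open>x\<close> is the
  boundary of an element of \<open>part V x\<close>, and conversely boundaries are cycles; so the
  recursive kernels are the images of the parts.\<close>

lemma min_part_iff: "min_part U0 U x w \<longleftrightarrow> w \<in> theta ` part V x"
proof
  show "min_part U0 U x w \<Longrightarrow> w \<in> theta ` part V x"
  proof (induction rule: min_part.induct)
    case (base u)
    then show ?case using psi_U0 theta_bot by force
  next
    case (atom a u)
    then obtain v where v: "v \<in> part V a" "u = \<psi> (diff V v)" using psi_U by blast
    have "{y. y \<lessdot> a} = {bot}" "a \<noteq> bot" using atom(1) by (auto simp: atoms_iff_rk covers_iff_rk)
    then have "diff V v \<in> part V bot" using diff_part[of a] v(1) by (auto simp: sum_parts_singleton)
    then have "theta v = push a (at_base u)" using theta_part[OF v(1) \<open>a \<noteq> bot\<close>] theta_bot v(2) by simp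
    then show ?case using imageI[OF v(1), of theta] by simp
  next
    case (kernel x f)
    let ?Y = "{y. y \<lessdot> x}"
    have "\<forall>y\<in>?Y. \<exists>v\<in>part V y. f y = theta v" using kernel by blast
    then obtain g where g: "\<And>y. y \<in> ?Y \<Longrightarrow> g y \<in> part V y" "\<And>y. y \<in> ?Y \<Longrightarrow> f y = theta (g y)" by metis
    have gt: "\<And>y. y \<in> ?Y \<Longrightarrow> g y \<in> total V" using g(1) part_in_total by blast
    have S: "sum g ?Y \<in> sum_parts V ?Y" using g(1) by (auto simp: sum_parts_def)
    then have St: "sum g ?Y \<in> total V" using parts_mono[of ?Y UNIV] by auto
    have sumf: "sum f ?Y = theta (sum g ?Y)" using g(2) theta_sum[of ?Y g, OF gt] by simp
    then have "theta (diff V (sum g ?Y)) = 0" using kernel min_diff_theta[OF St] by simp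
    then have "diff V (sum g ?Y) = 0" by (intro theta_eq_0 diff_total St)
    moreover have rkx: "1 < rk x" using kernel by blast
    ultimately obtain v where v: "v \<in> part V x" "diff V v = sum g ?Y" using exact_part[OF _ S] by blast
    have "x \<noteq> bot" using rkx by auto
    then have "theta v = push x (sum f ?Y)" using theta_part[OF v(1)] v(2) sumf by simp
    then show ?case using imageI[OF v(1), of theta] by simp
  qed
  have "min_part U0 U x (theta v)" if "v \<in> part V x" for v
    using that
  proof (induction "rk x" arbitrary: x v rule: less_induct)
    case less
    consider "x = bot" | "x \<in> atoms" | "rk x > 1" using atoms_iff_rk[of x] rk_eq_0_iff[of x] by linarith
    then show ?case
    proof cases
      case 1
      then show ?thesis using less.prems theta_bot psi_U0 by (auto intro!: min_part.base)
    next
      case 2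
      have "{y. y \<lessdot> x} = {bot}" "x \<noteq> bot" using 2 by (auto simp: atoms_iff_rk covers_iff_rk)
      then have "diff V v \<in> part V bot" using diff_part[of x] less.prems by (auto simp: sum_parts_singleton)
      then have "theta v = push x (at_base (\<psi> (diff V v)))" using theta_part[OF less.prems \<open>x \<noteq> bot\<close>] theta_bot by simp
      then show ?thesis using psi_U[OF 2] less.prems by (auto intro!: min_part.atom[OF 2])
    next
      case 3
      let ?Y = "{y. y \<lessdot> x}"
      have "diff V v \<in> sum_parts V ?Y" using diff_part less.prems by blast
      then obtain g where g: "diff V v = sum g ?Y" "\<And>y. y \<in> ?Y \<Longrightarrow> g y \<in> part V y"
        by (auto simp: sum_parts_def)
      have v: "v \<in> total V" using less.prems part_in_total by blast
      have s: "theta (diff V v) = (\<Sum>y\<in>?Y. theta (g y))"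
        unfolding g(1) using g(2) part_in_total by (intro theta_sum) blast
      have "x \<noteq> bot" using 3 by auto
      then have "theta v = push x (\<Sum>y\<in>?Y. theta (g y))" using theta_part[OF less.prems] s by simp
      moreover have "min_part U0 U x (push x (\<Sum>y\<in>?Y. theta (g y)))"
      proof (rule min_part.kernel[OF 3])
        show "\<forall>y\<in>?Y. min_part U0 U y (theta (g y))"
        proof
          fix y assume y: "y \<in> ?Y"
          then have "rk y < rk x" using rk_covers[of y x] by simp
          then show "min_part U0 U y (theta (g y))" using g(2)[OF y] by (rule less.hyps)
        qed
        have "min_diff (theta (diff V v)) = theta (diff V (diff V v))" by (rule min_diff_theta[OF diff_total[OF v]])
        then show "min_diff (\<Sum>y\<in>?Y. theta (g y)) = 0" unfolding s[symmetric] diff_diff[OF v] by (simp add: theta_zero)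
      qed
      ultimately show ?thesis by simp
    qed
  qed
  then show "w \<in> theta ` part V x \<Longrightarrow> min_part U0 U x w" by blast
qed

abbreviation W :: "('l list \<Rightarrow> 'u, 'l) lcomplex"
  where "W \<equiv> minimal_complex U0 U"

lemma W_part: "part W x = theta ` part V x"
  by (auto simp: minimal_complex_def min_part_iff)

lemma sum_theta:
  "{\<Sum>x\<in>Q. f x | f. \<forall>x\<in>Q. f x \<in> theta ` part V x} = theta ` sum_parts V Q"
proof (intro equalityI subsetI)
  fix w assume "w \<in> {\<Sum>x\<in>Q. f x | f. \<forall>x\<in>Q. f x \<in> theta ` part V x}"
  then obtain f where f: "w = sum f Q" "\<forall>x\<in>Q. \<exists>v\<in>part V x. f x = theta v" by blast
  then obtain g where g: "\<And>x. x \<in> Q \<Longrightarrow> g x \<in> part V x" "\<And>x. x \<in> Q \<Longrightarrow> f x = theta (g x)" by metis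
  have "g x \<in> total V" if "x \<in> Q" for x using g(1)[OF that] part_in_total by blast
  then have "w = theta (sum g Q)" using f(1) g(2) theta_sum[of Q g] by simp
  then show "w \<in> theta ` sum_parts V Q" using g(1) by (auto simp: sum_parts_def)
next
  fix w assume "w \<in> theta ` sum_parts V Q"
  then obtain f where "w = theta (sum f Q)" "\<And>x. x \<in> Q \<Longrightarrow> f x \<in> part V x" by (auto simp: sum_parts_def)
  then have "w = (\<Sum>x\<in>Q. theta (f x))" "\<forall>x\<in>Q. theta (f x) \<in> theta ` part V x"
    using theta_sum[of Q f] part_in_total by auto
  then show "w \<in> {\<Sum>x\<in>Q. f x | f. \<forall>x\<in>Q. f x \<in> theta ` part V x}" by blast
qed

lemma W_total: "total W = theta ` total V"
  unfolding sum_parts_def[of W] W_part by (rule sum_theta)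

lemma W_chains: "chains W i = theta ` chains V i"
  unfolding chains_eq using sum_theta[of "{x. rk x = i}"] by (simp add: minimal_complex_def min_part_iff)

lemma W_diff: "diff W = min_diff"
  by (simp add: minimal_complex_def)

definition phi :: "('l list \<Rightarrow> 'u) \<Rightarrow> 'v"
  where "phi = the_inv_into (total V) theta"

lemma phi_theta: "v \<in> total V \<Longrightarrow> phi (theta v) = v"
  unfolding phi_def by (rule the_inv_into_f_f[OF theta_inj])

lemma phi_image: "A \<subseteq> total V \<Longrightarrow> phi ` theta ` A = A"
  using phi_theta by (force simp: image_image)

lemma lcomplex_iso_phi: "lcomplex_iso (\<lambda>c w l. su c (w l)) s W V phi"
  unfolding lcomplex_iso_def
proof (intro conjI allI ballI)
  show "linear_on (\<lambda>c w l. su c (w l)) s (total W) phi"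
    unfolding linear_on_def W_total
    by (auto simp: phi_theta subspace_add subspace_scale simp flip: theta_add theta_scale)
  show "bij_betw phi (total W) (total V)"
    unfolding W_total phi_def by (rule bij_betw_the_inv_into) (simp add: bij_betw_def theta_inj)
  show "phi ` chains W i = chains V i" for i
    unfolding W_chains by (rule phi_image[OF chains_subset])
  show "phi ` part W x = part V x" for x
    unfolding W_part by (rule phi_image) (use part_in_total in blast)
  show "phi (diff W v) = diff V (phi v)" if "v \<in> total W" for v
    using that unfolding W_total W_diff by (auto simp: min_diff_theta phi_theta diff_total)
qed

lemma exact_W: "exact_complex W"
  unfolding exact_complex_def
proof (intro ballI)
  fix i assume i: "i \<in> {1..rk (top :: 'l)}"
  have "{v \<in> chains V i. diff V v = 0} = diff V ` chains V (Suc i)"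
    using exact_below[OF i] diff_level[of top i] diff_diff chains_subset[of "Suc i"]
    unfolding chains_eq level_top by blast
  moreover have "{w \<in> chains W i. min_diff w = 0} = theta ` {v \<in> chains V i. diff V v = 0}"
  proof -
    have "min_diff (theta v) = 0 \<longleftrightarrow> diff V v = 0" if "v \<in> chains V i" for v
    proof -
      have v: "v \<in> total V" using that chains_subset by blast
      show ?thesis using min_diff_theta[OF v] theta_eq_0[OF diff_total[OF v]] theta_zero by auto
    qed
    then show ?thesis unfolding W_chains by auto
  qed
  moreover have "min_diff ` chains W (Suc i) = theta ` diff V ` chains V (Suc i)"
    unfolding W_chains image_image using min_diff_theta chains_subset by (intro image_cong) auto
  ultimately show "{v \<in> chains W i. diff W v = 0} = diff W ` chains W (i + 1)"
    by (simp add: W_diff)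
qed

end

section \<open>The degree zero part\<close>

context lgraded
begin

abbreviation comm_rels :: "('v, 'k) fa set"
  where "comm_rels \<equiv> {gen u * gen v - gen v * gen u | u v. u \<in> chains V 0 \<and> v \<in> chains V 0}"

definition Jsym :: "('v, 'k) fa set"
  where "Jsym = tensor_ideal s (chains V 0) comm_rels"

abbreviation sym :: "('v, 'k) fa \<Rightarrow> ('v, 'k) fa"
  where "sym \<equiv> sym_class s (chains V 0)"

lemma subspace_Jsym [simp]: "FA.subspace Jsym"
  by (simp add: Jsym_def)

lemma sym_eq: "sym = quot_map fscale Jsym"
  by (simp add: sym_class_def Jsym_def)

lemma fa_linear_sym: "fa_linear sym"
  unfolding sym_eq by (rule quot_map_fscale(1)[OF subspace_Jsym])

sublocale sym: Vector_Spaces.linear fscale fscale sym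
  by (rule fa_linear_sym)

lemma sym_0_iff: "sym p = 0 \<longleftrightarrow> p \<in> Jsym"
  unfolding sym_eq by (rule quot_map_fscale(3)[OF subspace_Jsym])

lemma sym_eq_iff: "sym p = sym q \<longleftrightarrow> p - q \<in> Jsym"
  using sym_0_iff[of "p - q"] by (simp add: sym.diff)

lemma sym_cong: "p - sym p \<in> Jsym"
  unfolding sym_eq_iff[symmetric] using quot_map_fscale(2)[OF subspace_Jsym] by (simp add: sym_eq)

lemma Jsym_mult:
  "p \<in> Jsym \<Longrightarrow> q \<in> free_alg (chains V 0) \<Longrightarrow> q * p \<in> Jsym"
  "p \<in> Jsym \<Longrightarrow> q \<in> free_alg (chains V 0) \<Longrightarrow> p * q \<in> Jsym"
  unfolding Jsym_def by (rule tensor_ideal_mult_left tensor_ideal_mult_right; assumption)+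

lemma Jsym_comm: "u \<in> chains V 0 \<Longrightarrow> v \<in> chains V 0 \<Longrightarrow> gen u * gen v - gen v * gen u \<in> Jsym"
  unfolding Jsym_def by (rule tensor_ideal_rel) auto

lemma Jsym_gen_0: "gen 0 \<in> Jsym"
proof -
  have "(0 :: 'v) \<in> chains V 0" by (rule subspace_0) simp
  then have "gen (s 0 0) - fscale 0 (gen 0) \<in> (linear_rels s (chains V 0) :: ('v, 'k) fa set)"
    unfolding linear_rels_def by blast
  then have "gen (s 0 0) - fscale 0 (gen 0) \<in> Jsym"
    unfolding Jsym_def by (intro tensor_ideal_rel) blast
  then show ?thesis by simp
qed

lemma Jsym_subset_J: "Jsym \<subseteq> J"
proof
  fix p assume "p \<in> Jsym"
  then have p: "p \<in> tensor_ideal s (chains V 0) comm_rels" by (simp add: Jsym_def)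
  show "p \<in> J"
  proof (rule tensor_ideal_induct[OF fa_linear_id subspace_J p])
    fix a r b
    assume ab: "set a \<subseteq> chains V 0" "set b \<subseteq> chains V 0" and "r \<in> linear_rels s (chains V 0) \<union> comm_rels"
    moreover have "r \<in> J" if "r \<in> linear_rels s (chains V 0)"
    proof -
      have "r \<in> linear_rels s (total V)" using that chains_subset[of 0] unfolding linear_rels_def by blast
      then show ?thesis unfolding J_def by (intro tensor_ideal_rel) simp
    qed
    moreover have "r \<in> J" if "r \<in> comm_rels"
      using that J_super[of _ 0 _ 0] by auto
    ultimately have "r \<in> J" by blast
    then show "word a * r * word b \<in> J"
      using ab chains_subset[of 0] by (intro J_mult_left J_mult_right) auto
  qed
qed

lemma sym_gen_commute:
  assumes "u \<in> chains V 0" "set rs \<subseteq> chains V 0"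
  shows "gen u * word rs - word rs * gen u \<in> Jsym"
  using assms(2)
proof (induction rs)
  case Nil
  show ?case by (simp add: word_Nil FA.subspace_0)
next
  case (Cons r rs)
  have "(gen u * gen r - gen r * gen u) * word rs + gen r * (gen u * word rs - word rs * gen u) \<in> Jsym"
    using Cons assms(1) by (intro FA.subspace_add subspace_Jsym Jsym_mult Jsym_comm) auto
  then show ?case by (simp add: word_Cons[of r rs] left_diff_distrib right_diff_distrib mult.assoc)
qed

lemma rho_bot_free_alg: "p \<in> tensors \<Longrightarrow> rho bot p \<in> free_alg (chains V 0)"
proof (rule hom_free_alg)
  have "linear_on s s (total V) (diag (\<lambda>x. of_bool (x \<le> bot)))" by (rule diag_linear)
  then show "diag (\<lambda>x. of_bool (x \<le> bot)) ` total V \<subseteq> chains V 0"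
  proof (rule linear_on_sum_parts_into)
    show "diag (\<lambda>x. of_bool (x \<le> bot)) ` part V x \<subseteq> chains V 0" for x
      using diag_part[of _ x "\<lambda>x. of_bool (x \<le> bot)"] bot.extremum_uniqueI[of x]
      by (cases "x = bot") (auto simp: chains_0 subspace_0)
  qed simp_all
qed

lemma rho_bot_id: "p \<in> free_alg (chains V 0) \<Longrightarrow> rho bot p = p"
proof -
  assume p: "p \<in> free_alg (chains V 0)"
  have "rho bot p - p \<in> {0}"
  proof (rule free_alg_into[OF fa_linear_diff[OF fa_linear_hom fa_linear_id] FA.subspace_single_0 p])
    fix rs assume "set rs \<subseteq> chains V 0"
    then have "map (diag (\<lambda>x. of_bool (x \<le> bot))) rs = rs"
      using diag_part[of _ bot] by (intro map_idI) (auto simp: chains_0)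
    then show "rho bot (word rs) - word rs \<in> {0}" by simp
  qed
  then show ?thesis by simp
qed

text \<open>With \<open>Jsym_subset_J\<close> this shows that S imposes no further relations on
  letters of degree zero: a supercommutation relation becomes a commutator of such letters or, if it
  involves a positive degree, a combination of products with the letter \<open>0\<close>.\<close>

lemma rho_bot_J:
  assumes "p \<in> J" shows "rho bot p \<in> Jsym"
  unfolding Jsym_def
proof (rule hom_tensor_ideal[OF diag_linear _ _ assms[unfolded J_def]])
  let ?f = "diag (\<lambda>x. of_bool (x \<le> bot))"
  have gens: "gen v \<in> tensors" if "v \<in> total V" for v using that by simp
  have f: "?f v \<in> chains V 0" if "v \<in> total V" for v
    using rho_bot_free_alg[OF gens[OF that]] by simp
  then show "?f ` total V \<subseteq> chains V 0" by blast
  fix r :: "('v, 'k) fa"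
  assume "r \<in> super_rels"
  then obtain u v i j where r: "r = gen u * gen v - (- 1) ^ (i * j) * (gen v * gen u)" "u \<in> chains V i" "v \<in> chains V j"
    unfolding super_rels_def by blast
  have uv: "?f u \<in> chains V 0" "?f v \<in> chains V 0" using f r chains_subset by blast+
  have eq: "rho bot r = gen (?f u) * gen (?f v) - fscale ((- 1) ^ (i * j)) (gen (?f v) * gen (?f u))"
    by (simp add: r(1) fscale_neg_one hom.diff hom.scale hom_mult)
  have zero: "?f w = 0" if "w \<in> chains V n" "n \<noteq> 0" for w n
  proof -
    have "of_bool (x \<le> bot) = (0 :: 'k)" if "rk x = n" for x :: 'l
      using that \<open>n \<noteq> 0\<close> bot.extremum_uniqueI[of x] by auto
    then show ?thesis using diag_chains_const[of n _ 0 w] that(1) by simp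
  qed
  have "rho bot r \<in> Jsym"
  proof (cases "i = 0 \<and> j = 0")
    case True
    then show ?thesis using Jsym_comm[OF uv] by (simp add: eq)
  next
    case False
    then have "?f u = 0 \<or> ?f v = 0" using zero r by blast
    then have "gen (?f u) * gen (?f v) \<in> Jsym" "gen (?f v) * gen (?f u) \<in> Jsym"
      using uv Jsym_gen_0 Jsym_mult[OF Jsym_gen_0] by auto
    then show ?thesis unfolding eq by (intro FA.subspace_diff[OF subspace_Jsym] FA.subspace_scale[OF subspace_Jsym])
  qed
  then show "rho bot r \<in> tensor_ideal s (chains V 0) comm_rels" by (simp add: Jsym_def)
qed

text \<open>\<open>rho_K\<close> and \<open>K_bot\<close> give membership in \<open>J\<close> only.
  A second application of \<open>rho bot\<close>, which changes nothing any more, sharpens this to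
  \<open>Jsym\<close>.\<close>

lemma rho_bot_K: "p \<in> K top \<Longrightarrow> rho bot p \<in> Jsym"
proof -
  assume p: "p \<in> K top"
  then have "rho bot p \<in> J" using rho_K[of p top bot] K_bot by auto
  then have "rho bot (rho bot p) \<in> Jsym" by (rule rho_bot_J)
  then show ?thesis unfolding rho_bot_id[OF rho_bot_free_alg[OF subsetD[OF K_free_alg p]]] .
qed

section \<open>Identification with the symmetric algebra\<close>

text \<open>A representative \<open>P p\<close> may contain letters of positive degree even if
  \<open>p\<close> does not, hence \<open>rho bot\<close> before \<open>sym\<close>.\<close>

definition psi :: "('v, 'k) fa \<Rightarrow> ('v, 'k) fa"
  where "psi a = sym (rho bot a)"

lemma fa_linear_psi: "fa_linear psi"
  unfolding psi_def by (rule fa_linear_compose[OF fa_linear_hom fa_linear_sym])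

sublocale psi: Vector_Spaces.linear fscale fscale psi
  by (rule fa_linear_psi)

lemma psi_P: "psi (P p) = psi p"
proof -
  have "rho bot p - rho bot (P p) \<in> Jsym" using rho_bot_K[OF P_cong[of p]] by (simp add: hom.diff)
  then show ?thesis by (simp add: psi_def sym_eq_iff[symmetric])
qed

lemma psi_sym: "p \<in> free_alg (chains V 0) \<Longrightarrow> psi p = sym p"
  by (simp add: psi_def rho_bot_id)

lemma psi_J: "p \<in> J \<Longrightarrow> psi p = 0"
  unfolding psi_def by (simp add: sym_0_iff rho_bot_J)

lemma hspan_bot: "hspan {xs. Sup (set xs) = bot} = free_alg (chains V 0)"
proof -
  have "rs \<in> lists (chains V 0) \<longleftrightarrow> (\<exists>xs\<in>{xs. Sup (set xs) = bot}. homogeneous rs xs)" for rs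
  proof
    assume "rs \<in> lists (chains V 0)"
    then have "homogeneous rs (replicate (length rs) bot)"
      by (auto simp: list_all2_conv_all_nth chains_0)
    moreover have "Sup (set (replicate (length rs) (bot :: 'l))) = bot"
      by (rule bot.extremum_uniqueI, rule Sup_least) auto
    ultimately show "\<exists>xs\<in>{xs. Sup (set xs) = bot}. homogeneous rs xs" by blast
  next
    assume "\<exists>xs\<in>{xs. Sup (set xs) = bot}. homogeneous rs xs"
    then obtain xs where xs: "Sup (set xs) = bot" "homogeneous rs xs" by blast
    have "x = bot" if "x \<in> set xs" for x using Sup_upper[OF that] xs(1) bot.extremum_uniqueI by metis
    then show "rs \<in> lists (chains V 0)" using xs(2)
      by (auto simp: list_all2_conv_all_nth chains_0 in_set_conv_nth lists_eq_set) (metis nth_mem)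
  qed
  then have "lists (chains V 0) = {rs. \<exists>xs\<in>{xs. Sup (set xs) = bot}. homogeneous rs xs}" by blast
  then show ?thesis unfolding hspan_def free_alg_eq_wspan by simp
qed

lemma OS_part_bot: "part OS bot = P ` free_alg (chains V 0)"
  unfolding OS_part hspan_bot ..

lemma psi_inj: "inj_on psi (part OS bot)"
proof (rule psi.inj_on_iff_eq_0[THEN iffD2])
  show "\<forall>a\<in>part OS bot. psi a = 0 \<longrightarrow> a = 0"
  proof (intro ballI impI)
    fix a assume "a \<in> part OS bot" "psi a = 0"
    then obtain p where p: "a = P p" "p \<in> free_alg (chains V 0)" "psi p = 0" by (auto simp: OS_part_bot psi_P)
    then have "p \<in> Jsym" using psi_sym sym_0_iff by simp
    then show "a = 0" using p(1) P_J Jsym_subset_J by auto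
  qed
qed simp

lemma psi_image: "psi ` part OS bot = Sym s (chains V 0)"
  unfolding Sym_def OS_part_bot image_image psi_P using psi_sym by (rule image_cong[OF refl])

lemma D_word_bot:
  assumes "set rs \<subseteq> chains V 0" shows "der_word parity (diff V) rs \<in> J"
  using assms
proof (induction rs)
  case (Cons r rs)
  have r: "r \<in> total V" "parity r = r" "diff V r = 0"
    using Cons.prems chains_subset[of 0] diag_part[of r bot] diff_bot by (auto simp: chains_0)
  have "gen 0 * word rs + gen r * der_word parity (diff V) rs \<in> J"
    using Cons r(1) chains_subset[of 0] by (intro J_add J_mult_left J_mult_right J_gen_0) auto
  then show ?case by (simp add: r word_mult)
qed (simp add: J_0)

text \<open>Letters of degree zero are fixed by parity and have boundary 0, so modulo
  \<open>J\<close> one summand survives, without sign.\<close>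

lemma D_word_atom:
  assumes rs: "set r1 \<subseteq> chains V 0" "set r2 \<subseteq> chains V 0" and v: "v \<in> part V a" "a \<in> atoms"
  shows "D (word (r1 @ v # r2)) - word r1 * gen (diff V v) * word r2 \<in> J"
proof -
  have t: "v \<in> total V" "parity v \<in> total V" "diff V v \<in> total V" "set r1 \<subseteq> total V" "set r2 \<subseteq> total V"
    using v(1) part_in_total diag_parts[of v UNIV] diff_total rs chains_subset[of 0] by blast+
  have p1: "map parity r1 = r1" using rs(1) diag_part[of _ bot] by (intro map_idI) (auto simp: chains_0)
  have "(der_word parity (diff V) (r1 @ v # r2) :: ('v, 'k) fa) = der_word parity (diff V) r1 * word (v # r2)
      + word r1 * (gen (diff V v) * word r2 + gen (parity v) * der_word parity (diff V) r2)"
    by (simp add: der_word_append p1 word_mult)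
  moreover have "der_word parity (diff V) r1 * word (v # r2) + word r1 * (gen (parity v) * der_word parity (diff V) r2) \<in> J"
    using D_word_bot rs t by (intro J_add J_mult_left J_mult_right) auto
  ultimately show ?thesis by (simp add: distrib_left mult.assoc word_Nil)
qed

lemma diff_atom: "v \<in> part V a \<Longrightarrow> a \<in> atoms \<Longrightarrow> diff V v \<in> chains V 0"
proof -
  assume "v \<in> part V a" "a \<in> atoms"
  moreover have "{y. y \<lessdot> a} = {bot}" using \<open>a \<in> atoms\<close> by (auto simp: atoms_iff_rk covers_iff_rk)
  ultimately show ?thesis using diff_part[of a] by (auto simp: sum_parts_singleton chains_0)
qed

lemma psi_D_word_atom:
  assumes rs: "set r1 \<subseteq> chains V 0" "set r2 \<subseteq> chains V 0" and v: "v \<in> part V a" "a \<in> atoms"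
  shows "psi (D (word (r1 @ v # r2))) = sym (word (r1 @ r2) * gen (diff V v))"
proof -
  have "psi (D (word (r1 @ v # r2))) = psi (word r1 * gen (diff V v) * word r2)"
    using psi_J[OF D_word_atom[OF assms]] by (simp add: psi.diff)
  also have "\<dots> = sym (word r1 * gen (diff V v) * word r2)"
    using rs diff_atom[OF v] by (intro psi_sym free_alg_mult) auto
  also have "\<dots> = sym (word (r1 @ r2) * gen (diff V v))"
  proof -
    have "word r1 * (gen (diff V v) * word r2 - word r2 * gen (diff V v)) \<in> Jsym"
      using rs diff_atom[OF v] by (intro Jsym_mult sym_gen_commute) auto
    then show ?thesis unfolding sym_eq_iff by (simp add: right_diff_distrib mult.assoc flip: word_mult)
  qed
  finally show ?thesis .
qed

lemma split_atom_list:
  assumes "sum_list (map rk xs) = 1"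
  shows "\<exists>a ys zs. xs = ys @ a # zs \<and> rk a = 1 \<and> set ys \<subseteq> {bot :: 'l} \<and> set zs \<subseteq> {bot}"
  using assms
proof (induction xs)
  case (Cons x xs)
  show ?case
  proof (cases "x = bot")
    case True
    then have "sum_list (map rk xs) = 1" using Cons.prems by simp
    then obtain a ys zs where "xs = ys @ a # zs" "rk a = 1" "set ys \<subseteq> {bot}" "set zs \<subseteq> {bot}"
      using Cons.IH by blast
    then have "x # xs = (x # ys) @ a # zs \<and> rk a = 1 \<and> set (x # ys) \<subseteq> {bot} \<and> set zs \<subseteq> {bot}" using True by simp
    then show ?thesis by blast
  next
    case False
    then have "rk x \<noteq> 0" by simp
    then have "rk x = 1" "sum_list (map rk xs) = 0" using Cons.prems by (simp_all only: list.map sum_list.Cons)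
    moreover from this have "set xs \<subseteq> {bot}" by (auto simp: sum_list_eq_0_iff)
    ultimately have "x # xs = [] @ x # xs \<and> rk x = 1 \<and> set [] \<subseteq> {bot :: 'l} \<and> set xs \<subseteq> {bot}" by simp
    then show ?thesis by blast
  qed
qed simp

text \<open>An independent word with join \<open>a\<close> has rank sum 1, hence one letter from
  \<open>part V a\<close> among letters of degree zero. Its boundary is a multiple of the boundary
  of that letter, and all such multiples occur.\<close>

lemma psi_diff_atom:
  assumes a: "a \<in> atoms"
  shows "psi ` diff OS ` part OS a = Sym_ideal s (chains V 0) (diff V ` part V a)"
proof -
  let ?G = "{sym (b * sym (gen y)) | b y. b \<in> Sym s (chains V 0) \<and> y \<in> diff V ` part V a}"
  let ?H = "{xs \<in> {xs. Sup (set xs) = a}. \<not> lattice_dependent xs}"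
  define T where "T p = psi (D p)" for p :: "('v, 'k) fa"
  have T: "fa_linear T" unfolding T_def by (rule fa_linear_compose[OF fa_linear_der fa_linear_psi])
  have PT: "psi ` diff OS ` part OS a = T ` hspan ?H"
  proof -
    have "diff OS (P p) = P (D p)" if "p \<in> hspan ?H" for p using OS_diff that hspan_free_alg by blast
    then show ?thesis
      unfolding OS_part P_hspan_independent[of "{xs. Sup (set xs) = a}"] image_image
      by (intro image_cong) (simp_all add: psi_P T_def)
  qed
  \<comment> \<open>Products in \<open>Sym\<close> are formed from the chosen representatives;
    exchanging them for \<open>q\<close> and the letter changes the product by an element of
    \<open>Jsym\<close>.\<close>
  have G: "sym (q * gen (diff V v)) = sym (sym q * sym (gen (diff V v)))"
    if "q \<in> free_alg (chains V 0)" "v \<in> part V a" for q v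
  proof -
    have y: "gen (diff V v) \<in> (free_alg (chains V 0) :: ('v, 'k) fa set)" using diff_atom[OF that(2) a] by simp
    have "comm_rels \<subseteq> free_alg (chains V 0)"
      by (auto intro!: FA.subspace_diff[OF subspace_free_alg] free_alg_mult)
    then have "Jsym \<subseteq> free_alg (chains V 0)" unfolding Jsym_def
      by (intro tensor_ideal_free_alg) (auto intro: subspace_add subspace_scale)
    then have "sym q \<in> free_alg (chains V 0)"
      using FA.subspace_diff[OF subspace_free_alg that(1), of "q - sym q"] sym_cong by auto
    then have "(q - sym q) * gen (diff V v) + sym q * (gen (diff V v) - sym (gen (diff V v))) \<in> Jsym"
      using y by (intro FA.subspace_add[OF subspace_Jsym] Jsym_mult sym_cong)
    then show ?thesis unfolding sym_eq_iff by (simp add: left_diff_distrib right_diff_distrib)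
  qed
  have ra: "rk a = 1" using a by (simp add: atoms_iff_rk)
  show ?thesis unfolding PT Sym_ideal_def
  proof
    show "T ` hspan ?H \<subseteq> FA.span ?G"
    proof
      fix w assume "w \<in> T ` hspan ?H"
      then obtain p where p: "w = T p" "p \<in> hspan ?H" by blast
      show "w \<in> FA.span ?G" unfolding p(1)
      proof (rule hspan_into[OF T _ p(2)])
        fix rs xs assume rs: "homogeneous rs xs" and xs: "xs \<in> ?H"
        then have "sum_list (map rk xs) = 1" using ra not_lattice_dependent_iff[of xs] by simp
        then obtain b ys zs where b: "xs = ys @ b # zs" "rk b = 1" "set ys \<subseteq> {bot}" "set zs \<subseteq> {bot}"
          using split_atom_list by blast
        have "b \<le> a" using xs b(1) Sup_upper[of b "set xs"] by auto
        then have "b = a" using rk_less[of b a] b(2) ra by (auto simp: order.order_iff_strict)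
        then have "homogeneous rs (ys @ a # zs)" using rs b(1) by simp
        then obtain r1 v r2 where r: "rs = r1 @ v # r2" "homogeneous r1 ys" "v \<in> part V a"
            "homogeneous r2 zs"
          by (auto simp: list_all2_append2 list_all2_Cons2)
        have bots: "set us \<subseteq> chains V 0" if "homogeneous us ws" "set ws \<subseteq> {bot}" for us ws
          using that by (induction rule: list_all2_induct) (auto simp: chains_0)
        have r12: "set r1 \<subseteq> chains V 0" "set r2 \<subseteq> chains V 0" using bots r b by auto
        have q: "word (r1 @ r2) \<in> (free_alg (chains V 0) :: ('v, 'k) fa set)" using r12 by simp
        have "T (word rs) = sym (sym (word (r1 @ r2)) * sym (gen (diff V v)))"
          unfolding T_def r(1) psi_D_word_atom[OF r12 r(3) a] by (rule G[OF q r(3)])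
        moreover have "sym (word (r1 @ r2)) \<in> Sym s (chains V 0)" unfolding Sym_def using q by blast
        ultimately show "T (word rs) \<in> FA.span ?G" using r(3) by (intro FA.span_base) auto
      qed simp
    qed
    show "FA.span ?G \<subseteq> T ` hspan ?H"
    proof (rule FA.span_minimal)
      show "FA.subspace (T ` hspan ?H)" by (rule FA2.linear_subspace_image[OF T]) simp
      show "?G \<subseteq> T ` hspan ?H"
      proof
        fix w assume "w \<in> ?G"
        then obtain q v where q: "q \<in> free_alg (chains V 0)" "v \<in> part V a" "w = sym (sym q * sym (gen (diff V v)))"
          by (auto simp: Sym_def)
        have "sym (q * gen (diff V v)) \<in> T ` hspan ?H"
        proof (rule free_alg_into[OF fa_linear_compose[OF fa_linear_mult_right fa_linear_sym] _ q(1)])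
          show "FA.subspace (T ` hspan ?H)" by (rule FA2.linear_subspace_image[OF T]) simp
          fix rs assume rs: "set rs \<subseteq> chains V 0"
          have "sym (word rs * gen (diff V v)) = T (word (rs @ v # []))"
            unfolding T_def using psi_D_word_atom[OF rs _ q(2) a, of "[]"] by simp
          moreover have "word (rs @ v # []) \<in> hspan ?H"
          proof (rule hspan_word)
            let ?xs = "replicate (length rs) bot @ [a]"
            show "homogeneous (rs @ v # []) ?xs"
            proof -
              have "homogeneous rs (replicate (length rs) bot)"
                using rs by (auto simp: list_all2_conv_all_nth chains_0)
              then show ?thesis using q(2) by (simp add: list_all2_append)
            qed
            have "Sup (set ?xs) = a" by (rule antisym) (auto intro!: Sup_least Sup_upper)
            moreover have "sum_list (map rk ?xs) = 1" using ra by (simp add: sum_list_replicate)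
            ultimately show "?xs \<in> ?H" using ra not_lattice_dependent_iff[of ?xs] by simp
          qed
          ultimately show "sym (word rs * gen (diff V v)) \<in> T ` hspan ?H" by (rule image_eqI)
        qed
        then show "w \<in> T ` hspan ?H" using G[OF q(1,2)] q(3) by simp
      qed
    qed
  qed
qed

lemma contractible_lgraded_OS:
  assumes "L_contractible s V"
  shows "contractible_lgraded fscale OS fscale (Sym s (chains V 0))
    (\<lambda>a. Sym_ideal s (chains V 0) (diff V ` part V a)) psi"
proof (intro contractible_lgraded.intro contractible_lgraded_axioms.intro lgraded_OS L_contractible_OS[OF assms]
    vector_space_fscale psi_inj psi_image psi_diff_atom)
  show "linear_on fscale fscale (part OS bot) psi" by (simp add: linear_on_def psi.add psi.scale)
qed

end

theorem proposition5p4: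
  fixes s :: "'k::field_char_0 \<Rightarrow> 'v::ab_group_add \<Rightarrow> 'v"
    and V :: "('v, 'l::geometric_lattice) lcomplex"
  assumes "vector_space s"
    and "graded_complex s top V"
    and "L_contractible s V"
  shows "L_contractible fscale (OS_algebra s V) \<and>
    ((\<forall>a\<in>atoms. inj_on (diff V) (part V a)) \<longrightarrow>
      (let W = minimal_complex (Sym s (chains V 0))
                 (\<lambda>a. Sym_ideal s (chains V 0) (diff V ` part V a))
       in (\<exists>\<phi>. lcomplex_iso (\<lambda>c w l. fscale c (w l)) fscale W (OS_algebra s V) \<phi> \<and>
            (\<forall>p\<in>free_alg (chains V 0).
              \<phi> (at_base (sym_class s (chains V 0) p)) = OS_class s V (S_class s V p))) \<and>
          exact_complex W))"
proof -
  interpret lgraded s V by (intro lgraded.intro lgraded_axioms.intro assms)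
  interpret M: contractible_lgraded fscale OS fscale "Sym s (chains V 0)"
    "\<lambda>a. Sym_ideal s (chains V 0) (diff V ` part V a)" psi
    by (rule contractible_lgraded_OS[OF assms(3)])
  have "M.phi (at_base (sym p)) = OS_class s V (S_class s V p)" if p: "p \<in> free_alg (chains V 0)" for p
  proof -
    have b: "P p \<in> part OS bot" using p by (simp add: OS_part_bot)
    have "M.theta (P p) = at_base (sym p)" using M.theta_bot[OF b] by (simp add: psi_P psi_sym p)
    then show ?thesis using M.phi_theta[OF M.part_in_total[OF b]] by (simp add: P_def)
  qed
  then show ?thesis
    unfolding Let_def using L_contractible_OS[OF assms(3)] M.lcomplex_iso_phi M.exact_W by blast
qed

end
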